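(* Let $\mathfrak G=(G_2\xrightarrow{\partial}G_1)$ be a $\mathbb Z_2$-graded crossed module with $G_1$ finite, and let $A$ be an N-weak $\mathfrak G$-algebra over a field $\mathbb K$. (i) If $A$ is split semisimple, then there exists a strict split semisimple $\mathfrak G$-algebra $B$ which is $\mathfrak G$-Morita equivalent to $A$. (ii) In general, there exist a $\mathbb Z_2$-graded crossed module $\mathfrak H$, a strict homomorphism of $\mathbb Z_2$-graded crossed modules $\varphi:\mathfrak H\to\mathfrak G$ inducing an equivalence $\widetilde{\mathfrak H}\simeq\widetilde{\mathfrak G}$ of $\mathbb Z_2$-graded $2$-groups, and a strict $\mathfrak H$-algebra $B$ such that $B$ is $\mathfrak H$-Morita equivalent to $A$ (where $A$ is regarded as an N-weak $\mathfrak H$-algebra by pulling its structure back along $\varphi$).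
   Context: Crossed modules. A crossed module $\mathfrak G=(G_2\xrightarrow{\partial}G_1)$ consists of groups $G_1,G_2$, an action $(g,x)\mapsto{}^gx$ of $G_1$ on $G_2$ by automorphisms and a homomorphism $\partial$ with $\partial({}^gx)=g\partial(x)g^{-1}$ and ${}^{\partial(y)}x=yxy^{-1}$. Let $\mathbb Z_2=\{\pm1\}$. A $\mathbb Z_2$-grading is a homomorphism $\pi:G_1\to\mathbb Z_2$ (possibly trivial) with $\operatorname{im}\partial\le\ker\pi=:G_0$; strict homomorphisms of $\mathbb Z_2$-graded crossed modules are pairs of group homomorphisms compatible with $\partial$, the actions and $\pi$. The associated $2$-group $\widetilde{\mathfrak G}$ has one object, $1$-morphisms the elements of $G_1$, $2$-morphisms $x:g\Rightarrow\partial(x)g$ ($x\in G_2$), vertical composition $x_2x_1$, and horizontal composition of $x:g_1\Rightarrow g_2$ with $x':g_1'\Rightarrow g_2'$ equal to $x\cdot{}^{g_1}x'$; it is $\mathbb Z_2$-graded by $\pi$. N-weak algebras. Algebras are associative unital $\mathbb K$-algebras; ${}^{+1}A=A$, ${}^{-1}A=A^{\mathrm{op}}$. $\mathrm{Aut}^{\mathrm{gen}}(A)$ is the group of all algebra isomorphisms $A\to A$ (degree $+1$) and $A^{\mathrm{op}}\to A$ (degree $-1$) under composition of maps, graded by $\pi$. It acts on $A^\times$ by ${}^gy=g(y^{\pi(g)})$, and $\partial:A^\times\to\mathrm{Aut}^{\mathrm{gen}}(A)$ is $\partial(y)(a)=yay^{-1}$. An N-weak $\mathfrak G$-algebra is an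 algebra $A$ with maps $\omega_3:G_1\times G_1\to A^\times$ (equal to $1$ if one argument is $e$), $\omega_1:G_1\to\mathrm{Aut}^{\mathrm{gen}}(A)$ degree preserving and unital, $\omega_2:G_2\to A^\times$ unital, such that $\omega_1(g_2g_1)=\partial(\omega_3(g_2,g_1))\omega_1(g_2)\omega_1(g_1)$; $\omega_2(x_2x_1)=\omega_3(\partial x_2,\partial x_1)\omega_2(x_2)\omega_2(x_1)$; $\omega_1\circ\partial=\partial\circ\omega_2$; $\omega_3(g_3g_2,g_1)\omega_3(g_3,g_2)=\omega_3(g_3,g_2g_1)\cdot{}^{\omega_1(g_3)}\omega_3(g_2,g_1)$; $\omega_2({}^gx)=\omega_3(g\partial x,g^{-1})\,\omega_3(g,\partial x)\cdot{}^{\omega_1(g)}\omega_2(x)\,\omega_3(g,g^{-1})^{-1}$. It is strict if $\omega_3\equiv1$ (then it is called a $\mathfrak G$-algebra). Split semisimple means isomorphic as an algebra to a finite product of matrix algebras over $\mathbb K$. Morita equivalence. For a $B$-$A$-bimodule $M$ put $M^\circ=\mathrm{Hom}_{\mathrm{Mod}\text{-}A}(M,A)$, viewed as a $B^{\mathrm{op}}$-$A^{\mathrm{op}}$-bimodule; ${}^{+1}M=M$, ${}^{-1}M=M^\circ$; $\mathrm{ev}_M:M\to M^{\circ\circ}$ is evaluation. For N-weak $\mathfrak G$-algebras $A,B$, a $1$-morphism $(M,\omega_M):A\to B$ is a $B$-$A$-bimodule $M$ with $\mathbb K$-linear isomorphisms $\omega_M(g):{}^{\pi(g)}M\to M$ ($g\in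 G_1$), $\omega_M(e)=\mathrm{id}$, such that (a) $\omega_M(g)(bma)=\omega_{B,1}(g)(b)\,\omega_M(g)(m)\,\omega_{A,1}(g)(a)$ for $a\in{}^{\pi(g)}A$, $m\in{}^{\pi(g)}M$, $b\in{}^{\pi(g)}B$; (b) $\omega_M(g_2g_1)(m)=\omega_{B,3}(g_2,g_1)\cdot\omega_M(g_2)\big(\omega_M(g_1)^{[g_2]}(m)\big)\cdot\omega_{A,3}(g_2,g_1)^{-1}$, where $\omega_M(g_1)^{[g_2]}=\omega_M(g_1)$ if $\pi(g_2)=1$, and if $\pi(g_2)=-1$ it is the map $({}^{\pi(g_1)}M)^\circ\to M^\circ$, $\mathfrak m\mapsto\omega_{A,1}(g_1)\circ\mathfrak m\circ\omega_M(g_1)^{-1}$, precomposed with $\mathrm{ev}_M$ when also $\pi(g_1)=-1$; (c) $\omega_M(\partial x)(m)=\omega_{B,2}(x)\,m\,\omega_{A,2}(x)^{-1}$ for $x\in G_2$. $A$ and $B$ are $\mathfrak G$-Morita equivalent if there is such a $1$-morphism whose underlying bimodule $M$ is invertible (a Morita equivalence); for separable algebras this is equivalence in the bicategory of separable N-weak $\mathfrak G$-algebras and these $1$-morphisms. *)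

theory Defs
  imports
    "HOL-Algebra.Free_Abelian_Groups"
    "HOL-Algebra.Sym_Groups"
    "HOL-Algebra.QuotRing"
    "HOL-Algebra.Module"
begin

section \<open>Graded crossed modules\<close>

record ('g, 'x) xmod =
  grp1 :: "'g monoid"
  grp2 :: "'x monoid"
  bdry :: "'x \<Rightarrow> 'g"
  actn :: "'g \<Rightarrow> 'x \<Rightarrow> 'x"
  grading :: "'g \<Rightarrow> int"

text \<open>The group \<^const>\<open>sign_img\<close> is the multiplicative group of the integers 1 and -1.\<close>

locale graded_crossed_module =
  fixes X :: "('g, 'x) xmod"
  assumes group1: "group (grp1 X)"
    and group2: "group (grp2 X)"
    and actn_hom: "g \<in> carrier (grp1 X) \<Longrightarrow> actn X g \<in> hom (grp2 X) (grp2 X)"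
    and actn_one: "x \<in> carrier (grp2 X) \<Longrightarrow> actn X \<one>\<^bsub>grp1 X\<^esub> x = x"
    and actn_mult:
      "\<lbrakk>g \<in> carrier (grp1 X); h \<in> carrier (grp1 X); x \<in> carrier (grp2 X)\<rbrakk>
        \<Longrightarrow> actn X (g \<otimes>\<^bsub>grp1 X\<^esub> h) x = actn X g (actn X h x)"
    and bdry_hom: "bdry X \<in> hom (grp2 X) (grp1 X)"
    and bdry_actn:
      "\<lbrakk>g \<in> carrier (grp1 X); x \<in> carrier (grp2 X)\<rbrakk>
        \<Longrightarrow> bdry X (actn X g x) = g \<otimes>\<^bsub>grp1 X\<^esub> bdry X x \<otimes>\<^bsub>grp1 X\<^esub> inv\<^bsub>grp1 X\<^esub> g"
    and peiffer:
      "\<lbrakk>x \<in> carrier (grp2 X); y \<in> carrier (grp2 X)\<rbrakk>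
        \<Longrightarrow> actn X (bdry X y) x = y \<otimes>\<^bsub>grp2 X\<^esub> x \<otimes>\<^bsub>grp2 X\<^esub> inv\<^bsub>grp2 X\<^esub> y"
    and grading_hom: "grading X \<in> hom (grp1 X) sign_img"
    and grading_bdry: "x \<in> carrier (grp2 X) \<Longrightarrow> grading X (bdry X x) = 1"

definition xmod_hom ::
    "('h, 'y) xmod \<Rightarrow> ('g, 'x) xmod \<Rightarrow> ('h \<Rightarrow> 'g) \<Rightarrow> ('y \<Rightarrow> 'x) \<Rightarrow> bool" where
  "xmod_hom Y X \<phi>1 \<phi>2 \<longleftrightarrow>
     \<phi>1 \<in> hom (grp1 Y) (grp1 X) \<and> \<phi>2 \<in> hom (grp2 Y) (grp2 X) \<and>
     (\<forall>y\<in>carrier (grp2 Y). \<phi>1 (bdry Y y) = bdry X (\<phi>2 y)) \<and>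
     (\<forall>h\<in>carrier (grp1 Y). \<forall>y\<in>carrier (grp2 Y). \<phi>2 (actn Y h y) = actn X (\<phi>1 h) (\<phi>2 y)) \<and>
     (\<forall>h\<in>carrier (grp1 Y). grading X (\<phi>1 h) = grading Y h)"


section \<open>Graded 2-groups and their equivalences\<close>

text \<open>
  The data of a strict one-object 2-category: the monoid part consists of the 1-morphisms,
  \<open>cells\<close> are the 2-morphisms. Both compositions are written in the order of function
  composition, so \<open>vcomp P d c\<close> is \<open>c\<close> followed by \<open>d\<close>.
\<close>

record ('g, 'c) two_group = "'g monoid" +
  cells :: "'c set"
  src :: "'c \<Rightarrow> 'g"
  tgt :: "'c \<Rightarrow> 'g"
  idc :: "'g \<Rightarrow> 'c"
  vcomp :: "'c \<Rightarrow> 'c \<Rightarrow> 'c"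
  hcomp :: "'c \<Rightarrow> 'c \<Rightarrow> 'c"
  degr :: "'g \<Rightarrow> int"

text \<open>The pair \<open>(g, x)\<close> is the 2-morphism \<open>x : g \<Rightarrow> \<partial>(x)g\<close>.\<close>

definition two_group_of :: "('g, 'x) xmod \<Rightarrow> ('g, 'g \<times> 'x) two_group" where
  "two_group_of X =
    \<lparr>carrier = carrier (grp1 X), monoid.mult = monoid.mult (grp1 X), one = \<one>\<^bsub>grp1 X\<^esub>,
     cells = carrier (grp1 X) \<times> carrier (grp2 X),
     src = fst,
     tgt = (\<lambda>(g, x). bdry X x \<otimes>\<^bsub>grp1 X\<^esub> g),
     idc = (\<lambda>g. (g, \<one>\<^bsub>grp2 X\<^esub>)),
     vcomp = (\<lambda>(g2, x2) (g1, x1). (g1, x2 \<otimes>\<^bsub>grp2 X\<^esub> x1)),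
     hcomp = (\<lambda>(g, x) (g', x'). (g \<otimes>\<^bsub>grp1 X\<^esub> g', x \<otimes>\<^bsub>grp2 X\<^esub> actn X g x')),
     degr = grading X\<rparr>"

text \<open>
  Homomorphisms of graded 2-groups are pseudofunctors of one-object 2-categories that
  preserve the degree; \<open>mlt F g h : F g \<otimes> F h \<Rightarrow> F (g \<otimes> h)\<close> and \<open>unt F : \<one> \<Rightarrow> F \<one>\<close> are the
  compositors (invertible, as all 2-morphisms are).
\<close>

record ('g, 'c, 'h, 'd) two_group_map =
  on1 :: "'g \<Rightarrow> 'h"
  on2 :: "'c \<Rightarrow> 'd"
  mlt :: "'g \<Rightarrow> 'g \<Rightarrow> 'd"
  unt :: 'd

definition two_group_hom ::
    "('g, 'c) two_group \<Rightarrow> ('h, 'd) two_group \<Rightarrow> ('g, 'c, 'h, 'd) two_group_map \<Rightarrow> bool" where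
  "two_group_hom P Q F \<longleftrightarrow>
     (\<forall>g\<in>carrier P. on1 F g \<in> carrier Q \<and> degr Q (on1 F g) = degr P g) \<and>
     (\<forall>c\<in>cells P. on2 F c \<in> cells Q \<and>
        src Q (on2 F c) = on1 F (src P c) \<and> tgt Q (on2 F c) = on1 F (tgt P c)) \<and>
     (\<forall>g\<in>carrier P. on2 F (idc P g) = idc Q (on1 F g)) \<and>
     (\<forall>c\<in>cells P. \<forall>d\<in>cells P. tgt P c = src P d \<longrightarrow>
        on2 F (vcomp P d c) = vcomp Q (on2 F d) (on2 F c)) \<and>
     (\<forall>g\<in>carrier P. \<forall>h\<in>carrier P. mlt F g h \<in> cells Q \<and>
        src Q (mlt F g h) = on1 F g \<otimes>\<^bsub>Q\<^esub> on1 F h \<and> tgt Q (mlt F g h) = on1 F (g \<otimes>\<^bsub>P\<^esub> h)) \<and>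
     (\<forall>c\<in>cells P. \<forall>d\<in>cells P.
        vcomp Q (mlt F (tgt P c) (tgt P d)) (hcomp Q (on2 F c) (on2 F d)) =
        vcomp Q (on2 F (hcomp P c d)) (mlt F (src P c) (src P d))) \<and>
     (\<forall>g\<in>carrier P. \<forall>h\<in>carrier P. \<forall>k\<in>carrier P.
        vcomp Q (mlt F (g \<otimes>\<^bsub>P\<^esub> h) k) (hcomp Q (mlt F g h) (idc Q (on1 F k))) =
        vcomp Q (mlt F g (h \<otimes>\<^bsub>P\<^esub> k)) (hcomp Q (idc Q (on1 F g)) (mlt F h k))) \<and>
     unt F \<in> cells Q \<and> src Q (unt F) = \<one>\<^bsub>Q\<^esub> \<and> tgt Q (unt F) = on1 F \<one>\<^bsub>P\<^esub> \<and>
     (\<forall>g\<in>carrier P.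
        vcomp Q (mlt F \<one>\<^bsub>P\<^esub> g) (hcomp Q (unt F) (idc Q (on1 F g))) = idc Q (on1 F g) \<and>
        vcomp Q (mlt F g \<one>\<^bsub>P\<^esub>) (hcomp Q (idc Q (on1 F g)) (unt F)) = idc Q (on1 F g))"

definition two_group_id :: "('g, 'c) two_group \<Rightarrow> ('g, 'c, 'g, 'c) two_group_map" where
  "two_group_id P =
    \<lparr>on1 = (\<lambda>g. g), on2 = (\<lambda>c. c), mlt = (\<lambda>g h. idc P (g \<otimes>\<^bsub>P\<^esub> h)), unt = idc P \<one>\<^bsub>P\<^esub>\<rparr>"

definition two_group_comp ::
    "('k, 'e) two_group \<Rightarrow> ('h, 'd, 'k, 'e) two_group_map \<Rightarrow> ('g, 'c, 'h, 'd) two_group_map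
      \<Rightarrow> ('g, 'c, 'k, 'e) two_group_map" where
  "two_group_comp R F' F =
    \<lparr>on1 = on1 F' \<circ> on1 F, on2 = on2 F' \<circ> on2 F,
     mlt = (\<lambda>g h. vcomp R (on2 F' (mlt F g h)) (mlt F' (on1 F g) (on1 F h))),
     unt = vcomp R (on2 F' (unt F)) (unt F')\<rparr>"

text \<open>
  Pseudonatural transformations \<open>F \<Rightarrow> F'\<close> with component \<open>t\<close> at the unique object, of degree 1,
  and components \<open>\<tau> g : F' g \<otimes> t \<Rightarrow> t \<otimes> F g\<close>. Between 2-groups each of them is an equivalence,
  since all 1- and 2-morphisms are invertible.
\<close>

definition two_group_trans ::
    "('g, 'c) two_group \<Rightarrow> ('h, 'd) two_group
      \<Rightarrow> ('g, 'c, 'h, 'd) two_group_map \<Rightarrow> ('g, 'c, 'h, 'd) two_group_map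
      \<Rightarrow> 'h \<Rightarrow> ('g \<Rightarrow> 'd) \<Rightarrow> bool" where
  "two_group_trans P Q F F' t \<tau> \<longleftrightarrow>
     t \<in> carrier Q \<and> degr Q t = 1 \<and>
     (\<forall>g\<in>carrier P. \<tau> g \<in> cells Q \<and>
        src Q (\<tau> g) = on1 F' g \<otimes>\<^bsub>Q\<^esub> t \<and> tgt Q (\<tau> g) = t \<otimes>\<^bsub>Q\<^esub> on1 F g) \<and>
     (\<forall>c\<in>cells P.
        vcomp Q (\<tau> (tgt P c)) (hcomp Q (on2 F' c) (idc Q t)) =
        vcomp Q (hcomp Q (idc Q t) (on2 F c)) (\<tau> (src P c))) \<and>
     (\<forall>g\<in>carrier P. \<forall>h\<in>carrier P.
        vcomp Q (\<tau> (g \<otimes>\<^bsub>P\<^esub> h)) (hcomp Q (mlt F' g h) (idc Q t)) =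
        vcomp Q (hcomp Q (idc Q t) (mlt F g h))
          (vcomp Q (hcomp Q (\<tau> g) (idc Q (on1 F h))) (hcomp Q (idc Q (on1 F' g)) (\<tau> h)))) \<and>
     vcomp Q (\<tau> \<one>\<^bsub>P\<^esub>) (hcomp Q (unt F') (idc Q t)) = hcomp Q (idc Q t) (unt F)"

definition two_group_equivalence ::
    "('g, 'c) two_group \<Rightarrow> ('h, 'd) two_group \<Rightarrow> ('g, 'c, 'h, 'd) two_group_map \<Rightarrow> bool" where
  "two_group_equivalence P Q F \<longleftrightarrow>
     two_group_hom P Q F \<and>
     (\<exists>F'. two_group_hom Q P F' \<and>
        (\<exists>t \<tau>. two_group_trans P P (two_group_comp P F' F) (two_group_id P) t \<tau>) \<and>
        (\<exists>t \<tau>. two_group_trans Q Q (two_group_comp Q F F') (two_group_id Q) t \<tau>))"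

definition induced_two_group_map ::
    "('h, 'y) xmod \<Rightarrow> ('g, 'x) xmod \<Rightarrow> ('h \<Rightarrow> 'g) \<Rightarrow> ('y \<Rightarrow> 'x)
      \<Rightarrow> ('h, 'h \<times> 'y, 'g, 'g \<times> 'x) two_group_map" where
  "induced_two_group_map Y X \<phi>1 \<phi>2 =
    \<lparr>on1 = \<phi>1, on2 = map_prod \<phi>1 \<phi>2,
     mlt = (\<lambda>g h. idc (two_group_of X) (\<phi>1 (g \<otimes>\<^bsub>grp1 Y\<^esub> h))),
     unt = idc (two_group_of X) (\<phi>1 \<one>\<^bsub>grp1 Y\<^esub>)\<rparr>"


section \<open>Algebras\<close>

locale assoc_algebra = module K A + ring A
  for K :: "'k ring" and A :: "('k, 'a) module" +
  assumes smult_mult_left: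
      "\<lbrakk>k \<in> carrier K; x \<in> carrier A; y \<in> carrier A\<rbrakk>
        \<Longrightarrow> (k \<odot>\<^bsub>A\<^esub> x) \<otimes>\<^bsub>A\<^esub> y = k \<odot>\<^bsub>A\<^esub> (x \<otimes>\<^bsub>A\<^esub> y)"
    and smult_mult_right:
      "\<lbrakk>k \<in> carrier K; x \<in> carrier A; y \<in> carrier A\<rbrakk>
        \<Longrightarrow> x \<otimes>\<^bsub>A\<^esub> (k \<odot>\<^bsub>A\<^esub> y) = k \<odot>\<^bsub>A\<^esub> (x \<otimes>\<^bsub>A\<^esub> y)"

definition op_alg :: "('k, 'a) module \<Rightarrow> ('k, 'a) module" where
  "op_alg A = A\<lparr>monoid.mult := (\<lambda>x y. y \<otimes>\<^bsub>A\<^esub> x)\<rparr>"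

definition signed_alg :: "int \<Rightarrow> ('k, 'a) module \<Rightarrow> ('k, 'a) module" where
  "signed_alg s A = (if s = 1 then A else op_alg A)"

definition alg_iso :: "'k ring \<Rightarrow> ('k, 'a) module \<Rightarrow> ('k, 'b) module \<Rightarrow> ('a \<Rightarrow> 'b) set" where
  "alg_iso K A B =
    {f \<in> ring_iso A B. \<forall>k\<in>carrier K. \<forall>x\<in>carrier A. f (k \<odot>\<^bsub>A\<^esub> x) = k \<odot>\<^bsub>B\<^esub> f x}"

definition matrix_alg :: "'k ring \<Rightarrow> nat \<Rightarrow> ('k, nat \<times> nat \<Rightarrow> 'k) module" where
  "matrix_alg K n =
    \<lparr>carrier = {..<n} \<times> {..<n} \<rightarrow>\<^sub>E carrier K,
     monoid.mult = (\<lambda>X Y. \<lambda>p\<in>{..<n} \<times> {..<n}. \<Oplus>\<^bsub>K\<^esub>l\<in>{..<n}. X (fst p, l) \<otimes>\<^bsub>K\<^esub> Y (l, snd p)),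
     one = (\<lambda>p\<in>{..<n} \<times> {..<n}. if fst p = snd p then \<one>\<^bsub>K\<^esub> else \<zero>\<^bsub>K\<^esub>),
     zero = (\<lambda>p\<in>{..<n} \<times> {..<n}. \<zero>\<^bsub>K\<^esub>),
     add = (\<lambda>X Y. \<lambda>p\<in>{..<n} \<times> {..<n}. X p \<oplus>\<^bsub>K\<^esub> Y p),
     smult = (\<lambda>k X. \<lambda>p\<in>{..<n} \<times> {..<n}. k \<otimes>\<^bsub>K\<^esub> X p)\<rparr>"

definition product_alg :: "'i set \<Rightarrow> ('i \<Rightarrow> ('k, 'a) module) \<Rightarrow> ('k, 'i \<Rightarrow> 'a) module" where
  "product_alg I A =
    \<lparr>carrier = (\<Pi>\<^sub>E i\<in>I. carrier (A i)),
     monoid.mult = (\<lambda>x y. \<lambda>i\<in>I. x i \<otimes>\<^bsub>A i\<^esub> y i),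
     one = (\<lambda>i\<in>I. \<one>\<^bsub>A i\<^esub>),
     zero = (\<lambda>i\<in>I. \<zero>\<^bsub>A i\<^esub>),
     add = (\<lambda>x y. \<lambda>i\<in>I. x i \<oplus>\<^bsub>A i\<^esub> y i),
     smult = (\<lambda>k x. \<lambda>i\<in>I. k \<odot>\<^bsub>A i\<^esub> x i)\<rparr>"

text \<open>The empty product is allowed, so the zero algebra is split semisimple.\<close>

definition split_semisimple :: "'k ring \<Rightarrow> ('k, 'a) module \<Rightarrow> bool" where
  "split_semisimple K A \<longleftrightarrow>
     (\<exists>(r::nat) d. (\<forall>i<r. 1 \<le> d i) \<and>
        alg_iso K A (product_alg {..<r} (\<lambda>i. matrix_alg K (d i))) \<noteq> {})"


section \<open>N-weak algebras over graded crossed modules\<close>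

record ('k, 'a, 'g, 'x) nwalg =
  alg :: "('k, 'a) module"
  om1 :: "'g \<Rightarrow> 'a \<Rightarrow> 'a"
  om2 :: "'x \<Rightarrow> 'a"
  om3 :: "'g \<Rightarrow> 'g \<Rightarrow> 'a"

text \<open>The action of \<open>\<omega>\<^sub>1(g)\<close>, of degree \<open>\<pi>(g)\<close>, on a unit.\<close>

definition unit_act ::
    "('g, 'x) xmod \<Rightarrow> ('k, 'a, 'g, 'x) nwalg \<Rightarrow> 'g \<Rightarrow> 'a \<Rightarrow> 'a" where
  "unit_act X A g y = om1 A g (y [^]\<^bsub>alg A\<^esub> grading X g)"

locale nweak_algebra =
  fixes K :: "'k ring" and X :: "('g, 'x) xmod" and A :: "('k, 'a, 'g, 'x) nwalg"
  assumes assoc_algebra: "assoc_algebra K (alg A)"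
    and om3_unit:
      "\<lbrakk>g \<in> carrier (grp1 X); h \<in> carrier (grp1 X)\<rbrakk> \<Longrightarrow> om3 A g h \<in> Units (alg A)"
    and om3_one_left: "g \<in> carrier (grp1 X) \<Longrightarrow> om3 A \<one>\<^bsub>grp1 X\<^esub> g = \<one>\<^bsub>alg A\<^esub>"
    and om3_one_right: "g \<in> carrier (grp1 X) \<Longrightarrow> om3 A g \<one>\<^bsub>grp1 X\<^esub> = \<one>\<^bsub>alg A\<^esub>"
    and om1_iso:
      "g \<in> carrier (grp1 X) \<Longrightarrow> om1 A g \<in> alg_iso K (signed_alg (grading X g) (alg A)) (alg A)"
    and om1_one: "a \<in> carrier (alg A) \<Longrightarrow> om1 A \<one>\<^bsub>grp1 X\<^esub> a = a"
    and om2_unit: "x \<in> carrier (grp2 X) \<Longrightarrow> om2 A x \<in> Units (alg A)"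
    and om2_one: "om2 A \<one>\<^bsub>grp2 X\<^esub> = \<one>\<^bsub>alg A\<^esub>"
    and om1_mult:
      "\<lbrakk>g2 \<in> carrier (grp1 X); g1 \<in> carrier (grp1 X); a \<in> carrier (alg A)\<rbrakk>
        \<Longrightarrow> om1 A (g2 \<otimes>\<^bsub>grp1 X\<^esub> g1) a =
            om3 A g2 g1 \<otimes>\<^bsub>alg A\<^esub> om1 A g2 (om1 A g1 a) \<otimes>\<^bsub>alg A\<^esub> inv\<^bsub>alg A\<^esub> (om3 A g2 g1)"
    and om2_mult:
      "\<lbrakk>x2 \<in> carrier (grp2 X); x1 \<in> carrier (grp2 X)\<rbrakk>
        \<Longrightarrow> om2 A (x2 \<otimes>\<^bsub>grp2 X\<^esub> x1) =
            om3 A (bdry X x2) (bdry X x1) \<otimes>\<^bsub>alg A\<^esub> om2 A x2 \<otimes>\<^bsub>alg A\<^esub> om2 A x1"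
    and om1_bdry:
      "\<lbrakk>x \<in> carrier (grp2 X); a \<in> carrier (alg A)\<rbrakk>
        \<Longrightarrow> om1 A (bdry X x) a = om2 A x \<otimes>\<^bsub>alg A\<^esub> a \<otimes>\<^bsub>alg A\<^esub> inv\<^bsub>alg A\<^esub> (om2 A x)"
    and om3_cocycle:
      "\<lbrakk>g3 \<in> carrier (grp1 X); g2 \<in> carrier (grp1 X); g1 \<in> carrier (grp1 X)\<rbrakk>
        \<Longrightarrow> om3 A (g3 \<otimes>\<^bsub>grp1 X\<^esub> g2) g1 \<otimes>\<^bsub>alg A\<^esub> om3 A g3 g2 =
            om3 A g3 (g2 \<otimes>\<^bsub>grp1 X\<^esub> g1) \<otimes>\<^bsub>alg A\<^esub> unit_act X A g3 (om3 A g2 g1)"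
    and om2_actn:
      "\<lbrakk>g \<in> carrier (grp1 X); x \<in> carrier (grp2 X)\<rbrakk>
        \<Longrightarrow> om2 A (actn X g x) =
            om3 A (g \<otimes>\<^bsub>grp1 X\<^esub> bdry X x) (inv\<^bsub>grp1 X\<^esub> g) \<otimes>\<^bsub>alg A\<^esub> om3 A g (bdry X x)
              \<otimes>\<^bsub>alg A\<^esub> unit_act X A g (om2 A x)
              \<otimes>\<^bsub>alg A\<^esub> inv\<^bsub>alg A\<^esub> (om3 A g (inv\<^bsub>grp1 X\<^esub> g))"

locale strict_algebra = nweak_algebra +
  assumes om3_trivial:
    "\<lbrakk>g \<in> carrier (grp1 X); h \<in> carrier (grp1 X)\<rbrakk> \<Longrightarrow> om3 A g h = \<one>\<^bsub>alg A\<^esub>"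

definition pullback_nwalg ::
    "('h \<Rightarrow> 'g) \<Rightarrow> ('y \<Rightarrow> 'x) \<Rightarrow> ('k, 'a, 'g, 'x) nwalg \<Rightarrow> ('k, 'a, 'h, 'y) nwalg" where
  "pullback_nwalg \<phi>1 \<phi>2 A =
    \<lparr>alg = alg A, om1 = om1 A \<circ> \<phi>1, om2 = om2 A \<circ> \<phi>2, om3 = (\<lambda>g h. om3 A (\<phi>1 g) (\<phi>1 h))\<rparr>"


section \<open>Bimodules\<close>

text \<open>
  As for modules in the library, the multiplication and the unit in the record carry no meaning.
\<close>

record ('k, 'b, 'a, 'm) bimod = "('k, 'm) module" +
  lact :: "'b \<Rightarrow> 'm \<Rightarrow> 'm"
  ract :: "'m \<Rightarrow> 'a \<Rightarrow> 'm"

locale bimodule =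
  fixes K :: "'k ring" and B :: "('k, 'b) module" and A :: "('k, 'a) module"
    and M :: "('k, 'b, 'a, 'm) bimod"
  assumes left_algebra: "assoc_algebra K B"
    and right_algebra: "assoc_algebra K A"
    and module: "module K M"
    and lact_closed: "\<lbrakk>b \<in> carrier B; m \<in> carrier M\<rbrakk> \<Longrightarrow> lact M b m \<in> carrier M"
    and lact_add_left:
      "\<lbrakk>b \<in> carrier B; b' \<in> carrier B; m \<in> carrier M\<rbrakk>
        \<Longrightarrow> lact M (b \<oplus>\<^bsub>B\<^esub> b') m = lact M b m \<oplus>\<^bsub>M\<^esub> lact M b' m"
    and lact_add_right:
      "\<lbrakk>b \<in> carrier B; m \<in> carrier M; m' \<in> carrier M\<rbrakk>
        \<Longrightarrow> lact M b (m \<oplus>\<^bsub>M\<^esub> m') = lact M b m \<oplus>\<^bsub>M\<^esub> lact M b m'"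
    and lact_mult:
      "\<lbrakk>b \<in> carrier B; b' \<in> carrier B; m \<in> carrier M\<rbrakk>
        \<Longrightarrow> lact M (b \<otimes>\<^bsub>B\<^esub> b') m = lact M b (lact M b' m)"
    and lact_one: "m \<in> carrier M \<Longrightarrow> lact M \<one>\<^bsub>B\<^esub> m = m"
    and lact_smult_left:
      "\<lbrakk>k \<in> carrier K; b \<in> carrier B; m \<in> carrier M\<rbrakk>
        \<Longrightarrow> lact M (k \<odot>\<^bsub>B\<^esub> b) m = k \<odot>\<^bsub>M\<^esub> lact M b m"
    and lact_smult_right:
      "\<lbrakk>k \<in> carrier K; b \<in> carrier B; m \<in> carrier M\<rbrakk>
        \<Longrightarrow> lact M b (k \<odot>\<^bsub>M\<^esub> m) = k \<odot>\<^bsub>M\<^esub> lact M b m"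
    and ract_closed: "\<lbrakk>m \<in> carrier M; a \<in> carrier A\<rbrakk> \<Longrightarrow> ract M m a \<in> carrier M"
    and ract_add_right:
      "\<lbrakk>m \<in> carrier M; a \<in> carrier A; a' \<in> carrier A\<rbrakk>
        \<Longrightarrow> ract M m (a \<oplus>\<^bsub>A\<^esub> a') = ract M m a \<oplus>\<^bsub>M\<^esub> ract M m a'"
    and ract_add_left:
      "\<lbrakk>m \<in> carrier M; m' \<in> carrier M; a \<in> carrier A\<rbrakk>
        \<Longrightarrow> ract M (m \<oplus>\<^bsub>M\<^esub> m') a = ract M m a \<oplus>\<^bsub>M\<^esub> ract M m' a"
    and ract_mult:
      "\<lbrakk>m \<in> carrier M; a \<in> carrier A; a' \<in> carrier A\<rbrakk>
        \<Longrightarrow> ract M m (a \<otimes>\<^bsub>A\<^esub> a') = ract M (ract M m a) a'"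
    and ract_one: "m \<in> carrier M \<Longrightarrow> ract M m \<one>\<^bsub>A\<^esub> = m"
    and ract_smult_right:
      "\<lbrakk>k \<in> carrier K; m \<in> carrier M; a \<in> carrier A\<rbrakk>
        \<Longrightarrow> ract M m (k \<odot>\<^bsub>A\<^esub> a) = k \<odot>\<^bsub>M\<^esub> ract M m a"
    and ract_smult_left:
      "\<lbrakk>k \<in> carrier K; m \<in> carrier M; a \<in> carrier A\<rbrakk>
        \<Longrightarrow> ract M (k \<odot>\<^bsub>M\<^esub> m) a = k \<odot>\<^bsub>M\<^esub> ract M m a"
    and lact_ract:
      "\<lbrakk>b \<in> carrier B; m \<in> carrier M; a \<in> carrier A\<rbrakk>
        \<Longrightarrow> ract M (lact M b m) a = lact M b (ract M m a)"

definition linear_iso ::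
    "'k ring \<Rightarrow> ('k, 'b, 'a, 'm) bimod \<Rightarrow> ('k, 'c, 'd, 'n) bimod \<Rightarrow> ('m \<Rightarrow> 'n) set" where
  "linear_iso K M N =
    {f. bij_betw f (carrier M) (carrier N) \<and>
        (\<forall>m\<in>carrier M. \<forall>m'\<in>carrier M. f (m \<oplus>\<^bsub>M\<^esub> m') = f m \<oplus>\<^bsub>N\<^esub> f m') \<and>
        (\<forall>k\<in>carrier K. \<forall>m\<in>carrier M. f (k \<odot>\<^bsub>M\<^esub> m) = k \<odot>\<^bsub>N\<^esub> f m)}"

text \<open>
  \<open>Hom\<^sub>M\<^sub>o\<^sub>d\<^sub>-\<^sub>A(M, A)\<close> for a \<open>B\<close>-\<open>A\<close>-bimodule \<open>M\<close>, as a bimodule over the opposite algebras: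
  \<open>b \<in> B\<close> acts from the left by precomposition with the action of \<open>b\<close> on \<open>M\<close>, and \<open>a \<in> A\<close> acts
  from the right by multiplying the values by \<open>a\<close> from the left in \<open>A\<close>. The functions are
  extensional, so that equality of homomorphisms is equality in the function type.
\<close>

definition dual_bimod ::
    "('k, 'a) module \<Rightarrow> ('k, 'b, 'a, 'm) bimod \<Rightarrow> ('k, 'b, 'a, 'm \<Rightarrow> 'a) bimod" where
  "dual_bimod A M =
    \<lparr>carrier =
       {f \<in> carrier M \<rightarrow>\<^sub>E carrier A.
          (\<forall>m\<in>carrier M. \<forall>m'\<in>carrier M. f (m \<oplus>\<^bsub>M\<^esub> m') = f m \<oplus>\<^bsub>A\<^esub> f m') \<and>
          (\<forall>m\<in>carrier M. \<forall>a\<in>carrier A. f (ract M m a) = f m \<otimes>\<^bsub>A\<^esub> a)},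
     monoid.mult = undefined, one = undefined,
     zero = (\<lambda>m\<in>carrier M. \<zero>\<^bsub>A\<^esub>),
     add = (\<lambda>f f'. \<lambda>m\<in>carrier M. f m \<oplus>\<^bsub>A\<^esub> f' m),
     smult = (\<lambda>k f. \<lambda>m\<in>carrier M. k \<odot>\<^bsub>A\<^esub> f m),
     lact = (\<lambda>b f. \<lambda>m\<in>carrier M. f (lact M b m)),
     ract = (\<lambda>f a. \<lambda>m\<in>carrier M. a \<otimes>\<^bsub>A\<^esub> f m)\<rparr>"

text \<open>The evaluation map into the double dual, \<open>dual_bimod (op_alg A) (dual_bimod A M)\<close>.\<close>

definition ev_bimod ::
    "('k, 'a) module \<Rightarrow> ('k, 'b, 'a, 'm) bimod \<Rightarrow> 'm \<Rightarrow> ('m \<Rightarrow> 'a) \<Rightarrow> 'a" where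
  "ev_bimod A M m = (\<lambda>f\<in>carrier (dual_bimod A M). f m)"


subsection \<open>Tensor products and invertible bimodules\<close>

definition tensor_relators ::
    "('k, 'a) module \<Rightarrow> ('k, 'b, 'a, 'm) bimod \<Rightarrow> ('k, 'a, 'c, 'n) bimod
      \<Rightarrow> ('m \<times> 'n \<Rightarrow>\<^sub>0 int) set" where
  "tensor_relators A M N =
     {frag_of (m \<oplus>\<^bsub>M\<^esub> m', n) - frag_of (m, n) - frag_of (m', n) | m m' n.
        m \<in> carrier M \<and> m' \<in> carrier M \<and> n \<in> carrier N} \<union>
     {frag_of (m, n \<oplus>\<^bsub>N\<^esub> n') - frag_of (m, n) - frag_of (m, n') | m n n'.
        m \<in> carrier M \<and> n \<in> carrier N \<and> n' \<in> carrier N} \<union>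
     {frag_of (ract M m a, n) - frag_of (m, lact N a n) | m a n.
        m \<in> carrier M \<and> a \<in> carrier A \<and> n \<in> carrier N}"

definition tensor_kernel ::
    "('k, 'a) module \<Rightarrow> ('k, 'b, 'a, 'm) bimod \<Rightarrow> ('k, 'a, 'c, 'n) bimod
      \<Rightarrow> ('m \<times> 'n \<Rightarrow>\<^sub>0 int) set" where
  "tensor_kernel A M N =
     generate (free_Abelian_group (carrier M \<times> carrier N)) (tensor_relators A M N)"

definition tensor_product ::
    "('k, 'a) module \<Rightarrow> ('k, 'b, 'a, 'm) bimod \<Rightarrow> ('k, 'a, 'c, 'n) bimod
      \<Rightarrow> ('m \<times> 'n \<Rightarrow>\<^sub>0 int) set monoid" where
  "tensor_product A M N =
     free_Abelian_group (carrier M \<times> carrier N) Mod tensor_kernel A M N"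

definition elem_tensor ::
    "('k, 'a) module \<Rightarrow> ('k, 'b, 'a, 'm) bimod \<Rightarrow> ('k, 'a, 'c, 'n) bimod
      \<Rightarrow> 'm \<Rightarrow> 'n \<Rightarrow> ('m \<times> 'n \<Rightarrow>\<^sub>0 int) set" where
  "elem_tensor A M N m n =
     tensor_kernel A M N #>\<^bsub>free_Abelian_group (carrier M \<times> carrier N)\<^esub> frag_of (m, n)"

text \<open>
  An isomorphism of \<open>C\<close>-\<open>C\<close>-bimodules from \<open>M \<otimes>\<^sub>A N\<close> to \<open>C\<close>. The actions of \<open>C\<close> on the tensor
  product are the additive maps given on the generators by \<open>c (m \<otimes> n) c' = (c m) \<otimes> (n c')\<close>, so
  bilinearity is a condition on elementary tensors; it implies linearity over the base field.
\<close>

definition tensor_iso ::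
    "('k, 'c) module \<Rightarrow> ('k, 'a) module \<Rightarrow> ('k, 'c, 'a, 'm) bimod \<Rightarrow> ('k, 'a, 'c, 'n) bimod
      \<Rightarrow> (('m \<times> 'n \<Rightarrow>\<^sub>0 int) set \<Rightarrow> 'c) \<Rightarrow> bool" where
  "tensor_iso C A M N \<theta> \<longleftrightarrow>
     \<theta> \<in> iso (tensor_product A M N) (add_monoid C) \<and>
     (\<forall>c\<in>carrier C. \<forall>c'\<in>carrier C. \<forall>m\<in>carrier M. \<forall>n\<in>carrier N.
        \<theta> (elem_tensor A M N (lact M c m) (ract N n c')) =
        c \<otimes>\<^bsub>C\<^esub> \<theta> (elem_tensor A M N m n) \<otimes>\<^bsub>C\<^esub> c')"

text \<open>
  The inverse of \<open>M\<close> is looked for in the type of functions from \<open>M\<close> to \<open>A\<close>. This is no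
  restriction: an inverse of \<open>M\<close> is isomorphic to \<open>Hom\<^sub>M\<^sub>o\<^sub>d\<^sub>-\<^sub>A(M, A)\<close>.
\<close>

definition invertible_bimod ::
    "'k ring \<Rightarrow> ('k, 'b) module \<Rightarrow> ('k, 'a) module \<Rightarrow> ('k, 'b, 'a, 'm) bimod \<Rightarrow> bool" where
  "invertible_bimod K B A M \<longleftrightarrow>
     (\<exists>N :: ('k, 'a, 'b, 'm \<Rightarrow> 'a) bimod. bimodule K A B N \<and>
        (\<exists>\<theta>. tensor_iso B A M N \<theta>) \<and> (\<exists>\<theta>. tensor_iso A B N M \<theta>))"


section \<open>1-morphisms and Morita equivalence\<close>

text \<open>
  For \<open>w : P \<rightarrow> M\<close> of degree \<open>\<pi>(g)\<close>, with \<open>S\<close> the carrier of the source \<open>P\<close>, this is the map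
  \<open>f \<mapsto> \<omega>\<^sub>A\<^sub>,\<^sub>1(g) \<circ> f \<circ> w\<^sup>-\<^sup>1\<close> from the dual of \<open>P\<close> to the dual of \<open>M\<close>.
\<close>

definition dual_transport ::
    "('k, 'a, 'g, 'x) nwalg \<Rightarrow> ('k, 'b, 'a, 'm) bimod \<Rightarrow> 'g \<Rightarrow> 'p set \<Rightarrow> ('p \<Rightarrow> 'm)
      \<Rightarrow> ('p \<Rightarrow> 'a) \<Rightarrow> 'm \<Rightarrow> 'a" where
  "dual_transport A M g S w f = (\<lambda>m\<in>carrier M. om1 A g (f (inv_into S w m)))"

definition sandwich :: "('k, 'b, 'a, 'm) bimod \<Rightarrow> 'b \<Rightarrow> 'm \<Rightarrow> 'a \<Rightarrow> 'm" where
  "sandwich M b m a = ract M (lact M b m) a"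

text \<open>
  The structure map \<open>\<omega>\<^sub>M(g)\<close> is \<open>wp g : M \<rightarrow> M\<close> if \<open>\<pi>(g) = 1\<close> and
  \<open>wn g : dual_bimod (alg A) M \<rightarrow> M\<close> if \<open>\<pi>(g) = -1\<close>; values for the other degree are irrelevant.
\<close>

locale one_morphism =
  fixes K :: "'k ring" and X :: "('g, 'x) xmod"
    and A :: "('k, 'a, 'g, 'x) nwalg" and B :: "('k, 'b, 'g, 'x) nwalg"
    and M :: "('k, 'b, 'a, 'm) bimod"
    and wp :: "'g \<Rightarrow> 'm \<Rightarrow> 'm" and wn :: "'g \<Rightarrow> ('m \<Rightarrow> 'a) \<Rightarrow> 'm"
  assumes bimodule: "bimodule K (alg B) (alg A) M"
    and wp_iso:
      "\<lbrakk>g \<in> carrier (grp1 X); grading X g = 1\<rbrakk> \<Longrightarrow> wp g \<in> linear_iso K M M"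
    and wn_iso:
      "\<lbrakk>g \<in> carrier (grp1 X); grading X g = -1\<rbrakk>
        \<Longrightarrow> wn g \<in> linear_iso K (dual_bimod (alg A) M) M"
    and wp_one: "m \<in> carrier M \<Longrightarrow> wp \<one>\<^bsub>grp1 X\<^esub> m = m"
    and wp_sandwich:
      "\<lbrakk>g \<in> carrier (grp1 X); grading X g = 1;
        b \<in> carrier (alg B); m \<in> carrier M; a \<in> carrier (alg A)\<rbrakk>
        \<Longrightarrow> wp g (sandwich M b m a) = sandwich M (om1 B g b) (wp g m) (om1 A g a)"
    and wn_sandwich:
      "\<lbrakk>g \<in> carrier (grp1 X); grading X g = -1;
        b \<in> carrier (alg B); f \<in> carrier (dual_bimod (alg A) M); a \<in> carrier (alg A)\<rbrakk>
        \<Longrightarrow> wn g (sandwich (dual_bimod (alg A) M) b f a)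
            = sandwich M (om1 B g b) (wn g f) (om1 A g a)"
    and wp_wp:
      "\<lbrakk>g2 \<in> carrier (grp1 X); g1 \<in> carrier (grp1 X); grading X g2 = 1; grading X g1 = 1;
        m \<in> carrier M\<rbrakk>
        \<Longrightarrow> wp (g2 \<otimes>\<^bsub>grp1 X\<^esub> g1) m =
            sandwich M (om3 B g2 g1) (wp g2 (wp g1 m)) (inv\<^bsub>alg A\<^esub> (om3 A g2 g1))"
    and wp_wn:
      "\<lbrakk>g2 \<in> carrier (grp1 X); g1 \<in> carrier (grp1 X); grading X g2 = 1; grading X g1 = -1;
        f \<in> carrier (dual_bimod (alg A) M)\<rbrakk>
        \<Longrightarrow> wn (g2 \<otimes>\<^bsub>grp1 X\<^esub> g1) f =
            sandwich M (om3 B g2 g1) (wp g2 (wn g1 f)) (inv\<^bsub>alg A\<^esub> (om3 A g2 g1))"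
    and wn_wp:
      "\<lbrakk>g2 \<in> carrier (grp1 X); g1 \<in> carrier (grp1 X); grading X g2 = -1; grading X g1 = 1;
        f \<in> carrier (dual_bimod (alg A) M)\<rbrakk>
        \<Longrightarrow> wn (g2 \<otimes>\<^bsub>grp1 X\<^esub> g1) f =
            sandwich M (om3 B g2 g1)
              (wn g2 (dual_transport A M g1 (carrier M) (wp g1) f))
              (inv\<^bsub>alg A\<^esub> (om3 A g2 g1))"
    and wn_wn:
      "\<lbrakk>g2 \<in> carrier (grp1 X); g1 \<in> carrier (grp1 X); grading X g2 = -1; grading X g1 = -1;
        m \<in> carrier M\<rbrakk>
        \<Longrightarrow> wp (g2 \<otimes>\<^bsub>grp1 X\<^esub> g1) m =
            sandwich M (om3 B g2 g1)
              (wn g2 (dual_transport A M g1 (carrier (dual_bimod (alg A) M)) (wn g1)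
                 (ev_bimod (alg A) M m)))
              (inv\<^bsub>alg A\<^esub> (om3 A g2 g1))"
    and wp_bdry:
      "\<lbrakk>x \<in> carrier (grp2 X); m \<in> carrier M\<rbrakk>
        \<Longrightarrow> wp (bdry X x) m = sandwich M (om2 B x) m (inv\<^bsub>alg A\<^esub> (om2 A x))"

text \<open>
  The bimodule is looked for in the type \<^typ>\<open>nat \<Rightarrow> 'a\<close>. This is no restriction: an invertible
  \<open>B\<close>-\<open>A\<close>-bimodule is finitely generated and projective over \<open>A\<close>, hence isomorphic to one
  whose underlying right module is a submodule of \<open>A\<^sup>n\<close>. Likewise \<open>B\<close> is then isomorphic to
  the endomorphism algebra of that module, so up to isomorphism it lives in \<^typ>\<open>nat \<Rightarrow> nat \<Rightarrow> 'a\<close>.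
\<close>

definition morita_equivalent ::
    "'k ring \<Rightarrow> ('g, 'x) xmod \<Rightarrow> ('k, 'a, 'g, 'x) nwalg \<Rightarrow> ('k, 'b, 'g, 'x) nwalg \<Rightarrow> bool" where
  "morita_equivalent K X A B \<longleftrightarrow>
     (\<exists>(M :: ('k, 'b, 'a, nat \<Rightarrow> 'a) bimod) wp wn.
        one_morphism K X A B M wp wn \<and> invertible_bimod K (alg B) (alg A) M)"

end

theory Submission
  imports Defs
begin

text \<open>
  Let \<open>n\<close> be the order of \<open>G\<^sub>1\<close> and let \<open>M = A\<^sup>n\<close> be the right \<open>A\<close>-module with basis \<open>e\<^sub>h\<close>, \<open>h \<in> G\<^sub>1\<close>.
  Put \<open>\<omega>\<^sub>M(g)(e\<^sub>h a) = e\<^sub>g\<^sub>h \<omega>\<^sub>3(g, h) \<omega>\<^sub>1(g)(a)\<close>, where for \<open>g\<close> of degree -1 the vectors \<open>e\<^sub>h a\<close> on the left are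
  replaced by the functionals \<open>a e\<^sub>h\<^sup>*\<close>, with \<open>e\<^sub>h\<^sup>*\<close> the dual basis. The cocycle identity for \<open>\<omega>\<^sub>3\<close> is exactly
  condition (b) for \<open>\<omega>\<^sub>M\<close> with trivial \<open>\<omega>\<^sub>B\<^sub>,\<^sub>3\<close>. Conjugation by \<open>\<omega>\<^sub>M(g)\<close> (and a transposition in degree -1)
  and the maps \<open>m \<mapsto> \<omega>\<^sub>M(\<partial>x)(m) \<omega>\<^sub>2(x)\<close> then make \<open>B = End\<^sub>A(M) = M\<^sub>n(A)\<close> a strict algebra that is Morita
  equivalent to \<open>A\<close>. Passing to \<open>M\<^sub>n(A)\<close> preserves split semisimplicity, which gives (i). For (ii) the same
  construction applies with an isomorphic copy of \<open>G\<close> as \<open>H\<close>.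
\<close>

section \<open>Finite sums\<close>

text \<open>The basis is indexed by the group itself because, as a function of its second argument,
  \<open>\<omega>\<^sub>3(g, h)\<close> is a cochain whose coboundary is
  \<open>\<omega>\<^sub>3\<close>: coefficients induced from the trivial subgroup kill a cocycle.
  Units of \<open>A\<close> need not commute, so the sides matter. What is left of
  \<open>\<omega>\<^sub>3(g, h)\<close> in \<open>\<omega>\<^sub>M(gh)\<close> is a right
  multiplication by its inverse; it commutes with \<open>B\<close>, which acts from the left, so
  conjugation does not see it. Finiteness of \<open>G\<^sub>1\<close> makes \<open>M\<close> free of
  finite rank, hence invertible. In degree -1 the map \<open>\<omega>\<^sub>1(g)\<close> exchanges
  left and right multiplication, so it leads from row vectors to column vectors. The inversion in
  the action on units compensates the reversed products, and this keeps the identities for both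
  degrees in one shape.\<close>

lemma hom_finprod:
  fixes G (structure) and H (structure)
  assumes "comm_group G" "comm_group H" "finite I" and h: "h \<in> hom G H" and "f \<in> I \<rightarrow> carrier G"
  shows "h (\<Otimes>i\<in>I. f i) = (\<Otimes>\<^bsub>H\<^esub>i\<in>I. h (f i))"
proof -
  interpret G: comm_group G by fact
  interpret H: comm_group H by fact
  have h1: "h \<one> = \<one>\<^bsub>H\<^esub>"
    using h by (intro hom_one) auto
  show ?thesis
    using assms(3,5)
  proof (induction I)
    case (insert i I)
    moreover from this have "(\<lambda>i. h (f i)) \<in> insert i I \<rightarrow> carrier H"
      using h by (auto simp: hom_def)
    ultimately show ?case
      using hom_mult[OF h] by (simp add: G.finprod_closed Pi_def)
  qed (simp add: h1)
qed

text \<open>For maps that are additive but need not respect products: \<open>w g\<close> in degree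
  -1, coordinates, functionals, matrix entries of an isomorphism.\<close>

lemma finsum_additive:
  fixes R (structure) and S (structure)
  assumes R: "abelian_group R" and S: "abelian_group S" and fin: "finite I"
    and f: "\<And>x. x \<in> carrier R \<Longrightarrow> f x \<in> carrier S"
    and add: "\<And>x y. \<lbrakk>x \<in> carrier R; y \<in> carrier R\<rbrakk> \<Longrightarrow> f (x \<oplus> y) = f x \<oplus>\<^bsub>S\<^esub> f y"
    and g: "\<And>i. i \<in> I \<Longrightarrow> g i \<in> carrier R"
  shows "f (\<Oplus>i\<in>I. g i) = (\<Oplus>\<^bsub>S\<^esub>i\<in>I. f (g i))"
  unfolding finsum_def
  using assms by (intro hom_finprod) (auto simp: hom_def abelian_group.a_comm_group)

lemma (in abelian_monoid) finsum_swap: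
  assumes "finite I" "finite J" "\<And>i j. \<lbrakk>i \<in> I; j \<in> J\<rbrakk> \<Longrightarrow> f i j \<in> carrier G"
  shows "(\<Oplus>i\<in>I. \<Oplus>j\<in>J. f i j) = (\<Oplus>j\<in>J. \<Oplus>i\<in>I. f i j)"
  using assms(1,3)
proof (induction I)
  case empty
  then show ?case by (simp add: finsum_zero)
next
  case (insert i I)
  then have "(\<Oplus>j\<in>J. \<Oplus>i\<in>insert i I. f i j) = (\<Oplus>j\<in>J. f i j \<oplus> (\<Oplus>i\<in>I. f i j))"
    by (intro finsum_cong' refl) (auto intro!: finsum_closed finsum_insert)
  also have "\<dots> = (\<Oplus>j\<in>J. f i j) \<oplus> (\<Oplus>j\<in>J. \<Oplus>i\<in>I. f i j)"
    using insert by (intro finsum_addf) (auto intro!: finsum_closed)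
  finally show ?case
    using insert by (subst finsum_insert) (auto intro!: finsum_closed)
qed

lemma (in abelian_monoid) finsum_single:
  assumes "finite I" "i \<in> I" "f i \<in> carrier G" "\<And>j. \<lbrakk>j \<in> I; i \<noteq> j\<rbrakk> \<Longrightarrow> f j = \<zero>"
  shows "finsum G f I = f i"
proof -
  have "finsum G f I = (\<Oplus>j\<in>I. if i = j then f j else \<zero>)"
    using assms by (intro finsum_cong' refl) auto
  also have "\<dots> = f i"
    using assms by (intro add.finprod_singleton Pi_I) (auto, metis zero_closed)
  finally show ?thesis .
qed

lemma (in abelian_monoid) finsum_all_zero:
  assumes "\<And>j. j \<in> I \<Longrightarrow> f j = \<zero>"
  shows "finsum G f I = \<zero>"
proof -
  have "finsum G f I = (\<Oplus>j\<in>I. \<zero>)"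
    using assms by (intro finsum_cong') auto
  then show ?thesis by (simp add: finsum_zero)
qed


section \<open>Matrices and column vectors over an algebra\<close>

text \<open>
  Matrices and vectors are extended by zero outside the index range, so that all entries lie in
  the carrier and the operations need no restriction.
\<close>

definition mat_over :: "('k, 'a) module \<Rightarrow> nat \<Rightarrow> ('k, nat \<Rightarrow> nat \<Rightarrow> 'a) module" where
  "mat_over A n =
    \<lparr>carrier = {b. \<forall>i j. b i j \<in> carrier A \<and> (n \<le> i \<or> n \<le> j \<longrightarrow> b i j = \<zero>\<^bsub>A\<^esub>)},
     monoid.mult = (\<lambda>b c i j. \<Oplus>\<^bsub>A\<^esub>l\<in>{..<n}. b i l \<otimes>\<^bsub>A\<^esub> c l j),
     one = (\<lambda>i j. if i = j \<and> i < n then \<one>\<^bsub>A\<^esub> else \<zero>\<^bsub>A\<^esub>),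
     zero = (\<lambda>i j. \<zero>\<^bsub>A\<^esub>),
     add = (\<lambda>b c i j. b i j \<oplus>\<^bsub>A\<^esub> c i j),
     smult = (\<lambda>k b i j. k \<odot>\<^bsub>A\<^esub> b i j)\<rparr>"

definition vec_over ::
    "('k, 'a) module \<Rightarrow> nat \<Rightarrow> ('k, nat \<Rightarrow> nat \<Rightarrow> 'a, 'a, nat \<Rightarrow> 'a) bimod" where
  "vec_over A n =
    \<lparr>carrier = {v. \<forall>i. v i \<in> carrier A \<and> (n \<le> i \<longrightarrow> v i = \<zero>\<^bsub>A\<^esub>)},
     monoid.mult = undefined, one = undefined,
     zero = (\<lambda>i. \<zero>\<^bsub>A\<^esub>),
     add = (\<lambda>v w i. v i \<oplus>\<^bsub>A\<^esub> w i),
     smult = (\<lambda>k v i. k \<odot>\<^bsub>A\<^esub> v i),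
     lact = (\<lambda>b v i. \<Oplus>\<^bsub>A\<^esub>l\<in>{..<n}. b i l \<otimes>\<^bsub>A\<^esub> v l),
     ract = (\<lambda>v a i. v i \<otimes>\<^bsub>A\<^esub> a)\<rparr>"

lemma mat_over_simps [simp]:
  "b \<in> carrier (mat_over A n) \<longleftrightarrow>
    (\<forall>i j. b i j \<in> carrier A \<and> (n \<le> i \<or> n \<le> j \<longrightarrow> b i j = \<zero>\<^bsub>A\<^esub>))"
  "b \<otimes>\<^bsub>mat_over A n\<^esub> c = (\<lambda>i j. \<Oplus>\<^bsub>A\<^esub>l\<in>{..<n}. b i l \<otimes>\<^bsub>A\<^esub> c l j)"
  "\<one>\<^bsub>mat_over A n\<^esub> = (\<lambda>i j. if i = j \<and> i < n then \<one>\<^bsub>A\<^esub> else \<zero>\<^bsub>A\<^esub>)"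
  "\<zero>\<^bsub>mat_over A n\<^esub> = (\<lambda>i j. \<zero>\<^bsub>A\<^esub>)"
  "b \<oplus>\<^bsub>mat_over A n\<^esub> c = (\<lambda>i j. b i j \<oplus>\<^bsub>A\<^esub> c i j)"
  "k \<odot>\<^bsub>mat_over A n\<^esub> b = (\<lambda>i j. k \<odot>\<^bsub>A\<^esub> b i j)"
  by (simp_all add: mat_over_def)

lemma vec_over_simps [simp]:
  "v \<in> carrier (vec_over A n) \<longleftrightarrow> (\<forall>i. v i \<in> carrier A \<and> (n \<le> i \<longrightarrow> v i = \<zero>\<^bsub>A\<^esub>))"
  "\<zero>\<^bsub>vec_over A n\<^esub> = (\<lambda>i. \<zero>\<^bsub>A\<^esub>)"
  "v \<oplus>\<^bsub>vec_over A n\<^esub> w = (\<lambda>i. v i \<oplus>\<^bsub>A\<^esub> w i)"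
  "k \<odot>\<^bsub>vec_over A n\<^esub> v = (\<lambda>i. k \<odot>\<^bsub>A\<^esub> v i)"
  "lact (vec_over A n) b v = (\<lambda>i. \<Oplus>\<^bsub>A\<^esub>l\<in>{..<n}. b i l \<otimes>\<^bsub>A\<^esub> v l)"
  "ract (vec_over A n) v a = (\<lambda>i. v i \<otimes>\<^bsub>A\<^esub> a)"
  by (simp_all add: vec_over_def)

locale matrices = assoc_algebra K A for K and A (structure) +
  fixes n :: nat
begin

abbreviation "Mat \<equiv> mat_over A n"
abbreviation "Vec \<equiv> vec_over A n"

lemma dot_closed [simp]:
  "\<lbrakk>\<And>l. f l \<in> carrier A; \<And>l. g l \<in> carrier A\<rbrakk> \<Longrightarrow> (\<Oplus>l\<in>{..<n}. f l \<otimes> g l) \<in> carrier A"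
  by (auto intro!: finsum_closed)

text \<open>Associativity of row times matrix times column, by exchanging the two sums. It serves
  both the product of \<open>Mat\<close> and the action of \<open>Mat\<close> on
  \<open>Vec\<close>.\<close>

lemma dot_assoc:
  assumes "\<And>l. f l \<in> carrier A" "\<And>l m. b l m \<in> carrier A" "\<And>m. g m \<in> carrier A"
  shows "(\<Oplus>m\<in>{..<n}. (\<Oplus>l\<in>{..<n}. f l \<otimes> b l m) \<otimes> g m) =
    (\<Oplus>l\<in>{..<n}. f l \<otimes> (\<Oplus>m\<in>{..<n}. b l m \<otimes> g m))"
proof -
  have "(\<Oplus>m\<in>{..<n}. (\<Oplus>l\<in>{..<n}. f l \<otimes> b l m) \<otimes> g m) =
      (\<Oplus>m\<in>{..<n}. \<Oplus>l\<in>{..<n}. f l \<otimes> (b l m \<otimes> g m))"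
    using assms by (intro finsum_cong' refl) (auto intro!: finsum_closed simp: finsum_ldistr m_assoc)
  also have "\<dots> = (\<Oplus>l\<in>{..<n}. \<Oplus>m\<in>{..<n}. f l \<otimes> (b l m \<otimes> g m))"
    using assms by (intro finsum_swap) auto
  also have "\<dots> = (\<Oplus>l\<in>{..<n}. f l \<otimes> (\<Oplus>m\<in>{..<n}. b l m \<otimes> g m))"
    using assms by (intro finsum_cong' refl) (auto intro!: finsum_closed simp: finsum_rdistr)
  finally show ?thesis .
qed

lemma dot_add_left:
  assumes "\<And>l. f l \<in> carrier A" "\<And>l. f' l \<in> carrier A" "\<And>l. g l \<in> carrier A"
  shows "(\<Oplus>l\<in>{..<n}. (f l \<oplus> f' l) \<otimes> g l) =
    (\<Oplus>l\<in>{..<n}. f l \<otimes> g l) \<oplus> (\<Oplus>l\<in>{..<n}. f' l \<otimes> g l)"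
  using assms by (simp add: l_distr finsum_addf Pi_def)

lemma dot_add_right:
  assumes "\<And>l. f l \<in> carrier A" "\<And>l. g l \<in> carrier A" "\<And>l. g' l \<in> carrier A"
  shows "(\<Oplus>l\<in>{..<n}. f l \<otimes> (g l \<oplus> g' l)) =
    (\<Oplus>l\<in>{..<n}. f l \<otimes> g l) \<oplus> (\<Oplus>l\<in>{..<n}. f l \<otimes> g' l)"
  using assms by (simp add: r_distr finsum_addf Pi_def)

lemma dot_smult_left:
  assumes "k \<in> carrier K" "\<And>l. f l \<in> carrier A" "\<And>l. g l \<in> carrier A"
  shows "(\<Oplus>l\<in>{..<n}. (k \<odot> f l) \<otimes> g l) = k \<odot> (\<Oplus>l\<in>{..<n}. f l \<otimes> g l)"
  using assms by (simp add: smult_mult_left finsum_smult_ldistr Pi_def)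

lemma dot_smult_right:
  assumes "k \<in> carrier K" "\<And>l. f l \<in> carrier A" "\<And>l. g l \<in> carrier A"
  shows "(\<Oplus>l\<in>{..<n}. f l \<otimes> (k \<odot> g l)) = k \<odot> (\<Oplus>l\<in>{..<n}. f l \<otimes> g l)"
  using assms by (simp add: smult_mult_right finsum_smult_ldistr Pi_def)

lemma dot_mult_right:
  assumes "a \<in> carrier A" "\<And>l. f l \<in> carrier A" "\<And>l. g l \<in> carrier A"
  shows "(\<Oplus>l\<in>{..<n}. f l \<otimes> (g l \<otimes> a)) = (\<Oplus>l\<in>{..<n}. f l \<otimes> g l) \<otimes> a"
  using assms by (simp add: m_assoc[symmetric] finsum_ldistr Pi_def)

text \<open>The side condition \<open>P\<close> carries the range test by which unit matrices, unit
  vectors and monomial matrices are padded with zeros.\<close>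

lemma dot_delta_left:
  assumes "a \<in> carrier A" "\<And>l. g l \<in> carrier A"
  shows "(\<Oplus>l\<in>{..<n}. (if i = l \<and> P then a else \<zero>) \<otimes> g l) = (if i < n \<and> P then a \<otimes> g i else \<zero>)"
proof (cases "i < n \<and> P")
  case True
  then show ?thesis
    using assms by (subst finsum_single[where i = i]) auto
next
  case False
  then show ?thesis
    using assms by (subst finsum_all_zero) auto
qed

lemma dot_delta_right:
  assumes "a \<in> carrier A" "\<And>l. f l \<in> carrier A"
  shows "(\<Oplus>l\<in>{..<n}. f l \<otimes> (if l = i \<and> P l then a else \<zero>)) = (if i < n \<and> P i then f i \<otimes> a else \<zero>)"
proof (cases "i < n \<and> P i")
  case True
  then show ?thesis
    using assms by (subst finsum_single[where i = i]) auto
next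
  case False
  then show ?thesis
    using assms by (subst finsum_all_zero) auto
qed

lemma abelian_group_Mat: "abelian_group Mat"
proof (rule abelian_groupI)
  fix b assume "b \<in> carrier Mat"
  then show "\<exists>c\<in>carrier Mat. c \<oplus>\<^bsub>Mat\<^esub> b = \<zero>\<^bsub>Mat\<^esub>"
    by (intro bexI[where x = "\<lambda>i j. \<ominus> b i j"]) (auto simp: l_neg)
qed (auto simp: a_ac)

lemma abelian_group_Vec: "abelian_group Vec"
proof (rule abelian_groupI)
  fix b assume "b \<in> carrier Vec"
  then show "\<exists>c\<in>carrier Vec. c \<oplus>\<^bsub>Vec\<^esub> b = \<zero>\<^bsub>Vec\<^esub>"
    by (intro bexI[where x = "\<lambda>i. \<ominus> b i"]) (auto simp: l_neg)
qed (auto simp: a_ac)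

lemma ring_Mat: "ring Mat"
proof (rule ringI)
  show "Group.monoid Mat"
    by (rule Group.monoidI)
      (auto simp: dot_assoc dot_delta_left dot_delta_right fun_eq_iff)
qed (auto simp: abelian_group_Mat dot_add_left dot_add_right)

lemma module_Vec: "module K Vec"
  by (rule moduleI)
    (auto simp: R.is_cring abelian_group_Vec smult_l_distr smult_r_distr smult_assoc1)

lemma assoc_algebra_Mat: "assoc_algebra K Mat"
proof -
  have "module K Mat"
    by (rule moduleI)
      (auto simp: R.is_cring abelian_group_Mat smult_l_distr smult_r_distr smult_assoc1)
  then show ?thesis
    using ring_Mat by (auto simp: assoc_algebra_def assoc_algebra_axioms_def dot_smult_left dot_smult_right)
qed

lemma bimodule_Vec: "bimodule K Mat A Vec"
proof (rule bimodule.intro)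
  show "assoc_algebra K Mat" "assoc_algebra K A" "module K Vec"
    using assoc_algebra_Mat assoc_algebra_axioms module_Vec by auto
qed (auto simp: l_distr r_distr m_assoc dot_assoc dot_add_left dot_add_right dot_mult_right
    dot_delta_left smult_mult_left smult_mult_right finsum_smult_ldistr Pi_def fun_eq_iff)

end

section \<open>Tensor products from Morita contexts\<close>

text \<open>The induction rule for free abelian groups builds all elements from basis elements by
  differences, so it is enough that both maps respect products and inverses.\<close>

lemma hom_free_Abelian_group_eqI:
  assumes "group T" and f: "f \<in> hom (free_Abelian_group S) T" and g: "g \<in> hom (free_Abelian_group S) T"
    and eq: "\<And>a. a \<in> S \<Longrightarrow> f (frag_of a) = g (frag_of a)"
    and x: "x \<in> carrier (free_Abelian_group S)"
  shows "f x = g x"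
proof -
  interpret f: group_hom "free_Abelian_group S" T f
    using assms by (simp add: group_hom_def group_hom_axioms_def)
  interpret g: group_hom "free_Abelian_group S" T g
    using assms by (simp add: group_hom_def group_hom_axioms_def)
  have "Poly_Mapping.keys x \<subseteq> S"
    using x by simp
  then show ?thesis
  proof (rule free_Abelian_group_induct)
    fix x y
    assume *: "Poly_Mapping.keys x \<subseteq> S" "Poly_Mapping.keys y \<subseteq> S" "f x = g x" "f y = g y"
    then have diff: "x - y = x \<otimes>\<^bsub>free_Abelian_group S\<^esub> inv\<^bsub>free_Abelian_group S\<^esub> y"
      by simp
    show "f (x - y) = g (x - y)"
      using * f.hom_mult[of x "inv\<^bsub>free_Abelian_group S\<^esub> y"] g.hom_mult[of x "inv\<^bsub>free_Abelian_group S\<^esub> y"]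
        f.hom_inv[of y] g.hom_inv[of y] by simp
  qed (use f.hom_one g.hom_one eq in simp_all)
qed

locale tensor_factors =
  fixes K :: "'k ring" and C :: "('k, 'c) module" and A :: "('k, 'a) module"
    and M :: "('k, 'c, 'a, 'm) bimod" and N :: "('k, 'a, 'c, 'n) bimod"
  assumes M: "bimodule K C A M" and N: "bimodule K A C N"
begin

abbreviation "F \<equiv> free_Abelian_group (carrier M \<times> carrier N)"
abbreviation "T \<equiv> tensor_product A M N"
abbreviation "Ker \<equiv> tensor_kernel A M N"
abbreviation "elt \<equiv> elem_tensor A M N"

sublocale M: bimodule K C A M by (fact M)
sublocale N: bimodule K A C N by (fact N)
sublocale M: module K M by (fact M.module)
sublocale N: module K N by (fact N.module)
sublocale F: comm_group F by (fact abelian_free_Abelian_group)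

lemma F_diff_closed: "\<lbrakk>x \<in> carrier F; y \<in> carrier F\<rbrakk> \<Longrightarrow> x - y \<in> carrier F"
  using F.m_closed[of x "inv\<^bsub>F\<^esub> y"] F.inv_closed[of y] by simp

lemma relators_closed: "tensor_relators A M N \<subseteq> carrier F"
  unfolding tensor_relators_def
  by (auto simp del: carrier_free_Abelian_group_iff simp: frag_of_in_free_Abelian_group
      intro!: F_diff_closed M.ract_closed N.lact_closed)

lemma subgroup_Ker: "subgroup Ker F"
  unfolding tensor_kernel_def by (rule F.generate_is_subgroup[OF relators_closed])

lemma normal_Ker: "Ker \<lhd> F"
  using subgroup_Ker by (rule F.subgroup_imp_normal)

sublocale T: comm_group T
  unfolding tensor_product_def by (rule F.abelian_FactGroup[OF subgroup_Ker])

lemma proj_hom: "(\<lambda>x. Ker #>\<^bsub>F\<^esub> x) \<in> hom F T"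
  unfolding tensor_product_def by (rule normal.r_coset_hom_Mod[OF normal_Ker])

lemma proj_relator: "r \<in> tensor_relators A M N \<Longrightarrow> Ker #>\<^bsub>F\<^esub> r = \<one>\<^bsub>T\<^esub>"
  using F.coset_join2[OF _ subgroup_Ker, of r] relators_closed
  by (auto simp: tensor_kernel_def tensor_product_def FactGroup_def generate.incl)

lemma elt_closed [simp]: "\<lbrakk>m \<in> carrier M; n \<in> carrier N\<rbrakk> \<Longrightarrow> elt m n \<in> carrier T"
  unfolding elem_tensor_def by (rule hom_in_carrier[OF proj_hom]) simp

text \<open>Every defining relation of the tensor product reaches elementary tensors in this way,
  with the relator written as a difference.\<close>

lemma proj_eqI:
  assumes "x - y \<in> tensor_relators A M N" "y \<in> carrier F"
  shows "Ker #>\<^bsub>F\<^esub> x = Ker #>\<^bsub>F\<^esub> y"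
proof -
  have "Ker #>\<^bsub>F\<^esub> x = Ker #>\<^bsub>F\<^esub> ((x - y) \<otimes>\<^bsub>F\<^esub> y)"
    by simp
  also have "\<dots> = (Ker #>\<^bsub>F\<^esub> (x - y)) \<otimes>\<^bsub>T\<^esub> (Ker #>\<^bsub>F\<^esub> y)"
    by (rule hom_mult[OF proj_hom subsetD[OF relators_closed assms(1)] assms(2)])
  also have "\<dots> = Ker #>\<^bsub>F\<^esub> y"
    using proj_relator[OF assms(1)] hom_in_carrier[OF proj_hom assms(2)] by simp
  finally show ?thesis .
qed

lemma elt_add_left:
  assumes "m \<in> carrier M" "m' \<in> carrier M" "n \<in> carrier N"
  shows "elt (m \<oplus>\<^bsub>M\<^esub> m') n = elt m n \<otimes>\<^bsub>T\<^esub> elt m' n"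
proof -
  have "elt m n \<otimes>\<^bsub>T\<^esub> elt m' n = Ker #>\<^bsub>F\<^esub> (frag_of (m, n) \<otimes>\<^bsub>F\<^esub> frag_of (m', n))"
    unfolding elem_tensor_def using assms by (intro hom_mult[OF proj_hom, symmetric]) auto
  also have "\<dots> = elt (m \<oplus>\<^bsub>M\<^esub> m') n"
    unfolding elem_tensor_def
    using assms F.m_closed[of "frag_of (m, n)" "frag_of (m', n)"]
    by (intro proj_eqI[symmetric])
      (auto simp: tensor_relators_def diff_diff_eq[symmetric] simp del: carrier_free_Abelian_group_iff)
  finally show ?thesis by simp
qed

lemma elt_add_right:
  assumes "m \<in> carrier M" "n \<in> carrier N" "n' \<in> carrier N"
  shows "elt m (n \<oplus>\<^bsub>N\<^esub> n') = elt m n \<otimes>\<^bsub>T\<^esub> elt m n'"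
proof -
  have "elt m n \<otimes>\<^bsub>T\<^esub> elt m n' = Ker #>\<^bsub>F\<^esub> (frag_of (m, n) \<otimes>\<^bsub>F\<^esub> frag_of (m, n'))"
    unfolding elem_tensor_def using assms by (intro hom_mult[OF proj_hom, symmetric]) auto
  also have "\<dots> = elt m (n \<oplus>\<^bsub>N\<^esub> n')"
    unfolding elem_tensor_def
    using assms F.m_closed[of "frag_of (m, n)" "frag_of (m, n')"]
    by (intro proj_eqI[symmetric])
      (auto simp: tensor_relators_def diff_diff_eq[symmetric] simp del: carrier_free_Abelian_group_iff)
  finally show ?thesis by simp
qed

lemma elt_balanced:
  assumes "m \<in> carrier M" "a \<in> carrier A" "n \<in> carrier N"
  shows "elt (ract M m a) n = elt m (lact N a n)"
  unfolding elem_tensor_def using assms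
  by (intro proj_eqI) (auto simp: tensor_relators_def N.lact_closed)

text \<open>A balanced biadditive map extends to the free abelian group on pairs; its extension
  kills the relators, hence the subgroup they generate, and factors through the quotient. The target
  is written multiplicatively so that an additive monoid can be inserted.\<close>

lemma tensor_universal:
  assumes H: "comm_group H"
    and closed: "\<And>m n. \<lbrakk>m \<in> carrier M; n \<in> carrier N\<rbrakk> \<Longrightarrow> \<beta> m n \<in> carrier H"
    and add_left: "\<And>m m' n. \<lbrakk>m \<in> carrier M; m' \<in> carrier M; n \<in> carrier N\<rbrakk>
      \<Longrightarrow> \<beta> (m \<oplus>\<^bsub>M\<^esub> m') n = \<beta> m n \<otimes>\<^bsub>H\<^esub> \<beta> m' n"
    and add_right: "\<And>m n n'. \<lbrakk>m \<in> carrier M; n \<in> carrier N; n' \<in> carrier N\<rbrakk>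
      \<Longrightarrow> \<beta> m (n \<oplus>\<^bsub>N\<^esub> n') = \<beta> m n \<otimes>\<^bsub>H\<^esub> \<beta> m n'"
    and balanced: "\<And>m a n. \<lbrakk>m \<in> carrier M; a \<in> carrier A; n \<in> carrier N\<rbrakk>
      \<Longrightarrow> \<beta> (ract M m a) n = \<beta> m (lact N a n)"
  obtains \<theta> where "\<theta> \<in> hom T H"
    and "\<And>m n. \<lbrakk>m \<in> carrier M; n \<in> carrier N\<rbrakk> \<Longrightarrow> \<theta> (elt m n) = \<beta> m n"
proof -
  interpret H: comm_group H by fact
  have "case_prod \<beta> ` (carrier M \<times> carrier N) \<subseteq> carrier H"
    using closed by auto
  then obtain h where h: "h \<in> hom F H"
    and "\<And>p. p \<in> carrier M \<times> carrier N \<Longrightarrow> h (frag_of p) = case_prod \<beta> p"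
    using H.free_Abelian_group_universal by blast
  then have h_frag: "\<And>m n. \<lbrakk>m \<in> carrier M; n \<in> carrier N\<rbrakk> \<Longrightarrow> h (frag_of (m, n)) = \<beta> m n"
    by auto
  interpret h: group_hom F H h
    using h by (simp add: group_hom_def group_hom_axioms_def H.is_group)
  have diff: "h (x - y) = h x \<otimes>\<^bsub>H\<^esub> inv\<^bsub>H\<^esub> h y" "x - y \<in> carrier F"
    if "x \<in> carrier F" "y \<in> carrier F" for x y
    using h.hom_mult[of x "inv\<^bsub>F\<^esub> y"] h.hom_inv[of y] F.inv_closed[of y] F_diff_closed that
    by auto
  \<comment> \<open>The image of an additivity relator, in the associated form that the simplifier
    leaves.\<close>
  have cancel: "p \<otimes>\<^bsub>H\<^esub> (q \<otimes>\<^bsub>H\<^esub> (inv\<^bsub>H\<^esub> p \<otimes>\<^bsub>H\<^esub> inv\<^bsub>H\<^esub> q)) = \<one>\<^bsub>H\<^esub>"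
    if "p \<in> carrier H" "q \<in> carrier H" for p q
    using that H.r_inv[of "p \<otimes>\<^bsub>H\<^esub> q"] by (simp add: H.inv_mult H.m_assoc)
  have "tensor_relators A M N \<subseteq> kernel F H h"
  proof
    fix r assume "r \<in> tensor_relators A M N"
    then show "r \<in> kernel F H h"
      unfolding tensor_relators_def kernel_def
      by (auto simp: diff h_frag closed add_left add_right balanced M.ract_closed N.lact_closed
          frag_of_in_free_Abelian_group cancel H.m_assoc
          simp del: carrier_free_Abelian_group_iff)
  qed
  then have "Ker \<subseteq> kernel F H h"
    unfolding tensor_kernel_def by (intro F.generate_subgroup_incl h.subgroup_kernel)
  then obtain \<theta> where "\<theta> \<in> hom (F Mod Ker) H"
    and \<theta>: "\<And>x. x \<in> carrier F \<Longrightarrow> \<theta> (Ker #>\<^bsub>F\<^esub> x) = h x"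
    using h.FactGroup_universal_kernel[OF normal_Ker] by blast
  then show ?thesis
    by (intro that[of \<theta>]) (auto simp: tensor_product_def elem_tensor_def h_frag)
qed

text \<open>
  The inverse of \<open>m \<otimes> n \<mapsto> \<beta> m n\<close> is \<open>c \<mapsto> \<Sum>\<^sub>i (c u\<^sub>i) \<otimes> v\<^sub>i\<close>, because
  \<open>\<Sum>\<^sub>i \<beta>(m, n) u\<^sub>i \<otimes> v\<^sub>i = \<Sum>\<^sub>i m \<gamma>(n, u\<^sub>i) \<otimes> v\<^sub>i = \<Sum>\<^sub>i m \<otimes> n \<beta>(u\<^sub>i, v\<^sub>i) = m \<otimes> n\<close>.
\<close>

lemma tensor_iso_of_context:
  assumes closed: "\<And>m n. \<lbrakk>m \<in> carrier M; n \<in> carrier N\<rbrakk> \<Longrightarrow> \<beta> m n \<in> carrier C"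
    and add_left: "\<And>m m' n. \<lbrakk>m \<in> carrier M; m' \<in> carrier M; n \<in> carrier N\<rbrakk>
      \<Longrightarrow> \<beta> (m \<oplus>\<^bsub>M\<^esub> m') n = \<beta> m n \<oplus>\<^bsub>C\<^esub> \<beta> m' n"
    and add_right: "\<And>m n n'. \<lbrakk>m \<in> carrier M; n \<in> carrier N; n' \<in> carrier N\<rbrakk>
      \<Longrightarrow> \<beta> m (n \<oplus>\<^bsub>N\<^esub> n') = \<beta> m n \<oplus>\<^bsub>C\<^esub> \<beta> m n'"
    and balanced: "\<And>m a n. \<lbrakk>m \<in> carrier M; a \<in> carrier A; n \<in> carrier N\<rbrakk>
      \<Longrightarrow> \<beta> (ract M m a) n = \<beta> m (lact N a n)"
    and bilinear: "\<And>c c' m n. \<lbrakk>c \<in> carrier C; c' \<in> carrier C; m \<in> carrier M; n \<in> carrier N\<rbrakk>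
      \<Longrightarrow> \<beta> (lact M c m) (ract N n c') = c \<otimes>\<^bsub>C\<^esub> \<beta> m n \<otimes>\<^bsub>C\<^esub> c'"
    and \<gamma>_closed: "\<And>n m. \<lbrakk>n \<in> carrier N; m \<in> carrier M\<rbrakk> \<Longrightarrow> \<gamma> n m \<in> carrier A"
    and assoc_M: "\<And>m n m'. \<lbrakk>m \<in> carrier M; n \<in> carrier N; m' \<in> carrier M\<rbrakk>
      \<Longrightarrow> ract M m (\<gamma> n m') = lact M (\<beta> m n) m'"
    and assoc_N: "\<And>n m n'. \<lbrakk>n \<in> carrier N; m \<in> carrier M; n' \<in> carrier N\<rbrakk>
      \<Longrightarrow> lact N (\<gamma> n m) n' = ract N n (\<beta> m n')"
    and I: "finite I" and u: "\<And>i. i \<in> I \<Longrightarrow> u i \<in> carrier M" and v: "\<And>i. i \<in> I \<Longrightarrow> v i \<in> carrier N"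
    and unit: "(\<Oplus>\<^bsub>C\<^esub>i\<in>I. \<beta> (u i) (v i)) = \<one>\<^bsub>C\<^esub>"
  shows "\<exists>\<theta>. tensor_iso C A M N \<theta>"
proof -
  interpret C: assoc_algebra K C by (fact M.left_algebra)
  interpret A: assoc_algebra K A by (fact M.right_algebra)
  obtain \<theta> where \<theta>: "\<theta> \<in> hom T (add_monoid C)"
    and \<theta>_elt: "\<And>m n. \<lbrakk>m \<in> carrier M; n \<in> carrier N\<rbrakk> \<Longrightarrow> \<theta> (elt m n) = \<beta> m n"
    by (rule tensor_universal[OF C.a_comm_group, of \<beta>]) (simp_all add: closed add_left add_right balanced)
  define s where "s c = (\<Otimes>\<^bsub>T\<^esub>i\<in>I. elt (lact M c (u i)) (v i))" for c
  have s_hom: "s \<in> hom (add_monoid C) T"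
  proof (rule homI)
    fix c c' assume "c \<in> carrier (add_monoid C)" "c' \<in> carrier (add_monoid C)"
    then have cc': "c \<in> carrier C" "c' \<in> carrier C" by auto
    then have "s (c \<oplus>\<^bsub>C\<^esub> c') =
        (\<Otimes>\<^bsub>T\<^esub>i\<in>I. elt (lact M c (u i)) (v i) \<otimes>\<^bsub>T\<^esub> elt (lact M c' (u i)) (v i))"
      unfolding s_def using u v
      by (intro T.finprod_cong' refl) (auto simp: M.lact_add_left elt_add_left M.lact_closed)
    also have "\<dots> = s c \<otimes>\<^bsub>T\<^esub> s c'"
      unfolding s_def using u v cc' by (intro T.finprod_multf) (auto simp: M.lact_closed)
    finally show "s (c \<otimes>\<^bsub>add_monoid C\<^esub> c') = s c \<otimes>\<^bsub>T\<^esub> s c'" by simp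
  qed (auto simp: s_def u v M.lact_closed intro!: T.finprod_closed)
  have s\<beta>: "s (\<beta> m n) = elt m n" if mn: "m \<in> carrier M" "n \<in> carrier N" for m n
  proof -
    have "s (\<beta> m n) = (\<Otimes>\<^bsub>T\<^esub>i\<in>I. elt m (ract N n (\<beta> (u i) (v i))))"
      unfolding s_def using u v mn
      by (intro T.finprod_cong' refl)
        (auto simp: assoc_M[symmetric] assoc_N[symmetric] elt_balanced \<gamma>_closed N.lact_closed closed)
    also have "\<dots> = elt m (ract N n (\<Oplus>\<^bsub>C\<^esub>i\<in>I. \<beta> (u i) (v i)))"
      unfolding finsum_def using I u v mn closed
      by (intro hom_finprod[symmetric, where h = "\<lambda>c. elt m (ract N n c)"])
        (auto simp: C.a_comm_group T.comm_group_axioms hom_def N.ract_closed N.ract_add_right elt_add_right)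
    finally show ?thesis
      using mn by (simp add: unit N.ract_one)
  qed
  \<comment> \<open>Every \<open>t\<close> is the coset of some element of the free abelian group,
    and both sides are homomorphisms in that element, so the elementary tensors treated in
    \<open>s\<beta>\<close> suffice.\<close>
  have s\<theta>: "s (\<theta> t) = t" if "t \<in> carrier T" for t
  proof -
    obtain x where x: "x \<in> carrier F" "t = Ker #>\<^bsub>F\<^esub> x"
      using \<open>t \<in> carrier T\<close> by (auto simp: tensor_product_def carrier_FactGroup simp del: carrier_free_Abelian_group_iff)
    have "(\<lambda>x. s (\<theta> (Ker #>\<^bsub>F\<^esub> x))) \<in> hom F T"
      using hom_compose[OF hom_compose[OF proj_hom \<theta>] s_hom] by (simp add: comp_def)
    moreover have "s (\<theta> (Ker #>\<^bsub>F\<^esub> frag_of p)) = Ker #>\<^bsub>F\<^esub> frag_of p"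
      if "p \<in> carrier M \<times> carrier N" for p
      using that s\<beta> \<theta>_elt by (auto simp flip: elem_tensor_def)
    ultimately have "s (\<theta> (Ker #>\<^bsub>F\<^esub> x)) = Ker #>\<^bsub>F\<^esub> x"
      by (rule hom_free_Abelian_group_eqI[OF T.is_group _ proj_hom _ x(1),
          where f = "\<lambda>x. s (\<theta> (Ker #>\<^bsub>F\<^esub> x))"])
    then show ?thesis using x by simp
  qed
  have \<theta>s: "\<theta> (s c) = c" if "c \<in> carrier C" for c
  proof -
    have cu: "\<beta> (lact M c (u i)) (v i) = c \<otimes>\<^bsub>C\<^esub> \<beta> (u i) (v i)" if "i \<in> I" for i
      using bilinear[OF \<open>c \<in> carrier C\<close> C.one_closed u[OF that] v[OF that]] u[OF that] v[OF that]
        \<open>c \<in> carrier C\<close>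
      by (simp add: N.ract_one closed)
    have "\<theta> (s c) = (\<Otimes>\<^bsub>add_monoid C\<^esub>i\<in>I. \<theta> (elt (lact M c (u i)) (v i)))"
      unfolding s_def using I u v that
      by (intro hom_finprod[OF T.comm_group_axioms C.a_comm_group _ \<theta>]) (auto simp: M.lact_closed)
    also have "\<dots> = (\<Oplus>\<^bsub>C\<^esub>i\<in>I. c \<otimes>\<^bsub>C\<^esub> \<beta> (u i) (v i))"
      unfolding finsum_def[symmetric] using u v that
      by (intro C.finsum_cong' refl) (auto simp: \<theta>_elt M.lact_closed cu closed)
    also have "\<dots> = c"
      using I u v that closed by (simp add: C.finsum_rdistr[symmetric] unit Pi_def)
    finally show ?thesis .
  qed
  have "bij_betw \<theta> (carrier T) (carrier (add_monoid C))"
    using s\<theta> \<theta>s \<theta> s_hom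
    by (intro bij_betw_byWitness[where f' = s]) (auto simp: hom_def)
  then have "tensor_iso C A M N \<theta>"
    using \<theta> by (auto simp: tensor_iso_def iso_def \<theta>_elt M.lact_closed N.ract_closed bilinear)
  then show ?thesis by (rule exI[where x = \<theta>])
qed

end

section \<open>Linear functionals on column vectors and the invertibility of
  \<open>Vec\<close>\<close>

context matrices
begin

abbreviation "Dual \<equiv> dual_bimod A Vec"

text \<open>For \<open>i \<ge> n\<close> this is the zero vector, so the coordinates
  \<open>f (unit_vec i)\<close> of a functional are padded with zeros, as membership in
  \<open>Vec\<close> demands.\<close>

definition unit_vec :: "nat \<Rightarrow> nat \<Rightarrow> 'b" where
  "unit_vec i j = (if j = i \<and> i < n then \<one> else \<zero>)"

definition functional :: "(nat \<Rightarrow> 'b) \<Rightarrow> (nat \<Rightarrow> 'b) \<Rightarrow> 'b" where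
  "functional r = (\<lambda>v\<in>carrier Vec. \<Oplus>l\<in>{..<n}. r l \<otimes> v l)"

lemma unit_vec_entry_closed [simp]: "unit_vec i j \<in> carrier A"
  by (simp add: unit_vec_def)

lemma unit_vec_closed: "unit_vec i \<in> carrier Vec"
  by (auto simp: unit_vec_def)

lemma Dual_iff:
  "f \<in> carrier Dual \<longleftrightarrow> f \<in> carrier Vec \<rightarrow>\<^sub>E carrier A \<and>
    (\<forall>v\<in>carrier Vec. \<forall>w\<in>carrier Vec. f (v \<oplus>\<^bsub>Vec\<^esub> w) = f v \<oplus> f w) \<and>
    (\<forall>v\<in>carrier Vec. \<forall>a\<in>carrier A. f (ract Vec v a) = f v \<otimes> a)"
  by (simp add: dual_bimod_def)

lemma Dual_closed: "\<lbrakk>f \<in> carrier Dual; v \<in> carrier Vec\<rbrakk> \<Longrightarrow> f v \<in> carrier A"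
  by (auto simp: Dual_iff simp del: vec_over_simps)

lemma Dual_unit_vec_closed [simp]: "f \<in> carrier Dual \<Longrightarrow> f (unit_vec i) \<in> carrier A"
  by (rule Dual_closed[OF _ unit_vec_closed])

lemma Dual_zero: "f \<in> carrier Dual \<Longrightarrow> f (\<lambda>i. \<zero>) = \<zero>"
proof -
  assume f: "f \<in> carrier Dual"
  have "f (ract Vec (\<lambda>i. \<zero>) \<zero>) = f (\<lambda>i. \<zero>) \<otimes> \<zero>"
    using f by (auto simp: Dual_iff simp del: vec_over_simps(5,6))
  then show ?thesis
    using Dual_closed[OF f, of "\<lambda>i. \<zero>"] by simp
qed

lemma Dual_unit_vec_outside: "\<lbrakk>f \<in> carrier Dual; n \<le> i\<rbrakk> \<Longrightarrow> f (unit_vec i) = \<zero>"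
  using Dual_zero by (simp add: unit_vec_def[abs_def])

lemma vec_expansion:
  assumes v: "v \<in> carrier Vec"
  shows "v = (\<Oplus>\<^bsub>Vec\<^esub>l\<in>{..<n}. ract Vec (unit_vec l) (v l))"
proof
  fix i
  have "(\<Oplus>\<^bsub>Vec\<^esub>l\<in>{..<n}. ract Vec (unit_vec l) (v l)) i = (\<Oplus>l\<in>{..<n}. unit_vec l i \<otimes> v l)"
    using finsum_additive[OF abelian_group_Vec is_abelian_group, of "{..<n}" "\<lambda>v. v i"] v
    by (auto simp: unit_vec_def)
  also have "\<dots> = (\<Oplus>l\<in>{..<n}. (if i = l \<and> i < n then \<one> else \<zero>) \<otimes> v l)"
    using v by (intro finsum_cong' refl) (auto simp: unit_vec_def)
  also have "\<dots> = v i"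
    using v dot_delta_left[of \<one> v i "i < n"] by auto
  finally show "v i = (\<Oplus>\<^bsub>Vec\<^esub>l\<in>{..<n}. ract Vec (unit_vec l) (v l)) i" by simp
qed

lemma Dual_expansion:
  assumes f: "f \<in> carrier Dual" and v: "v \<in> carrier Vec"
  shows "f v = (\<Oplus>l\<in>{..<n}. f (unit_vec l) \<otimes> v l)"
proof -
  have ract: "ract Vec (unit_vec l) (v l) \<in> carrier Vec" for l
    using v by (auto simp: unit_vec_def)
  have "f v = f (\<Oplus>\<^bsub>Vec\<^esub>l\<in>{..<n}. ract Vec (unit_vec l) (v l))"
    using vec_expansion[OF v] by simp
  also have "\<dots> = (\<Oplus>l\<in>{..<n}. f (ract Vec (unit_vec l) (v l)))"
    using f ract
    by (intro finsum_additive[OF abelian_group_Vec is_abelian_group])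
      (auto simp: Dual_iff simp del: vec_over_simps)
  also have "\<dots> = (\<Oplus>l\<in>{..<n}. f (unit_vec l) \<otimes> v l)"
    using f v unit_vec_closed
    by (intro finsum_cong' refl) (auto simp: Dual_iff simp del: vec_over_simps(2-))
  finally show ?thesis .
qed

lemma Dual_eqI:
  assumes "f \<in> carrier Dual" "g \<in> carrier Dual" "\<And>v. v \<in> carrier Vec \<Longrightarrow> f v = g v"
  shows "f = g"
  using assms unfolding Dual_iff by (auto simp del: vec_over_simps intro: PiE_ext)

lemma functional_apply: "v \<in> carrier Vec \<Longrightarrow> functional r v = (\<Oplus>l\<in>{..<n}. r l \<otimes> v l)"
  by (simp add: functional_def)

lemma functional_closed:
  assumes "\<And>l. r l \<in> carrier A"
  shows "functional r \<in> carrier Dual"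
  using assms
  by (auto simp: Dual_iff functional_def dot_add_right dot_mult_right
      intro!: restrict_PiE_iff[THEN iffD2])

lemma functional_unit_vec:
  "\<lbrakk>\<And>l. r l \<in> carrier A; i < n\<rbrakk> \<Longrightarrow> functional r (unit_vec i) = r i"
  using unit_vec_closed[of i] dot_delta_right[of \<one> r i "\<lambda>_. True"]
  by (simp add: functional_apply unit_vec_def[abs_def])

lemma Dual_eq_functional:
  assumes "f \<in> carrier Dual"
  shows "f = functional (\<lambda>l. f (unit_vec l))"
  using assms by (intro Dual_eqI functional_closed) (auto simp: functional_apply Dual_expansion)

lemma lact_Vec_closed: "\<lbrakk>b \<in> carrier Mat; v \<in> carrier Vec\<rbrakk> \<Longrightarrow> lact Vec b v \<in> carrier Vec"
  by (rule bimodule.lact_closed[OF bimodule_Vec])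

lemma ract_Vec_closed: "\<lbrakk>v \<in> carrier Vec; a \<in> carrier A\<rbrakk> \<Longrightarrow> ract Vec v a \<in> carrier Vec"
  by (rule bimodule.ract_closed[OF bimodule_Vec])

text \<open>\<open>Dual\<close> is a bimodule over the opposite algebras. Exchanging its two actions
  undoes this: \<open>A\<close> acts from the left and \<open>Mat\<close> from the right, as on row
  vectors. This is the inverse of \<open>Vec\<close>, in the function type that
  \<open>invertible_bimod\<close> asks for.\<close>

definition Row :: "('a, 'b, nat \<Rightarrow> nat \<Rightarrow> 'b, (nat \<Rightarrow> 'b) \<Rightarrow> 'b) bimod" where
  "Row =
    \<lparr>carrier = carrier Dual, monoid.mult = undefined, one = undefined, zero = \<zero>\<^bsub>Dual\<^esub>, add = add Dual,
     smult = smult Dual, lact = (\<lambda>a f. ract Dual f a), ract = (\<lambda>f b. lact Dual b f)\<rparr>"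

lemma Row_simps [simp]:
  "carrier Row = carrier Dual"
  "\<zero>\<^bsub>Row\<^esub> = (\<lambda>v\<in>carrier Vec. \<zero>)"
  "f \<oplus>\<^bsub>Row\<^esub> g = (\<lambda>v\<in>carrier Vec. f v \<oplus> g v)"
  "k \<odot>\<^bsub>Row\<^esub> f = (\<lambda>v\<in>carrier Vec. k \<odot> f v)"
  "lact Row a f = (\<lambda>v\<in>carrier Vec. a \<otimes> f v)"
  "ract Row f b = (\<lambda>v\<in>carrier Vec. f (lact Vec b v))"
  by (simp_all add: Row_def dual_bimod_def del: vec_over_simps)

lemma Dual_simps [simp]:
  "\<zero>\<^bsub>Dual\<^esub> = (\<lambda>v\<in>carrier Vec. \<zero>)"
  "f \<oplus>\<^bsub>Dual\<^esub> g = (\<lambda>v\<in>carrier Vec. f v \<oplus> g v)"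
  "k \<odot>\<^bsub>Dual\<^esub> f = (\<lambda>v\<in>carrier Vec. k \<odot> f v)"
  "ract Dual f a = (\<lambda>v\<in>carrier Vec. a \<otimes> f v)"
  "lact Dual b f = (\<lambda>v\<in>carrier Vec. f (lact Vec b v))"
  by (simp_all add: dual_bimod_def del: vec_over_simps)

lemma Dual_memI:
  assumes "\<And>v. v \<in> carrier Vec \<Longrightarrow> h v \<in> carrier A"
    and "\<And>v w. \<lbrakk>v \<in> carrier Vec; w \<in> carrier Vec\<rbrakk> \<Longrightarrow> h (v \<oplus>\<^bsub>Vec\<^esub> w) = h v \<oplus> h w"
    and "\<And>v a. \<lbrakk>v \<in> carrier Vec; a \<in> carrier A\<rbrakk> \<Longrightarrow> h (ract Vec v a) = h v \<otimes> a"
  shows "(\<lambda>v\<in>carrier Vec. h v) \<in> carrier Dual"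
proof -
  have "v \<oplus>\<^bsub>Vec\<^esub> w \<in> carrier Vec" if "v \<in> carrier Vec" "w \<in> carrier Vec" for v w
    using that by auto
  then show ?thesis
    using assms ract_Vec_closed by (simp add: Dual_iff del: vec_over_simps)
qed

lemma Dual_add: "\<lbrakk>f \<in> carrier Dual; v \<in> carrier Vec; w \<in> carrier Vec\<rbrakk> \<Longrightarrow> f (v \<oplus>\<^bsub>Vec\<^esub> w) = f v \<oplus> f w"
  and Dual_mult: "\<lbrakk>f \<in> carrier Dual; v \<in> carrier Vec; a \<in> carrier A\<rbrakk> \<Longrightarrow> f (ract Vec v a) = f v \<otimes> a"
  by (simp_all add: Dual_iff del: vec_over_simps)

text \<open>Scalars act on \<open>Vec\<close> as right multiplication by
  \<open>k \<odot> \<one>\<close>, so right linearity over the algebra already gives linearity over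
  \<open>K\<close>.\<close>

lemma Dual_smult:
  assumes f: "f \<in> carrier Dual" and v: "v \<in> carrier Vec" and k: "k \<in> carrier K"
  shows "f (k \<odot>\<^bsub>Vec\<^esub> v) = k \<odot> f v"
proof -
  have "k \<odot>\<^bsub>Vec\<^esub> v = ract Vec v (k \<odot> \<one>)"
    using v k by (auto simp: smult_mult_right)
  then show ?thesis
    using Dual_mult[OF f v, of "k \<odot> \<one>"] Dual_closed[OF f v] k
    by (simp add: smult_mult_right del: vec_over_simps)
qed

lemma Row_ops_closed:
  "f \<in> carrier Dual \<Longrightarrow> g \<in> carrier Dual \<Longrightarrow> (\<lambda>v\<in>carrier Vec. f v \<oplus> g v) \<in> carrier Dual"
  "k \<in> carrier K \<Longrightarrow> f \<in> carrier Dual \<Longrightarrow> (\<lambda>v\<in>carrier Vec. k \<odot> f v) \<in> carrier Dual"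
  "a \<in> carrier A \<Longrightarrow> f \<in> carrier Dual \<Longrightarrow> (\<lambda>v\<in>carrier Vec. a \<otimes> f v) \<in> carrier Dual"
  "b \<in> carrier Mat \<Longrightarrow> f \<in> carrier Dual \<Longrightarrow> (\<lambda>v\<in>carrier Vec. f (lact Vec b v)) \<in> carrier Dual"
  "(\<lambda>v\<in>carrier Vec. \<zero>) \<in> carrier Dual"
proof -
  interpret V: bimodule K Mat A Vec by (rule bimodule_Vec)
  show "f \<in> carrier Dual \<Longrightarrow> g \<in> carrier Dual \<Longrightarrow> (\<lambda>v\<in>carrier Vec. f v \<oplus> g v) \<in> carrier Dual"
    by (rule Dual_memI) (simp_all add: Dual_add Dual_mult Dual_closed a_ac l_distr del: vec_over_simps)
  show "k \<in> carrier K \<Longrightarrow> f \<in> carrier Dual \<Longrightarrow> (\<lambda>v\<in>carrier Vec. k \<odot> f v) \<in> carrier Dual"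
    by (rule Dual_memI) (simp_all add: Dual_add Dual_mult Dual_closed smult_r_distr smult_mult_left del: vec_over_simps)
  show "a \<in> carrier A \<Longrightarrow> f \<in> carrier Dual \<Longrightarrow> (\<lambda>v\<in>carrier Vec. a \<otimes> f v) \<in> carrier Dual"
    by (rule Dual_memI) (simp_all add: Dual_add Dual_mult Dual_closed r_distr m_assoc del: vec_over_simps)
  show "b \<in> carrier Mat \<Longrightarrow> f \<in> carrier Dual \<Longrightarrow> (\<lambda>v\<in>carrier Vec. f (lact Vec b v)) \<in> carrier Dual"
    by (rule Dual_memI)
      (simp_all add: Dual_add Dual_mult Dual_closed V.lact_closed V.lact_add_right V.lact_ract[symmetric]
        del: vec_over_simps mat_over_simps)
  show "(\<lambda>v\<in>carrier Vec. \<zero>) \<in> carrier Dual"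
    by (rule Dual_memI) simp_all
qed

lemma abelian_group_Row: "abelian_group Row"
proof (rule abelian_groupI)
  fix f g h assume fgh: "f \<in> carrier Row" "g \<in> carrier Row" "h \<in> carrier Row"
  show "f \<oplus>\<^bsub>Row\<^esub> g \<oplus>\<^bsub>Row\<^esub> h = f \<oplus>\<^bsub>Row\<^esub> (g \<oplus>\<^bsub>Row\<^esub> h)"
    using fgh by (auto simp: Dual_closed a_ac simp del: vec_over_simps intro!: restrict_ext)
next
  fix f g assume "f \<in> carrier Row" "g \<in> carrier Row"
  then show "f \<oplus>\<^bsub>Row\<^esub> g = g \<oplus>\<^bsub>Row\<^esub> f"
    by (auto simp: Dual_closed a_ac simp del: vec_over_simps intro!: restrict_ext)
next
  fix f assume f: "f \<in> carrier Row"
  then show "\<zero>\<^bsub>Row\<^esub> \<oplus>\<^bsub>Row\<^esub> f = f"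
    using Row_ops_closed(1)[OF Row_ops_closed(5), of f]
    by (intro Dual_eqI) (auto simp: Dual_closed simp del: vec_over_simps)
  have "(\<lambda>v\<in>carrier Vec. \<ominus> f v) \<in> carrier Dual"
    using f by (intro Dual_memI)
      (simp_all add: Dual_add Dual_mult Dual_closed minus_add l_minus del: vec_over_simps)
  then show "\<exists>g\<in>carrier Row. g \<oplus>\<^bsub>Row\<^esub> f = \<zero>\<^bsub>Row\<^esub>"
    using f by (intro bexI[where x = "\<lambda>v\<in>carrier Vec. \<ominus> f v"])
      (auto simp: Dual_closed l_neg simp del: vec_over_simps intro!: restrict_ext)
qed (use Row_ops_closed in \<open>simp_all del: vec_over_simps mat_over_simps\<close>)

lemma module_Row: "module K Row"
proof (rule moduleI)
  fix f assume f: "f \<in> carrier Row"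
  show "\<one>\<^bsub>K\<^esub> \<odot>\<^bsub>Row\<^esub> f = f"
    using f Row_ops_closed(2)[OF R.one_closed, of f]
    by (intro Dual_eqI) (auto simp: Dual_closed simp del: vec_over_simps)
qed (use R.is_cring abelian_group_Row Row_ops_closed in
    \<open>auto simp: Dual_closed smult_l_distr smult_r_distr smult_assoc1 simp del: vec_over_simps intro!: restrict_ext\<close>)

lemma bimodule_Row: "bimodule K A Mat Row"
proof -
  interpret V: bimodule K Mat A Vec by (rule bimodule_Vec)
  show ?thesis
  proof (rule bimodule.intro)
    show "assoc_algebra K Mat" "assoc_algebra K A" "module K Row"
      using assoc_algebra_Mat assoc_algebra_axioms module_Row by auto
    fix f assume f: "f \<in> carrier Row"
    show "lact Row \<one> f = f"
      using f Row_ops_closed(3)[OF one_closed, of f]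
      by (intro Dual_eqI) (auto simp: Dual_closed simp del: vec_over_simps)
    show "ract Row f \<one>\<^bsub>Mat\<^esub> = f"
      using f Row_ops_closed(4)[OF ring.ring_simprules(6)[OF ring_Mat], of f] V.lact_one
      by (intro Dual_eqI) (auto simp: Dual_closed simp del: vec_over_simps mat_over_simps)
  qed (use Row_ops_closed in \<open>auto simp: Dual_closed Dual_add Dual_mult Dual_smult smult_r_distr l_distr r_distr
      m_assoc smult_mult_left smult_mult_right V.lact_closed V.lact_add_left V.lact_add_right V.lact_mult
      V.lact_smult_left V.lact_smult_right simp del: vec_over_simps mat_over_simps intro!: restrict_ext\<close>)
qed

text \<open>The rank one matrix of the operator \<open>w \<mapsto> v f(w)\<close>. It is one pairing
  of the Morita context between \<open>Mat\<close> and \<open>A\<close>; the other is evaluation of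
  functionals.\<close>

definition outer :: "(nat \<Rightarrow> 'b) \<Rightarrow> ((nat \<Rightarrow> 'b) \<Rightarrow> 'b) \<Rightarrow> nat \<Rightarrow> nat \<Rightarrow> 'b" where
  "outer v f i j = v i \<otimes> f (unit_vec j)"

lemma outer_closed: "\<lbrakk>v \<in> carrier Vec; f \<in> carrier Dual\<rbrakk> \<Longrightarrow> outer v f \<in> carrier Mat"
  by (auto simp: outer_def Dual_unit_vec_outside)

lemma outer_lact:
  assumes "v \<in> carrier Vec" "f \<in> carrier Dual" "w \<in> carrier Vec"
  shows "lact Vec (outer v f) w = ract Vec v (f w)"
  using assms Dual_expansion[of f w]
  by (auto simp: outer_def m_assoc finsum_rdistr Pi_def fun_eq_iff)

lemma ract_Row_outer:
  assumes "v \<in> carrier Vec" "f \<in> carrier Dual" "g \<in> carrier Dual"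
  shows "ract Row g (outer v f) = lact Row (g v) f"
  using assms by (auto simp: outer_lact Dual_mult Dual_closed simp del: vec_over_simps intro!: restrict_ext)

lemma lact_unit_vec: "b \<in> carrier Mat \<Longrightarrow> lact Vec b (unit_vec j) = (\<lambda>i. b i j)"
proof
  fix i assume "b \<in> carrier Mat"
  then show "lact Vec b (unit_vec j) i = b i j"
    using dot_delta_right[of \<one> "b i" j "\<lambda>l. j < n"] by (auto simp: unit_vec_def)
qed

lemma outer_bilinear:
  assumes b: "b \<in> carrier Mat" "c \<in> carrier Mat" and v: "v \<in> carrier Vec" and f: "f \<in> carrier Dual"
  shows "outer (lact Vec b v) (ract Row f c) = b \<otimes>\<^bsub>Mat\<^esub> outer v f \<otimes>\<^bsub>Mat\<^esub> c"
proof (intro ext)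
  fix i j
  have "f (lact Vec c (unit_vec j)) = (\<Oplus>m\<in>{..<n}. f (unit_vec m) \<otimes> c m j)"
    using Dual_expansion[OF f lact_Vec_closed[OF b(2) unit_vec_closed]]
    unfolding lact_unit_vec[OF b(2)] .
  then show "outer (lact Vec b v) (ract Row f c) i j = (b \<otimes>\<^bsub>Mat\<^esub> outer v f \<otimes>\<^bsub>Mat\<^esub> c) i j"
    using b v f unit_vec_closed[of j]
    by (simp add: outer_def dot_mult_right m_assoc finsum_rdistr Pi_def)
qed

lemma finsum_Mat_apply:
  assumes "finite I" "\<And>i. i \<in> I \<Longrightarrow> b i \<in> carrier Mat"
  shows "(\<Oplus>\<^bsub>Mat\<^esub>i\<in>I. b i) p q = (\<Oplus>i\<in>I. b i p q)"
  using assms by (intro finsum_additive[OF abelian_group_Mat is_abelian_group]) auto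

text \<open>Both tensor isomorphisms come from the Morita context of \<open>outer\<close> and
  evaluation. The unit of \<open>Mat\<close> is the sum of the \<open>outer\<close> products of the
  basis with its dual basis.\<close>

theorem invertible_Vec:
  assumes "0 < n"
  shows "invertible_bimod K Mat A Vec"
proof -
  interpret V: bimodule K Mat A Vec by (rule bimodule_Vec)
  interpret VR: tensor_factors K Mat A Vec Row
    by (intro tensor_factors.intro bimodule_Vec bimodule_Row)
  interpret RV: tensor_factors K A Mat Row Vec
    by (intro tensor_factors.intro bimodule_Vec bimodule_Row)
  let ?e = "\<lambda>i. functional (unit_vec i)"
  have e: "?e i \<in> carrier Dual" for i
    by (intro functional_closed) simp
  have e_unit: "?e i (unit_vec j) = unit_vec i j" for i j
    using functional_unit_vec[of "unit_vec i" j] Dual_unit_vec_outside[OF e, of j i]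
    by (cases "j < n") (auto simp: unit_vec_def)
  have "\<exists>\<theta>. tensor_iso Mat A Vec Row \<theta>"
  proof (rule VR.tensor_iso_of_context[where \<beta> = outer and \<gamma> = "\<lambda>f v. f v" and I = "{..<n}"
        and u = unit_vec and v = ?e])
    show "(\<Oplus>\<^bsub>Mat\<^esub>i\<in>{..<n}. outer (unit_vec i) (?e i)) = \<one>\<^bsub>Mat\<^esub>"
    proof (intro ext)
      fix p q
      have "(\<Oplus>\<^bsub>Mat\<^esub>i\<in>{..<n}. outer (unit_vec i) (?e i)) p q =
          (\<Oplus>i\<in>{..<n}. outer (unit_vec i) (?e i) p q)"
        using outer_closed[OF unit_vec_closed e] by (intro finsum_Mat_apply) auto
      also have "\<dots> = (\<Oplus>i\<in>{..<n}. unit_vec p i \<otimes> (if i = q \<and> q < n then \<one> else \<zero>))"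
        by (intro finsum_cong' refl) (auto simp: outer_def e_unit unit_vec_def)
      also have "\<dots> = \<one>\<^bsub>Mat\<^esub> p q"
        using dot_delta_right[of \<one> "unit_vec p" q "\<lambda>_. q < n"] by (auto simp: unit_vec_def)
      finally show "(\<Oplus>\<^bsub>Mat\<^esub>i\<in>{..<n}. outer (unit_vec i) (?e i)) p q = \<one>\<^bsub>Mat\<^esub> p q" .
    qed
  next
    fix b c v f
    assume "b \<in> carrier Mat" "c \<in> carrier Mat" "v \<in> carrier Vec" "f \<in> carrier Row"
    then show "outer (lact Vec b v) (ract Row f c) = b \<otimes>\<^bsub>Mat\<^esub> outer v f \<otimes>\<^bsub>Mat\<^esub> c"
      by (intro outer_bilinear) (auto simp del: vec_over_simps)
  next
    fix v a f assume "v \<in> carrier Vec" "a \<in> carrier A" "f \<in> carrier Row"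
    then show "outer (ract Vec v a) f = outer v (lact Row a f)"
      using unit_vec_closed by (auto simp: outer_def m_assoc fun_eq_iff)
  next
    fix v w f assume "v \<in> carrier Vec" "w \<in> carrier Vec" "f \<in> carrier Row"
    then show "outer (v \<oplus>\<^bsub>Vec\<^esub> w) f = outer v f \<oplus>\<^bsub>Mat\<^esub> outer w f"
      using unit_vec_closed by (auto simp: outer_def l_distr fun_eq_iff)
  next
    fix v f g assume "v \<in> carrier Vec" "f \<in> carrier Row" "g \<in> carrier Row"
    then show "outer v (f \<oplus>\<^bsub>Row\<^esub> g) = outer v f \<oplus>\<^bsub>Mat\<^esub> outer v g"
      using unit_vec_closed by (auto simp: outer_def r_distr fun_eq_iff)
  qed (simp_all add: outer_closed outer_lact ract_Row_outer Dual_closed unit_vec_closed e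
      del: vec_over_simps mat_over_simps Row_simps(2-))
  moreover have "\<exists>\<theta>. tensor_iso A Mat Row Vec \<theta>"
  \<comment> \<open>For the unit of \<open>A\<close> a single pair is enough, the basis vector of
    index 0 and its dual; it exists because \<open>0 < n\<close>.\<close>
  proof (rule RV.tensor_iso_of_context[where \<beta> = "\<lambda>f v. f v" and \<gamma> = outer and I = "{0::nat}"
        and u = ?e and v = unit_vec])
    show "(\<Oplus>i\<in>{0}. ?e i (unit_vec i)) = \<one>"
      using assms by (simp add: e_unit unit_vec_def)
  next
    fix f v g assume "f \<in> carrier Row" "v \<in> carrier Vec" "g \<in> carrier Row"
    then show "ract Row f (outer v g) = lact Row (f v) g"
      by (simp only: Row_simps(1) ract_Row_outer)
  qed (use lact_Vec_closed in \<open>simp_all add: outer_closed outer_lact Dual_closed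
      unit_vec_closed e Dual_add Dual_mult V.ract_closed m_assoc del: vec_over_simps mat_over_simps\<close>)
  ultimately show ?thesis
    using bimodule_Row unfolding invertible_bimod_def by blast
qed

end

section \<open>The strictification of an N-weak algebra\<close>

lemma (in Group.monoid) Units_cancel [simp]:
  assumes "u \<in> Units G" "x \<in> carrier G"
  shows "inv u \<otimes> (u \<otimes> x) = x" "u \<otimes> (inv u \<otimes> x) = x"
  using assms by (simp_all add: m_assoc[symmetric] Units_closed)

lemma (in Group.monoid) Units_inv_mult:
  assumes "u \<in> Units G" "v \<in> Units G"
  shows "inv (u \<otimes> v) = inv v \<otimes> inv u"
  using assms by (intro inv_unique'[symmetric]) (simp_all add: m_assoc Units_closed)

text \<open>
  In the application \<open>p g j\<close> is the index of \<open>g\<^sup>-\<^sup>1 e\<^sub>j\<close> and \<open>d g j = \<omega>\<^sub>3(g, g\<^sup>-\<^sup>1 e\<^sub>j)\<close>, where \<open>e\<close> enumerates the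
  group \<open>G\<^sub>1\<close>; then \<open>d_mult\<close> is the cocycle identity.
\<close>

locale twisting =
  fixes K :: "'k ring" and X :: "('g, 'x) xmod" and N :: "('k, 'a, 'g, 'x) nwalg"
    and R :: "('k, 'a) module" (structure)
    and n :: nat and p :: "'g \<Rightarrow> nat \<Rightarrow> nat" and d :: "'g \<Rightarrow> nat \<Rightarrow> 'a"
  assumes xmod: "graded_crossed_module X" and nweak: "nweak_algebra K X N" and alg_N: "alg N = R"
    and p_less: "g \<in> carrier (grp1 X) \<Longrightarrow> p g j < n \<longleftrightarrow> j < n"
    and p_one: "p \<one>\<^bsub>grp1 X\<^esub> j = j"
    and p_mult: "\<lbrakk>g \<in> carrier (grp1 X); h \<in> carrier (grp1 X)\<rbrakk>
      \<Longrightarrow> p (g \<otimes>\<^bsub>grp1 X\<^esub> h) j = p h (p g j)"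
    and d_unit: "g \<in> carrier (grp1 X) \<Longrightarrow> d g j \<in> Units R"
    and d_one: "d \<one>\<^bsub>grp1 X\<^esub> j = \<one>"
    and d_mult: "\<lbrakk>g \<in> carrier (grp1 X); h \<in> carrier (grp1 X); j < n\<rbrakk>
      \<Longrightarrow> d (g \<otimes>\<^bsub>grp1 X\<^esub> h) j \<otimes> om3 N g h = d g j \<otimes> unit_act X N g (d h (p g j))"
begin

abbreviation "G \<equiv> grp1 X"
abbreviation "w \<equiv> om1 N"
abbreviation "\<pi> \<equiv> grading X"
abbreviation "bd \<equiv> bdry X"
abbreviation "U \<equiv> unit_act X N"

sublocale X: graded_crossed_module X by (fact xmod)
sublocale N: nweak_algebra K X N by (fact nweak)
sublocale G: group G by (fact X.group1)
sublocale G2: group "grp2 X" by (fact X.group2)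
sublocale matrices K R n
  using N.assoc_algebra unfolding matrices_def alg_N .

lemma bd_closed [simp]: "x \<in> carrier (grp2 X) \<Longrightarrow> bd x \<in> carrier G"
  by (rule hom_in_carrier[OF X.bdry_hom])

lemma \<pi>_cases:
  assumes "g \<in> carrier G"
  obtains "\<pi> g = 1" | "\<pi> g = -1"
  using hom_in_carrier[OF X.grading_hom assms] by (auto simp: sign_img_def)

lemma \<pi>_mult: "\<lbrakk>g \<in> carrier G; h \<in> carrier G\<rbrakk> \<Longrightarrow> \<pi> (g \<otimes>\<^bsub>G\<^esub> h) = \<pi> g * \<pi> h"
  using hom_mult[OF X.grading_hom] by (simp add: sign_img_def)

lemma \<pi>_one: "\<pi> \<one>\<^bsub>G\<^esub> = 1"
  using \<pi>_mult[of "\<one>\<^bsub>G\<^esub>" "\<one>\<^bsub>G\<^esub>"] \<pi>_cases[of "\<one>\<^bsub>G\<^esub>"] by fastforce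

lemmas om3_unit = N.om3_unit[unfolded alg_N]
  and om2_unit = N.om2_unit[unfolded alg_N]

lemma p_inv:
  assumes "g \<in> carrier G"
  shows "p g (p (inv\<^bsub>G\<^esub> g) j) = j" "p (inv\<^bsub>G\<^esub> g) (p g j) = j"
  using p_mult[of "inv\<^bsub>G\<^esub> g" g j] p_mult[of g "inv\<^bsub>G\<^esub> g" j] assms p_one by simp_all

lemma p_not_less: "g \<in> carrier G \<Longrightarrow> n \<le> p g j \<longleftrightarrow> n \<le> j"
  using p_less[of g j] by (simp add: not_less[symmetric])

lemma finsum_p:
  assumes "g \<in> carrier G" "\<And>l. f l \<in> carrier R"
  shows "(\<Oplus>l\<in>{..<n}. f l) = (\<Oplus>l\<in>{..<n}. f (p g l))"
proof -
  have "inj_on (p g) {..<n}"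
    using p_inv[OF assms(1)] by (metis inj_onI)
  moreover have "p g ` {..<n} = {..<n}"
    using p_inv[OF assms(1)] p_less assms(1) p_less[OF G.inv_closed[OF assms(1)]]
    by (auto simp: image_iff) (metis lessThan_iff)
  ultimately show ?thesis
    using finsum_reindex[of f "p g" "{..<n}"] assms(2) by simp
qed

lemma w_iso: "g \<in> carrier G \<Longrightarrow> w g \<in> alg_iso K (signed_alg (\<pi> g) R) R"
  using N.om1_iso unfolding alg_N .

lemma w_props:
  assumes "g \<in> carrier G"
  shows w_closed [simp]: "a \<in> carrier R \<Longrightarrow> w g a \<in> carrier R"
    and w_one [simp]: "w g \<one> = \<one>"
    and w_add: "\<lbrakk>a \<in> carrier R; b \<in> carrier R\<rbrakk> \<Longrightarrow> w g (a \<oplus> b) = w g a \<oplus> w g b"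
    and w_smult: "\<lbrakk>k \<in> carrier K; a \<in> carrier R\<rbrakk> \<Longrightarrow> w g (k \<odot> a) = k \<odot> w g a"
    and w_mult_pos: "\<lbrakk>\<pi> g = 1; a \<in> carrier R; b \<in> carrier R\<rbrakk> \<Longrightarrow> w g (a \<otimes> b) = w g a \<otimes> w g b"
    and w_mult_neg: "\<lbrakk>\<pi> g = -1; a \<in> carrier R; b \<in> carrier R\<rbrakk> \<Longrightarrow> w g (a \<otimes> b) = w g b \<otimes> w g a"
    and w_bij: "bij_betw (w g) (carrier R) (carrier R)"
  using w_iso[OF assms]
  by (auto simp: alg_iso_def ring_iso_def ring_hom_def signed_alg_def op_alg_def split: if_splits)

lemma w_zero [simp]: "g \<in> carrier G \<Longrightarrow> w g \<zero> = \<zero>"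
  using w_add[of g \<zero> \<zero>] by (simp add: add.l_cancel_one')

lemma w_Units:
  assumes "g \<in> carrier G" "u \<in> Units R"
  shows "w g u \<in> Units R" "w g (inv u) = inv (w g u)"
proof -
  have *: "w g u \<otimes> w g (inv u) = \<one>" "w g (inv u) \<otimes> w g u = \<one>"
    using assms w_mult_pos[of g u "inv u"] w_mult_pos[of g "inv u" u]
      w_mult_neg[of g u "inv u"] w_mult_neg[of g "inv u" u]
    by (cases rule: \<pi>_cases[OF assms(1)]; simp add: Units_closed)+
  have cl: "w g u \<in> carrier R" "w g (inv u) \<in> carrier R"
    using assms by (simp_all add: Units_closed)
  then show "w g u \<in> Units R"
    using * unfolding Units_def by blast
  show "w g (inv u) = inv (w g u)"
    using cl * by (intro inv_unique') simp_all
qed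

lemma w_finsum:
  assumes "g \<in> carrier G" "\<And>l. f l \<in> carrier R"
  shows "w g (\<Oplus>l\<in>{..<n}. f l) = (\<Oplus>l\<in>{..<n}. w g (f l))"
  using assms by (intro finsum_additive[OF is_abelian_group is_abelian_group]) (auto simp: w_add)

text \<open>Reindexing by the permutation \<open>p g\<close> brings the sum into the form that
  arises when the twisted entries of \<open>str1 g\<close> or \<open>act_pos g\<close> are
  multiplied.\<close>

lemma w_dot_pos:
  assumes "g \<in> carrier G" "\<pi> g = 1" "\<And>l. f l \<in> carrier R" "\<And>l. h l \<in> carrier R"
  shows "w g (\<Oplus>l\<in>{..<n}. f l \<otimes> h l) = (\<Oplus>l\<in>{..<n}. w g (f (p g l)) \<otimes> w g (h (p g l)))"
  using assms finsum_p[of g "\<lambda>l. w g (f l) \<otimes> w g (h l)"]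
  by (simp add: w_finsum w_mult_pos)

lemma w_dot_neg:
  assumes "g \<in> carrier G" "\<pi> g = -1" "\<And>l. f l \<in> carrier R" "\<And>l. h l \<in> carrier R"
  shows "w g (\<Oplus>l\<in>{..<n}. f l \<otimes> h l) = (\<Oplus>l\<in>{..<n}. w g (h (p g l)) \<otimes> w g (f (p g l)))"
  using assms finsum_p[of g "\<lambda>l. w g (h l) \<otimes> w g (f l)"]
  by (simp add: w_finsum w_mult_neg)

lemma U_pos: "\<lbrakk>\<pi> g = 1; u \<in> carrier R\<rbrakk> \<Longrightarrow> U g u = w g u"
  and U_neg: "\<lbrakk>\<pi> g = -1; u \<in> carrier R\<rbrakk> \<Longrightarrow> U g u = w g (inv u)"
  by (simp_all add: unit_act_def alg_N int_pow_def2)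

lemma U_Units:
  assumes "g \<in> carrier G" "u \<in> Units R"
  shows "U g u \<in> Units R"
  using assms by (cases rule: \<pi>_cases[OF assms(1)]) (simp_all add: U_pos U_neg w_Units Units_closed)

text \<open>In degree -1 both inversion and \<open>w g\<close> reverse products, so their composite
  preserves them.\<close>

lemma U_mult:
  assumes "g \<in> carrier G" "u \<in> Units R" "v \<in> Units R"
  shows "U g (u \<otimes> v) = U g u \<otimes> U g v"
  using assms
  by (cases rule: \<pi>_cases[OF assms(1)])
    (simp_all add: U_pos U_neg w_mult_pos w_mult_neg Units_closed Units_inv_mult)

lemma U_inv:
  assumes "g \<in> carrier G" "u \<in> Units R"
  shows "U g (inv u) = inv (U g u)"
  using assms
  by (cases rule: \<pi>_cases[OF assms(1)]) (simp_all add: U_pos U_neg Units_closed w_Units)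

lemma w_comp:
  assumes "g \<in> carrier G" "h \<in> carrier G" "a \<in> carrier R"
  shows "w (g \<otimes>\<^bsub>G\<^esub> h) a = om3 N g h \<otimes> w g (w h a) \<otimes> inv (om3 N g h)"
  using N.om1_mult[unfolded alg_N] assms by blast

text \<open>\<open>w_comp\<close> conjugates by \<open>om3 N g h\<close>. Its left factor is
  absorbed by \<open>d_mult\<close>; the right factor stays and becomes the right multiplication in
  condition (b) of a 1-morphism.\<close>

lemma d_w_comp:
  assumes "g \<in> carrier G" "h \<in> carrier G" "a \<in> carrier R" "j < n"
  shows "d (g \<otimes>\<^bsub>G\<^esub> h) j \<otimes> w (g \<otimes>\<^bsub>G\<^esub> h) a =
    d g j \<otimes> U g (d h (p g j)) \<otimes> w g (w h a) \<otimes> inv (om3 N g h)"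
  using assms
  by (simp add: w_comp Units_closed om3_unit d_unit U_Units flip: d_mult m_assoc)

text \<open>The factor \<open>inv (om3 N g h)\<close> that remains in \<open>d_w_comp\<close> is
  absorbed by \<open>d_mult\<close> at the index \<open>j\<close>. No trace of \<open>om3\<close> is
  left, which is why \<open>str1\<close> composes strictly.\<close>

lemma d_w_comp_inv:
  assumes "g \<in> carrier G" "h \<in> carrier G" "a \<in> carrier R" "i < n" "j < n"
  shows "d (g \<otimes>\<^bsub>G\<^esub> h) i \<otimes> w (g \<otimes>\<^bsub>G\<^esub> h) a \<otimes> inv (d (g \<otimes>\<^bsub>G\<^esub> h) j) =
    d g i \<otimes> (U g (d h (p g i)) \<otimes> w g (w h a) \<otimes> inv (U g (d h (p g j)))) \<otimes> inv (d g j)"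
proof -
  have "inv (om3 N g h) \<otimes> inv (d (g \<otimes>\<^bsub>G\<^esub> h) j) = inv (d g j \<otimes> U g (d h (p g j)))"
    using assms by (simp add: Units_inv_mult om3_unit d_unit flip: d_mult)
  then show ?thesis
    using assms
    by (simp add: d_w_comp Units_inv_mult om3_unit d_unit U_Units Units_closed m_assoc)
qed

text \<open>
  The operator \<open>\<omega>\<^sub>M(g)\<close> is \<open>act_pos g\<close> or \<open>act_neg g\<close> below, and \<open>str1 g\<close> is conjugation by it. In degree -1
  it acts on row vectors, on which matrices operate from the right; hence the transposition \<open>tr\<close>.
\<close>

definition tr :: "int \<Rightarrow> (nat \<Rightarrow> nat \<Rightarrow> 'a) \<Rightarrow> nat \<Rightarrow> nat \<Rightarrow> 'a" where
  "tr s b i j = (if s = 1 then b i j else b j i)"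

definition str1 :: "'g \<Rightarrow> (nat \<Rightarrow> nat \<Rightarrow> 'a) \<Rightarrow> nat \<Rightarrow> nat \<Rightarrow> 'a" where
  "str1 g b i j = d g i \<otimes> w g (tr (\<pi> g) b (p g i) (p g j)) \<otimes> inv (d g j)"

definition monomial :: "(nat \<Rightarrow> nat) \<Rightarrow> (nat \<Rightarrow> 'a) \<Rightarrow> nat \<Rightarrow> nat \<Rightarrow> 'a" where
  "monomial q a i j = (if q i = j \<and> i < n then a i else \<zero>)"

text \<open>Since \<open>w (bd x)\<close> is conjugation by \<open>om2 N x\<close>, the operator of
  \<open>bd x\<close> on \<open>Vec\<close> followed by right multiplication by
  \<open>om2 N x\<close> is right linear. This is its matrix.\<close>

definition str2 :: "'x \<Rightarrow> nat \<Rightarrow> nat \<Rightarrow> 'a" where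
  "str2 x = monomial (p (bd x)) (\<lambda>i. d (bd x) i \<otimes> om2 N x)"

definition strictification :: "('k, nat \<Rightarrow> nat \<Rightarrow> 'a, 'g, 'x) nwalg" where
  "strictification = \<lparr>alg = Mat, om1 = str1, om2 = str2, om3 = (\<lambda>_ _. \<one>\<^bsub>Mat\<^esub>)\<rparr>"

lemma strictification_simps [simp]:
  "alg strictification = Mat" "om1 strictification = str1" "om2 strictification = str2"
  "om3 strictification g h = \<one>\<^bsub>Mat\<^esub>"
  by (simp_all add: strictification_def)

lemma d_closed [simp]: "g \<in> carrier G \<Longrightarrow> d g j \<in> carrier R" "g \<in> carrier G \<Longrightarrow> inv (d g j) \<in> carrier R"
  using d_unit by (simp_all add: Units_closed)

lemma tr_closed [simp]: "b \<in> carrier Mat \<Longrightarrow> tr s b i j \<in> carrier R"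
  by (simp add: tr_def)

lemma tr_outside: "\<lbrakk>b \<in> carrier Mat; n \<le> i \<or> n \<le> j\<rbrakk> \<Longrightarrow> tr s b i j = \<zero>"
  by (auto simp: tr_def)

lemma str1_closed: "\<lbrakk>g \<in> carrier G; b \<in> carrier Mat\<rbrakk> \<Longrightarrow> str1 g b \<in> carrier Mat"
  using tr_outside[of b] by (auto simp: str1_def p_not_less simp del: mat_over_simps(1) intro!: mat_over_simps(1)[THEN iffD2])

lemma str1_outside: "\<lbrakk>g \<in> carrier G; b \<in> carrier Mat; n \<le> i \<or> n \<le> j\<rbrakk> \<Longrightarrow> str1 g b i j = \<zero>"
  using str1_closed[of g b] unfolding mat_over_simps(1) by blast

lemma str1_one: "b \<in> carrier Mat \<Longrightarrow> str1 \<one>\<^bsub>G\<^esub> b = b"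
  using N.om1_one[unfolded alg_N] by (auto simp: str1_def p_one d_one \<pi>_one tr_def fun_eq_iff)

lemma str1_mult:
  assumes g: "g \<in> carrier G" and h: "h \<in> carrier G" and b: "b \<in> carrier Mat"
  shows "str1 (g \<otimes>\<^bsub>G\<^esub> h) b = str1 g (str1 h b)"
proof (intro ext)
  fix i j
  have gh: "g \<otimes>\<^bsub>G\<^esub> h \<in> carrier G" using g h by simp
  show "str1 (g \<otimes>\<^bsub>G\<^esub> h) b i j = str1 g (str1 h b) i j"
  proof (cases "i < n \<and> j < n")
    \<comment> \<open>\<open>d_mult\<close> speaks only about indices below \<open>n\<close>;
      outside this range both entries vanish.\<close>
    case False
    then show ?thesis
      using str1_outside[OF gh b] str1_outside[OF g str1_closed[OF h b]] by (simp add: not_less)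
  next
    case True
    let ?x = "tr (\<pi> (g \<otimes>\<^bsub>G\<^esub> h)) b (p h (p g i)) (p h (p g j))"
    have "str1 (g \<otimes>\<^bsub>G\<^esub> h) b i j =
        d g i \<otimes> (U g (d h (p g i)) \<otimes> w g (w h ?x) \<otimes> inv (U g (d h (p g j)))) \<otimes> inv (d g j)"
      unfolding str1_def p_mult[OF g h] using True b by (intro d_w_comp_inv g h) auto
    \<comment> \<open>In degree -1 the map \<open>w g\<close> reverses the three factors of an entry
      of \<open>str1 h b\<close>, while \<open>tr\<close> exchanges its indices. So the factor
      belonging to \<open>p g i\<close> is again on the left, inverted, as in
      \<open>U g\<close>.\<close>
    also have "U g (d h (p g i)) \<otimes> w g (w h ?x) \<otimes> inv (U g (d h (p g j))) =
        w g (tr (\<pi> g) (str1 h b) (p g i) (p g j))"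
      using g h b
      by (cases rule: \<pi>_cases[OF g]; cases rule: \<pi>_cases[OF h])
        (simp_all add: U_pos U_neg w_Units(2)[symmetric] d_unit str1_def tr_def \<pi>_mult w_mult_pos w_mult_neg m_assoc)
    finally show ?thesis
      by (simp add: str1_def)
  qed
qed

text \<open>The adjacent factors \<open>inv (d g l)\<close> and \<open>d g l\<close> cancel under
  the sum. What remains is \<open>w_dot_pos\<close> or, with transposed entries and exchanged
  factors, \<open>w_dot_neg\<close>.\<close>

lemma str1_dot:
  assumes g: "g \<in> carrier G" and b: "b \<in> carrier Mat" and c: "c \<in> carrier Mat"
  shows "str1 g b \<otimes>\<^bsub>Mat\<^esub> str1 g c = str1 g (if \<pi> g = 1 then b \<otimes>\<^bsub>Mat\<^esub> c else c \<otimes>\<^bsub>Mat\<^esub> b)"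
proof (intro ext)
  fix i j
  have "(\<Oplus>l\<in>{..<n}. str1 g b i l \<otimes> str1 g c l j) =
      (\<Oplus>l\<in>{..<n}. d g i \<otimes> ((w g (tr (\<pi> g) b (p g i) (p g l)) \<otimes> w g (tr (\<pi> g) c (p g l) (p g j))) \<otimes> inv (d g j)))"
    using assms d_unit by (intro finsum_cong' refl) (auto simp: str1_def m_assoc simp del: mat_over_simps)
  also have "\<dots> = d g i \<otimes>
      (\<Oplus>l\<in>{..<n}. w g (tr (\<pi> g) b (p g i) (p g l)) \<otimes> w g (tr (\<pi> g) c (p g l) (p g j))) \<otimes> inv (d g j)"
    using assms by (simp add: finsum_rdistr finsum_ldistr m_assoc Pi_def del: mat_over_simps)
  also have "(\<Oplus>l\<in>{..<n}. w g (tr (\<pi> g) b (p g i) (p g l)) \<otimes> w g (tr (\<pi> g) c (p g l) (p g j))) =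
      w g (tr (\<pi> g) (if \<pi> g = 1 then b \<otimes>\<^bsub>Mat\<^esub> c else c \<otimes>\<^bsub>Mat\<^esub> b) (p g i) (p g j))"
    using assms by (cases rule: \<pi>_cases[OF g]) (simp_all add: tr_def w_dot_pos w_dot_neg)
  finally show "(str1 g b \<otimes>\<^bsub>Mat\<^esub> str1 g c) i j =
      str1 g (if \<pi> g = 1 then b \<otimes>\<^bsub>Mat\<^esub> c else c \<otimes>\<^bsub>Mat\<^esub> b) i j"
    by (simp add: str1_def)
qed

lemma str1_iso:
  assumes g: "g \<in> carrier G"
  shows "str1 g \<in> alg_iso K (signed_alg (\<pi> g) Mat) Mat"
proof -
  \<comment> \<open>Strict composition provides the inverse map, namely \<open>str1\<close> at the
    inverse group element.\<close>
  have "bij_betw (str1 g) (carrier Mat) (carrier Mat)"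
    using g str1_mult[of "inv\<^bsub>G\<^esub> g" g] str1_mult[of g "inv\<^bsub>G\<^esub> g"] str1_one str1_closed
    by (intro bij_betw_byWitness[where f' = "str1 (inv\<^bsub>G\<^esub> g)"]) (auto simp del: mat_over_simps)
  moreover have "str1 g (b \<oplus>\<^bsub>Mat\<^esub> c) = str1 g b \<oplus>\<^bsub>Mat\<^esub> str1 g c" if "b \<in> carrier Mat" "c \<in> carrier Mat" for b c
    using that g by (auto simp: str1_def tr_def w_add l_distr r_distr fun_eq_iff)
  moreover have "str1 g \<one>\<^bsub>Mat\<^esub> = \<one>\<^bsub>Mat\<^esub>"
  proof -
    have inj: "p g i = p g j \<longleftrightarrow> i = j" for i j
      using p_inv(2)[OF g] by metis
    then show ?thesis
      using g d_unit[OF g] by (auto simp: str1_def tr_def p_less fun_eq_iff)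
  qed
  moreover have "str1 g (k \<odot>\<^bsub>Mat\<^esub> b) = k \<odot>\<^bsub>Mat\<^esub> str1 g b" if "k \<in> carrier K" "b \<in> carrier Mat" for k b
    using that g by (auto simp: str1_def tr_def w_smult smult_mult_left smult_mult_right fun_eq_iff)
  ultimately show ?thesis
    using g str1_closed str1_dot[OF g]
    by (auto simp: alg_iso_def ring_iso_def ring_hom_def signed_alg_def op_alg_def simp del: mat_over_simps)
qed

section \<open>Monomial matrices and the units \<open>str2\<close>\<close>

lemma monomial_closed:
  assumes "\<And>i. q i < n \<longleftrightarrow> i < n" "\<And>i. a i \<in> carrier R"
  shows "monomial q a \<in> carrier Mat"
  using assms by (auto simp: monomial_def) (metis not_less)

lemma monomial_lact:
  assumes "\<And>i. q i < n \<longleftrightarrow> i < n" "\<And>i. a i \<in> carrier R" "\<And>l. f l \<in> carrier R"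
  shows "(\<Oplus>l\<in>{..<n}. monomial q a i l \<otimes> f l) = (if i < n then a i \<otimes> f (q i) else \<zero>)"
  using assms dot_delta_left[of "a i" f "q i" "i < n"] by (simp add: monomial_def)

text \<open>With \<open>q'\<close> the inverse permutation of \<open>q\<close>, column
  \<open>j\<close> of the monomial matrix has its only entry in row \<open>q' j\<close>.\<close>

lemma monomial_ract:
  assumes "\<And>i. q' i < n \<longleftrightarrow> i < n" "\<And>i. q' (q i) = i" "\<And>i. q (q' i) = i"
    "\<And>i. a i \<in> carrier R" "\<And>l. f l \<in> carrier R"
  shows "(\<Oplus>l\<in>{..<n}. f l \<otimes> monomial q a l j) = (if j < n then f (q' j) \<otimes> a (q' j) else \<zero>)"
proof -
  have "q i < n \<longleftrightarrow> i < n" for i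
    using assms(1)[of "q i"] by (simp add: assms(2))
  then have "(\<Oplus>l\<in>{..<n}. f l \<otimes> monomial q a l j) =
      (\<Oplus>l\<in>{..<n}. (f l \<otimes> a l) \<otimes> (if l = q' j \<and> j < n then \<one> else \<zero>))"
    using assms by (intro finsum_cong' refl) (auto simp: monomial_def)
  then show ?thesis
    using assms dot_delta_right[of \<one> "\<lambda>l. f l \<otimes> a l" "q' j" "\<lambda>_. j < n"] by simp
qed

lemma monomial_mult:
  assumes "\<And>i. q i < n \<longleftrightarrow> i < n" "\<And>i. a i \<in> carrier R" "\<And>i. a' i \<in> carrier R"
  shows "monomial q a \<otimes>\<^bsub>Mat\<^esub> monomial q' a' = monomial (\<lambda>i. q' (q i)) (\<lambda>i. a i \<otimes> a' (q i))"
proof (intro ext)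
  fix i j
  have "\<And>l. monomial q' a' l j \<in> carrier R"
    using assms by (simp add: monomial_def)
  then show "(monomial q a \<otimes>\<^bsub>Mat\<^esub> monomial q' a') i j = monomial (\<lambda>i. q' (q i)) (\<lambda>i. a i \<otimes> a' (q i)) i j"
    using assms by (simp add: monomial_lact) (simp add: monomial_def)
qed

lemma om2_closed [simp]: "x \<in> carrier (grp2 X) \<Longrightarrow> om2 N x \<in> carrier R"
  "x \<in> carrier (grp2 X) \<Longrightarrow> inv (om2 N x) \<in> carrier R"
  using om2_unit by (simp_all add: Units_closed)

text \<open>The inverse permutation, with the coefficients inverted and each read in the row of
  \<open>str2 x\<close> from which it comes.\<close>

definition str2_inv :: "'x \<Rightarrow> nat \<Rightarrow> nat \<Rightarrow> 'a" where
  "str2_inv x = monomial (p (inv\<^bsub>G\<^esub> bd x)) (\<lambda>i. inv (d (bd x) (p (inv\<^bsub>G\<^esub> bd x) i) \<otimes> om2 N x))"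

lemma str2_Units:
  assumes x: "x \<in> carrier (grp2 X)"
  shows "str2 x \<in> Units Mat" "inv\<^bsub>Mat\<^esub> (str2 x) = str2_inv x"
proof -
  interpret M: ring Mat by (rule ring_Mat)
  have u: "d (bd x) i \<otimes> om2 N x \<in> Units R" for i
    using x by (simp add: d_unit om2_unit)
  have one: "\<one>\<^bsub>Mat\<^esub> = monomial (\<lambda>i. i) (\<lambda>i. \<one>)"
    by (auto simp: monomial_def fun_eq_iff)
  have *: "str2 x \<in> carrier Mat" "str2_inv x \<in> carrier Mat"
    unfolding str2_def str2_inv_def using x u by (auto intro!: monomial_closed simp: p_less Units_closed simp del: mat_over_simps)
  have 1: "str2 x \<otimes>\<^bsub>Mat\<^esub> str2_inv x = \<one>\<^bsub>Mat\<^esub>" "str2_inv x \<otimes>\<^bsub>Mat\<^esub> str2 x = \<one>\<^bsub>Mat\<^esub>"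
    unfolding str2_def str2_inv_def one using x u p_inv
    by (subst monomial_mult; simp add: p_less Units_closed del: mat_over_simps)+
  then show "str2 x \<in> Units Mat"
    using * by (auto simp: Units_def simp del: mat_over_simps)
  show "inv\<^bsub>Mat\<^esub> (str2 x) = str2_inv x"
    using * 1 by (intro M.inv_unique'[symmetric])
qed

lemma bdry_mult: "\<lbrakk>x \<in> carrier (grp2 X); y \<in> carrier (grp2 X)\<rbrakk> \<Longrightarrow> bd (x \<otimes>\<^bsub>grp2 X\<^esub> y) = bd x \<otimes>\<^bsub>G\<^esub> bd y"
  using hom_mult[OF X.bdry_hom] .

lemma w_bdry: "\<lbrakk>x \<in> carrier (grp2 X); a \<in> carrier R\<rbrakk> \<Longrightarrow> w (bd x) a = om2 N x \<otimes> a \<otimes> inv (om2 N x)"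
  using N.om1_bdry[unfolded alg_N] .

text \<open>\<open>om2_mult\<close> contributes a factor \<open>om3 N (bd x) (bd y)\<close>, which
  \<open>d_mult\<close> absorbs. The resulting \<open>w (bd x)\<close> is conjugation by
  \<open>om2 N x\<close>, and this moves \<open>om2 N x\<close> to the left of the second
  coefficient \<open>d\<close>.\<close>

lemma str2_mult:
  assumes x: "x \<in> carrier (grp2 X)" and y: "y \<in> carrier (grp2 X)"
  shows "str2 (x \<otimes>\<^bsub>grp2 X\<^esub> y) = str2 x \<otimes>\<^bsub>Mat\<^esub> str2 y"
proof -
  have "d (bd x \<otimes>\<^bsub>G\<^esub> bd y) i \<otimes> om2 N (x \<otimes>\<^bsub>grp2 X\<^esub> y) =
      d (bd x) i \<otimes> om2 N x \<otimes> (d (bd y) (p (bd x) i) \<otimes> om2 N y)" if "i < n" for i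
  proof -
    have "d (bd x \<otimes>\<^bsub>G\<^esub> bd y) i \<otimes> om2 N (x \<otimes>\<^bsub>grp2 X\<^esub> y) =
        (d (bd x \<otimes>\<^bsub>G\<^esub> bd y) i \<otimes> om3 N (bd x) (bd y)) \<otimes> (om2 N x \<otimes> om2 N y)"
      using x y by (simp add: N.om2_mult[unfolded alg_N] m_assoc Units_closed om3_unit)
    also have "\<dots> = (d (bd x) i \<otimes> w (bd x) (d (bd y) (p (bd x) i))) \<otimes> (om2 N x \<otimes> om2 N y)"
      using x y that by (simp add: d_mult U_pos X.grading_bdry)
    also have "\<dots> = d (bd x) i \<otimes> om2 N x \<otimes> (d (bd y) (p (bd x) i) \<otimes> om2 N y)"
      using x y by (simp add: w_bdry m_assoc om2_unit)
    finally show ?thesis .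
  qed
  then have "str2 (x \<otimes>\<^bsub>grp2 X\<^esub> y) = monomial (\<lambda>i. p (bd y) (p (bd x) i))
      (\<lambda>i. d (bd x) i \<otimes> om2 N x \<otimes> (d (bd y) (p (bd x) i) \<otimes> om2 N y))"
    using x y by (auto simp: str2_def monomial_def bdry_mult p_mult fun_eq_iff)
  then show ?thesis
    unfolding str2_def using x y by (subst monomial_mult) (auto simp: p_less simp del: mat_over_simps)
qed

text \<open>As \<open>w (bd x)\<close> is conjugation by \<open>om2 N x\<close>, the outer factors
  in \<open>str1 (bd x)\<close> combine with it to the coefficients
  \<open>d (bd x) i \<otimes> om2 N x\<close> of \<open>str2 x\<close> and their inverses.\<close>

lemma str2_bdry:
  assumes x: "x \<in> carrier (grp2 X)" and b: "b \<in> carrier Mat"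
  shows "str1 (bd x) b = str2 x \<otimes>\<^bsub>Mat\<^esub> b \<otimes>\<^bsub>Mat\<^esub> inv\<^bsub>Mat\<^esub> (str2 x)"
proof (intro ext)
  fix i j
  have u: "d (bd x) i \<otimes> om2 N x \<in> Units R" for i
    using x by (simp add: d_unit om2_unit)
  have "(str2 x \<otimes>\<^bsub>Mat\<^esub> b) i l = (if i < n then d (bd x) i \<otimes> om2 N x \<otimes> b (p (bd x) i) l else \<zero>)" for i l
    using x b by (simp add: str2_def monomial_lact p_less)
  then have "(str2 x \<otimes>\<^bsub>Mat\<^esub> b \<otimes>\<^bsub>Mat\<^esub> inv\<^bsub>Mat\<^esub> (str2 x)) i j =
      (\<Oplus>l\<in>{..<n}. (if i < n then d (bd x) i \<otimes> om2 N x \<otimes> b (p (bd x) i) l else \<zero>) \<otimes> str2_inv x l j)"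
    using x by (simp add: str2_Units)
  also have "\<dots> = (if j < n then (if i < n then d (bd x) i \<otimes> om2 N x \<otimes> b (p (bd x) i) (p (bd x) j) else \<zero>)
      \<otimes> inv (d (bd x) j \<otimes> om2 N x) else \<zero>)"
    unfolding str2_inv_def using x b u
    by (subst monomial_ract[where q' = "p (bd x)"]) (auto simp: p_less p_inv Units_closed)
  also have "\<dots> = str1 (bd x) b i j"
    using x b u str1_outside[OF bd_closed[OF x] b, of i j]
    by (auto simp: str1_def tr_def X.grading_bdry w_bdry Units_inv_mult d_unit om2_unit m_assoc not_less)
  finally show "str1 (bd x) b i j = (str2 x \<otimes>\<^bsub>Mat\<^esub> b \<otimes>\<^bsub>Mat\<^esub> inv\<^bsub>Mat\<^esub> (str2 x)) i j" by simp
qed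

text \<open>This is the axiom on \<open>\<omega>\<^sub>2\<close> of an acted element, read at one
  nonzero entry. Each of its three factors \<open>om3\<close> is rewritten by \<open>d_mult\<close>.
  Two of them, those with the inverse of \<open>g\<close> as second argument, bring in a value of
  \<open>d\<close> at that inverse; \<open>eq\<close> makes both values equal to \<open>?y\<close>,
  and they cancel.\<close>

lemma om2_act_entry:
  assumes g: "g \<in> carrier G" and x: "x \<in> carrier (grp2 X)" and i: "i < n" and j: "j < n"
    and eq: "p (bd x) (p g i) = p g j"
  shows "d (bd (actn X g x)) i \<otimes> om2 N (actn X g x) =
    d g i \<otimes> U g (d (bd x) (p g i) \<otimes> om2 N x) \<otimes> inv (d g j)"
proof -
  let ?h = "g \<otimes>\<^bsub>G\<^esub> bd x" and ?g' = "inv\<^bsub>G\<^esub> g"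
  let ?s = "om3 N g (bd x)" and ?y = "d ?g' (p g j)"
  have cl: "?h \<in> carrier G" "?g' \<in> carrier G" "bd x \<in> carrier G"
    using g x by auto
  note units = om3_unit d_unit om2_unit U_Units Units_closed
  have pi: "\<pi> ?h = \<pi> g"
    using g x by (simp add: \<pi>_mult X.grading_bdry)
  \<comment> \<open>\<open>?h\<close> has the degree of \<open>g\<close>, and up to conjugation by
    \<open>?s\<close> the map \<open>w ?h\<close> is \<open>w g\<close> after conjugation by
    \<open>om2 N x\<close>. On units this reads the same in both degrees.\<close>
  have Uh: "U ?h u = ?s \<otimes> U g (om2 N x \<otimes> u \<otimes> inv (om2 N x)) \<otimes> inv ?s" if u: "u \<in> Units R" for u
    using g x u cl
    by (cases rule: \<pi>_cases[OF g])
      (simp_all add: U_pos U_neg pi w_comp units w_bdry Units_inv_mult m_assoc)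
  \<comment> \<open>By \<open>eq\<close> the index \<open>p ?h i\<close> is \<open>p g j\<close>, so
    the value of \<open>d\<close> that appears is \<open>?y\<close>.\<close>
  have 1: "d (?h \<otimes>\<^bsub>G\<^esub> ?g') i \<otimes> om3 N ?h ?g' = d ?h i \<otimes> U ?h ?y"
    using d_mult[OF cl(1,2) i] eq g cl by (simp add: p_mult)
  have 2: "d ?h i \<otimes> ?s = d g i \<otimes> U g (d (bd x) (p g i))"
    using d_mult[OF g cl(3) i] .
  have "om3 N g ?g' = d g j \<otimes> U g ?y"
    using d_mult[OF g cl(2) j] g om3_unit[OF g cl(2)] by (simp add: d_one Units_closed)
  then have 3: "inv (om3 N g ?g') = inv (U g ?y) \<otimes> inv (d g j)"
    using g cl by (simp add: Units_inv_mult units)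
  have "d (bd (actn X g x)) i \<otimes> om2 N (actn X g x) =
      (d (?h \<otimes>\<^bsub>G\<^esub> ?g') i \<otimes> om3 N ?h ?g') \<otimes> ?s \<otimes> U g (om2 N x) \<otimes> inv (om3 N g ?g')"
    using g x cl by (simp add: X.bdry_actn N.om2_actn[unfolded alg_N] units m_assoc)
  also have "\<dots> = d ?h i \<otimes> ?s \<otimes> (U g (om2 N x) \<otimes> U g ?y \<otimes> inv (U g (om2 N x))) \<otimes> U g (om2 N x) \<otimes> inv (om3 N g ?g')"
    unfolding 1 using g x cl by (simp add: Uh units U_mult U_inv m_assoc)
  also have "\<dots> = d g i \<otimes> U g (d (bd x) (p g i)) \<otimes> U g (om2 N x) \<otimes> inv (d g j)"
    unfolding 2 3 using g x cl by (simp add: units m_assoc)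
  finally show ?thesis
    using g x cl by (simp add: U_mult units m_assoc)
qed

text \<open>Both sides are supported where \<open>p (bd x) (p g i) = p g j\<close>, and
  \<open>om2_act_entry\<close> compares the coefficients there.\<close>

lemma str2_act:
  assumes g: "g \<in> carrier G" and x: "x \<in> carrier (grp2 X)"
  shows "str2 (actn X g x) = str1 g (str2 x [^]\<^bsub>Mat\<^esub> \<pi> g)"
proof (intro ext)
  fix i j
  interpret M: ring Mat by (rule ring_Mat)
  let ?q = "p (bd (actn X g x))"
  have cl: "g \<otimes>\<^bsub>G\<^esub> bd x \<in> carrier G" "inv\<^bsub>G\<^esub> g \<in> carrier G" "bd x \<in> carrier G"
    using g x by auto
  have q: "?q i = p (inv\<^bsub>G\<^esub> g) (p (bd x) (p g i))"
    using g x cl by (simp add: X.bdry_actn p_mult)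
  have iff: "?q i = j \<longleftrightarrow> p (bd x) (p g i) = p g j"
    unfolding q using p_inv[OF g] by metis
  have iff': "p (inv\<^bsub>G\<^esub> bd x) (p g j) = p g i \<longleftrightarrow> p (bd x) (p g i) = p g j"
    using p_inv[OF cl(3)] by metis
  have less: "j < n \<longleftrightarrow> i < n" if "p (bd x) (p g i) = p g j"
    using p_less[OF g] p_less[OF cl(3)] that by metis
  have u: "d (bd x) i \<otimes> om2 N x \<in> Units R" for i
    using x by (simp add: d_unit om2_unit)
  have pow: "str2 x [^]\<^bsub>Mat\<^esub> \<pi> g = (if \<pi> g = 1 then str2 x else str2_inv x)"
    using M.Units_closed[OF str2_Units(1)[OF x]]
    by (cases rule: \<pi>_cases[OF g]) (simp_all add: int_pow_def2 str2_Units[OF x] del: mat_over_simps)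
  \<comment> \<open>In degree -1 the transpose of \<open>str2_inv x\<close> has the support of
    \<open>str2 x\<close> with inverted coefficients, and \<open>w g\<close> of an inverse is
    \<open>U g\<close>.\<close>
  have "w g (tr (\<pi> g) (str2 x [^]\<^bsub>Mat\<^esub> \<pi> g) (p g i) (p g j)) =
      (if p (bd x) (p g i) = p g j \<and> i < n then U g (d (bd x) (p g i) \<otimes> om2 N x) else \<zero>)"
    unfolding pow using g x cl u less iff'
    by (cases rule: \<pi>_cases[OF g])
      (auto simp: tr_def str2_def str2_inv_def monomial_def p_less U_pos U_neg Units_closed)
  then have "str1 g (str2 x [^]\<^bsub>Mat\<^esub> \<pi> g) i j =
      (if p (bd x) (p g i) = p g j \<and> i < n
       then d g i \<otimes> U g (d (bd x) (p g i) \<otimes> om2 N x) \<otimes> inv (d g j) else \<zero>)"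
    using g by (simp add: str1_def)
  also have "\<dots> = str2 (actn X g x) i j"
    using om2_act_entry[OF g x] iff less by (auto simp: str2_def monomial_def)
  finally show "str2 (actn X g x) i j = str1 g (str2 x [^]\<^bsub>Mat\<^esub> \<pi> g) i j" by simp
qed

lemma strict_strictification: "strict_algebra K X strictification"
proof -
  interpret M: ring Mat by (rule ring_Mat)
  \<comment> \<open>The trivial \<open>om3\<close> enters the cocycle identity through the action on
    units, so that action has to fix the unit matrix in both degrees.\<close>
  have one_pow: "unit_act X strictification g \<one>\<^bsub>Mat\<^esub> = \<one>\<^bsub>Mat\<^esub>" if g: "g \<in> carrier G" for g
  proof -
    have "\<one>\<^bsub>Mat\<^esub> [^]\<^bsub>Mat\<^esub> \<pi> g = \<one>\<^bsub>Mat\<^esub>"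
      by (simp add: int_pow_def2 M.nat_pow_one del: mat_over_simps)
    then show ?thesis
      using str1_iso[OF g]
      by (auto simp: unit_act_def alg_iso_def ring_iso_def ring_hom_def signed_alg_def op_alg_def
          simp del: mat_over_simps split: if_splits)
  qed
  have act: "unit_act X strictification g (str2 x) = str2 (actn X g x)"
    if "g \<in> carrier G" "x \<in> carrier (grp2 X)" for g x
    using str2_act[OF that] by (simp add: unit_act_def del: mat_over_simps)
  have act_closed: "actn X g x \<in> carrier (grp2 X)" if "g \<in> carrier G" "x \<in> carrier (grp2 X)" for g x
    using hom_in_carrier[OF X.actn_hom] that .
  have "bd \<one>\<^bsub>grp2 X\<^esub> = \<one>\<^bsub>G\<^esub>"
    by (rule hom_one[OF X.bdry_hom X.group2 X.group1])
  then have str2_one: "str2 \<one>\<^bsub>grp2 X\<^esub> = \<one>\<^bsub>Mat\<^esub>"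
    using N.om2_one by (auto simp: str2_def monomial_def p_one d_one alg_N fun_eq_iff)
  note str2_closed = M.Units_closed[OF str2_Units(1)]
  note simps = str2_closed str1_closed str2_Units(1) str2_one str1_one one_pow act act_closed
  show ?thesis
  proof (intro strict_algebra.intro nweak_algebra.intro strict_algebra_axioms.intro)
    fix g assume "g \<in> carrier G"
    then show "om1 strictification g \<in> alg_iso K (signed_alg (\<pi> g) (alg strictification)) (alg strictification)"
      using str1_iso by (simp del: mat_over_simps)
  next
    fix g h b assume "g \<in> carrier G" "h \<in> carrier G" "b \<in> carrier (alg strictification)"
    then show "om1 strictification (g \<otimes>\<^bsub>G\<^esub> h) b = om3 strictification g h \<otimes>\<^bsub>alg strictification\<^esub>
        om1 strictification g (om1 strictification h b) \<otimes>\<^bsub>alg strictification\<^esub>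
        inv\<^bsub>alg strictification\<^esub> om3 strictification g h"
      by (simp add: str1_mult str1_closed del: mat_over_simps)
  next
    fix x b assume "x \<in> carrier (grp2 X)" "b \<in> carrier (alg strictification)"
    then show "om1 strictification (bd x) b = om2 strictification x \<otimes>\<^bsub>alg strictification\<^esub> b
        \<otimes>\<^bsub>alg strictification\<^esub> inv\<^bsub>alg strictification\<^esub> om2 strictification x"
      using str2_bdry by (simp del: mat_over_simps)
  next
    fix x y assume "x \<in> carrier (grp2 X)" "y \<in> carrier (grp2 X)"
    then show "om2 strictification (x \<otimes>\<^bsub>grp2 X\<^esub> y) = om3 strictification (bd x) (bd y) \<otimes>\<^bsub>alg strictification\<^esub>
        om2 strictification x \<otimes>\<^bsub>alg strictification\<^esub> om2 strictification y"
      using str2_mult by (simp add: str2_closed del: mat_over_simps)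
  qed (simp_all add: assoc_algebra_Mat simps del: mat_over_simps)
qed

end

section \<open>The structure maps of the 1-morphism on column vectors\<close>

context twisting
begin

definition act_pos :: "'g \<Rightarrow> (nat \<Rightarrow> 'a) \<Rightarrow> nat \<Rightarrow> 'a" where
  "act_pos g v j = d g j \<otimes> w g (v (p g j))"

definition act_neg :: "'g \<Rightarrow> ((nat \<Rightarrow> 'a) \<Rightarrow> 'a) \<Rightarrow> nat \<Rightarrow> 'a" where
  "act_neg g f = act_pos g (\<lambda>i. f (unit_vec i))"

text \<open>An inverse function is taken because \<open>w\<close> at the inverse group element
  inverts \<open>w g\<close> only up to conjugation by a value of \<open>om3\<close>.\<close>

definition w_inv :: "'g \<Rightarrow> 'a \<Rightarrow> 'a" where
  "w_inv g = inv_into (carrier R) (w g)"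

definition act_inv :: "'g \<Rightarrow> (nat \<Rightarrow> 'a) \<Rightarrow> nat \<Rightarrow> 'a" where
  "act_inv g v i = w_inv g (inv (d g (p (inv\<^bsub>G\<^esub> g) i)) \<otimes> v (p (inv\<^bsub>G\<^esub> g) i))"

lemma w_inv:
  assumes "g \<in> carrier G" "a \<in> carrier R"
  shows w_inv_closed [simp]: "w_inv g a \<in> carrier R"
    and w_w_inv [simp]: "w g (w_inv g a) = a"
    and w_inv_w [simp]: "w_inv g (w g a) = a"
  using w_bij[OF assms(1)] assms(2) unfolding w_inv_def
  by (auto simp: bij_betw_def inv_into_into f_inv_into_f)

lemma w_inv_zero [simp]: "g \<in> carrier G \<Longrightarrow> w_inv g \<zero> = \<zero>"
  using w_inv_w[of g \<zero>] by simp

lemma act_pos_closed: "\<lbrakk>g \<in> carrier G; v \<in> carrier Vec\<rbrakk> \<Longrightarrow> act_pos g v \<in> carrier Vec"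
  by (simp add: act_pos_def p_not_less)

lemma act_inv_closed: "\<lbrakk>g \<in> carrier G; v \<in> carrier Vec\<rbrakk> \<Longrightarrow> act_inv g v \<in> carrier Vec"
  by (simp add: act_inv_def p_not_less)

lemma act_pos_inv: "\<lbrakk>g \<in> carrier G; v \<in> carrier Vec\<rbrakk> \<Longrightarrow> act_pos g (act_inv g v) = v"
  by (simp add: act_pos_def act_inv_def p_inv d_unit fun_eq_iff)

lemma act_inv_pos: "\<lbrakk>g \<in> carrier G; v \<in> carrier Vec\<rbrakk> \<Longrightarrow> act_inv g (act_pos g v) = v"
  by (simp add: act_pos_def act_inv_def p_inv d_unit fun_eq_iff)

lemma coords_closed: "f \<in> carrier Dual \<Longrightarrow> (\<lambda>i. f (unit_vec i)) \<in> carrier Vec"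
  by (simp add: Dual_unit_vec_outside)

lemma coords_functional: "v \<in> carrier Vec \<Longrightarrow> (\<lambda>i. functional v (unit_vec i)) = v"
proof
  fix i assume v: "v \<in> carrier Vec"
  show "functional v (unit_vec i) = v i"
    using v functional_unit_vec[of v i] Dual_unit_vec_outside[OF functional_closed, of v i]
    by (cases "i < n") auto
qed

lemma act_neg_functional: "v \<in> carrier Vec \<Longrightarrow> act_neg g (functional v) = act_pos g v"
  by (simp add: act_neg_def coords_functional del: vec_over_simps)

lemma act_pos_bij:
  assumes g: "g \<in> carrier G"
  shows "bij_betw (act_pos g) (carrier Vec) (carrier Vec)"
  using act_pos_closed[OF g] act_inv_closed[OF g] act_pos_inv[OF g] act_inv_pos[OF g]
  by (intro bij_betw_byWitness[where f' = "act_inv g"]) (auto simp del: vec_over_simps)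

lemma functional_Vec_closed: "v \<in> carrier Vec \<Longrightarrow> functional v \<in> carrier Dual"
  by (intro functional_closed) simp

lemma act_neg_bij:
  assumes g: "g \<in> carrier G"
  shows "bij_betw (act_neg g) (carrier Dual) (carrier Vec)"
proof -
  have "bij_betw (\<lambda>f i. f (unit_vec i)) (carrier Dual) (carrier Vec)"
    using coords_closed coords_functional functional_Vec_closed Dual_eq_functional
    by (intro bij_betw_byWitness[where f' = functional]) (auto simp del: vec_over_simps)
  from bij_betw_trans[OF this act_pos_bij[OF g]] show ?thesis
    by (simp add: act_neg_def[abs_def] comp_def)
qed

lemma inv_into_act_pos:
  assumes g: "g \<in> carrier G" and v: "v \<in> carrier Vec"
  shows "inv_into (carrier Vec) (act_pos g) v = act_inv g v"
  using act_pos_bij[OF g] act_inv_closed[OF g v] act_pos_inv[OF g v]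
  by (intro inv_into_f_eq) (auto simp: bij_betw_def simp del: vec_over_simps)

lemma inv_into_act_neg:
  assumes g: "g \<in> carrier G" and v: "v \<in> carrier Vec"
  shows "inv_into (carrier Dual) (act_neg g) v = functional (act_inv g v)"
  using act_neg_bij[OF g] act_inv_closed[OF g v] act_pos_inv[OF g v]
  by (intro inv_into_f_eq)
    (auto simp: bij_betw_def functional_Vec_closed act_neg_functional simp del: vec_over_simps)

text \<open>Transported functionals are needed only at unit vectors. The preimage of such a vector
  is a right multiple of a single unit vector, to which right linearity applies.\<close>

lemma act_inv_unit_vec:
  assumes g: "g \<in> carrier G" and i: "i < n"
  shows "act_inv g (unit_vec i) = ract Vec (unit_vec (p g i)) (w_inv g (inv (d g i)))"
proof
  fix l
  have "p (inv\<^bsub>G\<^esub> g) l = i \<longleftrightarrow> l = p g i"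
    using p_inv[OF g] by metis
  then show "act_inv g (unit_vec i) l = ract Vec (unit_vec (p g i)) (w_inv g (inv (d g i))) l"
    using g i by (auto simp: act_inv_def unit_vec_def p_less)
qed

lemma transport_pos:
  assumes g: "g \<in> carrier G" "\<pi> g = 1" and f: "f \<in> carrier Dual" and i: "i < n"
  shows "dual_transport N Vec g (carrier Vec) (act_pos g) f (unit_vec i) =
    w g (f (unit_vec (p g i))) \<otimes> inv (d g i)"
  using assms Dual_mult[OF f unit_vec_closed, of "w_inv g (inv (d g i))" "p g i"] unit_vec_closed[of i]
  by (simp add: dual_transport_def inv_into_act_pos act_inv_unit_vec w_mult_pos del: vec_over_simps)

text \<open>Here the scalar from \<open>act_inv_unit_vec\<close> becomes the coefficient of a
  functional and stands to the left of \<open>v (p g i)\<close>. Since \<open>w g\<close> reverses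
  products, it ends on the right, in the same form as in \<open>transport_pos\<close>.\<close>

lemma transport_neg:
  assumes g: "g \<in> carrier G" "\<pi> g = -1" and v: "v \<in> carrier Vec" and i: "i < n"
  shows "dual_transport N Vec g (carrier Dual) (act_neg g) (ev_bimod R Vec v) (unit_vec i) =
    w g (v (p g i)) \<otimes> inv (d g i)"
proof -
  have "functional (act_inv g (unit_vec i)) v = w_inv g (inv (d g i)) \<otimes> v (p g i)"
  proof -
    have "functional (act_inv g (unit_vec i)) v =
        (\<Oplus>l\<in>{..<n}. (if p g i = l \<and> p g i < n then w_inv g (inv (d g i)) else \<zero>) \<otimes> v l)"
      using g i v by (auto simp: functional_def act_inv_unit_vec unit_vec_def intro!: finsum_cong')
    also have "\<dots> = w_inv g (inv (d g i)) \<otimes> v (p g i)"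
      using dot_delta_left[of "w_inv g (inv (d g i))" v "p g i" "p g i < n"] g i v by (simp add: p_less)
    finally show ?thesis .
  qed
  moreover have "functional (act_inv g (unit_vec i)) \<in> carrier Dual"
    by (intro functional_Vec_closed act_inv_closed g unit_vec_closed)
  moreover have "v (p g i) \<in> carrier R"
    using v by simp
  ultimately show ?thesis
    using g i unit_vec_closed[of i]
    by (simp add: dual_transport_def inv_into_act_neg ev_bimod_def w_mult_neg del: vec_over_simps)
qed

text \<open>In degree -1 \<open>U g\<close> inverts and \<open>w g\<close> collects its factors in
  reverse order, so the coefficient of \<open>h\<close> appears inverted and on the right, exactly
  as in the coordinates of a transported functional.\<close>

lemma d_w_comp_neg:
  assumes g: "g \<in> carrier G" "\<pi> g = -1" and h: "h \<in> carrier G" and a: "a \<in> carrier R" and j: "j < n"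
  shows "d (g \<otimes>\<^bsub>G\<^esub> h) j \<otimes> w (g \<otimes>\<^bsub>G\<^esub> h) a =
    d g j \<otimes> w g (w h a \<otimes> inv (d h (p g j))) \<otimes> inv (om3 N g h)"
  using assms by (simp add: d_w_comp U_neg w_mult_neg m_assoc Units_closed om3_unit)

lemma d_w_comp_pos:
  assumes g: "g \<in> carrier G" "\<pi> g = 1" and h: "h \<in> carrier G" and a: "a \<in> carrier R" and j: "j < n"
  shows "d (g \<otimes>\<^bsub>G\<^esub> h) j \<otimes> w (g \<otimes>\<^bsub>G\<^esub> h) a =
    d g j \<otimes> w g (d h (p g j) \<otimes> w h a) \<otimes> inv (om3 N g h)"
  using assms by (simp add: d_w_comp U_pos w_mult_pos m_assoc Units_closed om3_unit)

lemma act_pos_comp: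
  assumes g: "g \<in> carrier G" "\<pi> g = 1" and h: "h \<in> carrier G" and v: "v \<in> carrier Vec"
  shows "act_pos (g \<otimes>\<^bsub>G\<^esub> h) v = ract Vec (act_pos g (act_pos h v)) (inv (om3 N g h))"
proof
  fix j
  show "act_pos (g \<otimes>\<^bsub>G\<^esub> h) v j = ract Vec (act_pos g (act_pos h v)) (inv (om3 N g h)) j"
  proof (cases "j < n")
    case True
    then show ?thesis
      using assms by (simp add: act_pos_def p_mult d_w_comp_pos)
  next
    case False
    then show ?thesis
      using assms by (simp add: act_pos_def p_mult p_not_less Units_closed om3_unit)
  qed
qed

text \<open>Only the coordinates of \<open>f\<close> are prescribed, and they have the same form for
  both degrees of \<open>h\<close>. One statement thus covers the transport of a functional and that
  of a double dual element.\<close>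

lemma act_neg_comp:
  assumes g: "g \<in> carrier G" "\<pi> g = -1" and h: "h \<in> carrier G" and v: "v \<in> carrier Vec"
    and f: "\<And>i. i < n \<Longrightarrow> f (unit_vec i) = w h (v (p h i)) \<otimes> inv (d h i)"
    and f_outside: "\<And>i. n \<le> i \<Longrightarrow> f (unit_vec i) = \<zero>"
  shows "act_pos (g \<otimes>\<^bsub>G\<^esub> h) v = ract Vec (act_neg g f) (inv (om3 N g h))"
proof
  fix j
  show "act_pos (g \<otimes>\<^bsub>G\<^esub> h) v j = ract Vec (act_neg g f) (inv (om3 N g h)) j"
  proof (cases "j < n")
    case True
    then show ?thesis
      using assms by (simp add: act_pos_def act_neg_def p_mult d_w_comp_neg p_less)
  next
    case False
    then show ?thesis
      using assms by (simp add: act_pos_def act_neg_def p_mult p_not_less Units_closed om3_unit)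
  qed
qed

lemma unit_vec_outside: "n \<le> i \<Longrightarrow> unit_vec i = \<zero>\<^bsub>Vec\<^esub>"
  by (auto simp: unit_vec_def fun_eq_iff)

lemma transport_outside_pos:
  assumes "g \<in> carrier G" "f \<in> carrier Dual" "n \<le> i"
  shows "dual_transport N Vec g (carrier Vec) (act_pos g) f (unit_vec i) = \<zero>"
proof -
  have "act_inv g (\<lambda>i. \<zero>) = (\<lambda>i. \<zero>)"
    using assms by (simp add: act_inv_def fun_eq_iff)
  then show ?thesis
    using assms Dual_zero[OF assms(2)] by (simp add: dual_transport_def unit_vec_outside inv_into_act_pos)
qed

lemma transport_outside_neg:
  assumes "g \<in> carrier G" "v \<in> carrier Vec" "n \<le> i"
  shows "dual_transport N Vec g (carrier Dual) (act_neg g) (ev_bimod R Vec v) (unit_vec i) = \<zero>"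
proof -
  have "act_inv g (\<lambda>i. \<zero>) = (\<lambda>i. \<zero>)"
    using assms by (simp add: act_inv_def fun_eq_iff)
  moreover have "functional (\<lambda>i. \<zero>) \<in> carrier Dual" "functional (\<lambda>i. \<zero>) v = \<zero>"
    using assms functional_closed[of "\<lambda>i. \<zero>"] by (auto simp: functional_apply)
  ultimately show ?thesis
    using assms by (simp add: dual_transport_def unit_vec_outside inv_into_act_neg ev_bimod_def)
qed

lemma act_pos_sandwich:
  assumes g: "g \<in> carrier G" "\<pi> g = 1" and b: "b \<in> carrier Mat" and v: "v \<in> carrier Vec"
    and a: "a \<in> carrier R"
  shows "act_pos g (sandwich Vec b v a) = sandwich Vec (str1 g b) (act_pos g v) (w g a)"
proof
  fix j
  have "(\<Oplus>l\<in>{..<n}. str1 g b j l \<otimes> act_pos g v l) =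
      (\<Oplus>l\<in>{..<n}. d g j \<otimes> (w g (b (p g j) (p g l)) \<otimes> w g (v (p g l))))"
    using assms by (intro finsum_cong' refl) (auto simp: str1_def act_pos_def tr_def m_assoc d_unit)
  also have "\<dots> = d g j \<otimes> w g (\<Oplus>l\<in>{..<n}. b (p g j) l \<otimes> v l)"
    using assms by (simp add: w_dot_pos finsum_rdistr Pi_def)
  finally show "act_pos g (sandwich Vec b v a) j = sandwich Vec (str1 g b) (act_pos g v) (w g a) j"
    using assms by (simp add: sandwich_def) (simp add: act_pos_def w_mult_pos m_assoc)
qed

text \<open>A matrix multiplies the coordinates of \<open>f\<close> as a row vector from the right.
  The reversal by \<open>w g\<close> turns this into a product with a column, of the transposed
  matrix, and so accounts for \<open>tr\<close> in \<open>str1\<close>.\<close>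

lemma act_neg_sandwich:
  assumes g: "g \<in> carrier G" "\<pi> g = -1" and b: "b \<in> carrier Mat" and f: "f \<in> carrier Dual"
    and a: "a \<in> carrier R"
  shows "act_neg g (sandwich Dual b f a) = sandwich Vec (str1 g b) (act_neg g f) (w g a)"
proof
  fix j
  have "f (lact Vec b (unit_vec i)) = (\<Oplus>m\<in>{..<n}. f (unit_vec m) \<otimes> b m i)" for i
    using Dual_expansion[OF f lact_Vec_closed[OF b unit_vec_closed]]
    unfolding lact_unit_vec[OF b] .
  then have *: "sandwich Dual b f a (unit_vec i) = a \<otimes> (\<Oplus>m\<in>{..<n}. f (unit_vec m) \<otimes> b m i)" for i
    using unit_vec_closed by (simp add: sandwich_def del: vec_over_simps)
  have "(\<Oplus>l\<in>{..<n}. str1 g b j l \<otimes> act_neg g f l) =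
      (\<Oplus>l\<in>{..<n}. d g j \<otimes> (w g (b (p g l) (p g j)) \<otimes> w g (f (unit_vec (p g l)))))"
    using assms
    by (intro finsum_cong' refl) (auto simp: str1_def act_neg_def act_pos_def tr_def m_assoc d_unit)
  also have "\<dots> = d g j \<otimes> w g (\<Oplus>l\<in>{..<n}. f (unit_vec l) \<otimes> b l (p g j))"
    using assms by (simp add: w_dot_neg finsum_rdistr Pi_def)
  finally show "act_neg g (sandwich Dual b f a) j = sandwich Vec (str1 g b) (act_neg g f) (w g a) j"
    using assms by (simp add: sandwich_def[of Vec]) (simp add: act_neg_def act_pos_def * w_mult_neg m_assoc)
qed

lemma sandwich_one: "\<lbrakk>v \<in> carrier Vec; a \<in> carrier R\<rbrakk> \<Longrightarrow> sandwich Vec \<one>\<^bsub>Mat\<^esub> v a = ract Vec v a"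
  using bimodule.lact_one[OF bimodule_Vec] by (simp add: sandwich_def del: vec_over_simps mat_over_simps)

theorem one_morphism_Vec: "one_morphism K X N strictification Vec act_pos act_neg"
proof (rule one_morphism.intro, unfold alg_N strictification_simps)
  show "bimodule K Mat R Vec" by (rule bimodule_Vec)
next
  fix g assume g: "g \<in> carrier G" "\<pi> g = 1"
  show "act_pos g \<in> linear_iso K Vec Vec"
    using act_pos_bij[OF g(1)] g
    by (auto simp: linear_iso_def act_pos_def w_add w_smult r_distr smult_mult_right fun_eq_iff)
next
  fix g assume g: "g \<in> carrier G" "\<pi> g = -1"
  show "act_neg g \<in> linear_iso K Dual Vec"
    using act_neg_bij[OF g(1)] g unit_vec_closed
    by (auto simp: linear_iso_def act_neg_def act_pos_def w_add w_smult r_distr smult_mult_right fun_eq_iff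
        simp del: vec_over_simps(1))
next
  fix v assume "v \<in> carrier Vec"
  then show "act_pos \<one>\<^bsub>G\<^esub> v = v"
    using N.om1_one[unfolded alg_N] by (simp add: act_pos_def p_one d_one fun_eq_iff)
next
  fix g h v assume g: "g \<in> carrier G" "\<pi> g = 1" and h: "h \<in> carrier G" "\<pi> h = 1" and v: "v \<in> carrier Vec"
  then show "act_pos (g \<otimes>\<^bsub>G\<^esub> h) v = sandwich Vec \<one>\<^bsub>Mat\<^esub> (act_pos g (act_pos h v)) (inv om3 N g h)"
    by (subst sandwich_one) (simp_all add: act_pos_comp act_pos_closed om3_unit del: vec_over_simps)
next
  fix g h f assume g: "g \<in> carrier G" "\<pi> g = 1" and h: "h \<in> carrier G" "\<pi> h = -1" and f: "f \<in> carrier Dual"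
  then show "act_neg (g \<otimes>\<^bsub>G\<^esub> h) f = sandwich Vec \<one>\<^bsub>Mat\<^esub> (act_pos g (act_neg h f)) (inv om3 N g h)"
    unfolding act_neg_def
    by (subst sandwich_one) (simp_all add: act_pos_comp act_pos_closed coords_closed om3_unit del: vec_over_simps)
next
  fix g h f assume g: "g \<in> carrier G" "\<pi> g = -1" and h: "h \<in> carrier G" "\<pi> h = 1" and f: "f \<in> carrier Dual"
  let ?f = "dual_transport N Vec h (carrier Vec) (act_pos h) f"
  have eq: "act_neg (g \<otimes>\<^bsub>G\<^esub> h) f = ract Vec (act_neg g ?f) (inv om3 N g h)"
    unfolding act_neg_def[of "g \<otimes>\<^bsub>G\<^esub> h"] using g h f
    by (intro act_neg_comp coords_closed transport_pos transport_outside_pos) auto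
  \<comment> \<open>\<open>act_neg\<close> reads only the values at unit vectors, so these alone
    show that its result lies in \<open>Vec\<close>.\<close>
  have "?f (unit_vec i) \<in> carrier R \<and> (n \<le> i \<longrightarrow> ?f (unit_vec i) = \<zero>)" for i
    using g h f transport_pos[OF h f, of i] transport_outside_pos[OF h(1) f, of i] by (cases "i < n") auto
  then have "act_neg g ?f \<in> carrier Vec"
    unfolding act_neg_def using g by (intro act_pos_closed) auto
  then show "act_neg (g \<otimes>\<^bsub>G\<^esub> h) f = sandwich Vec \<one>\<^bsub>Mat\<^esub> (act_neg g ?f) (inv om3 N g h)"
    unfolding eq using g h by (subst sandwich_one) (simp_all add: om3_unit del: vec_over_simps)
next
  fix g h v assume g: "g \<in> carrier G" "\<pi> g = -1" and h: "h \<in> carrier G" "\<pi> h = -1" and v: "v \<in> carrier Vec"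
  let ?f = "dual_transport N Vec h (carrier Dual) (act_neg h) (ev_bimod R Vec v)"
  have eq: "act_pos (g \<otimes>\<^bsub>G\<^esub> h) v = ract Vec (act_neg g ?f) (inv om3 N g h)"
    using g h v by (intro act_neg_comp transport_neg transport_outside_neg)
  have "?f (unit_vec i) \<in> carrier R \<and> (n \<le> i \<longrightarrow> ?f (unit_vec i) = \<zero>)" for i
    using g h v transport_neg[OF h v, of i] transport_outside_neg[OF h(1) v, of i] by (cases "i < n") auto
  then have "act_neg g ?f \<in> carrier Vec"
    unfolding act_neg_def using g by (intro act_pos_closed) auto
  then show "act_pos (g \<otimes>\<^bsub>G\<^esub> h) v = sandwich Vec \<one>\<^bsub>Mat\<^esub> (act_neg g ?f) (inv om3 N g h)"
    unfolding eq using g h by (subst sandwich_one) (simp_all add: om3_unit del: vec_over_simps)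
next
  \<comment> \<open>By \<open>w_bdry\<close> the entry is
    \<open>d \<otimes> om2 \<otimes> v \<otimes> inv om2\<close>; the part before \<open>v\<close>
    is the coefficient of \<open>str2 x\<close>.\<close>
  fix x v assume x: "x \<in> carrier (grp2 X)" and v: "v \<in> carrier Vec"
  then show "act_pos (bd x) v = sandwich Vec (str2 x) v (inv om2 N x)"
    by (auto simp: sandwich_def str2_def monomial_lact p_less act_pos_def w_bdry m_assoc fun_eq_iff
        p_not_less not_less)
qed (simp_all add: act_pos_sandwich act_neg_sandwich)

theorem morita_equivalent_strictification:
  "0 < n \<Longrightarrow> morita_equivalent K X N strictification"
  unfolding morita_equivalent_def using one_morphism_Vec invertible_Vec
  by (auto simp: alg_N)

end

section \<open>Matrices over split semisimple algebras\<close>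

text \<open>Division with remainder identifies the indices below \<open>n * d\<close> with pairs of
  a block and a position in it. This is what block multiplication of matrices needs.\<close>

lemma (in abelian_monoid) finsum_div_mod:
  fixes n d :: nat
  assumes "\<And>l m. \<lbrakk>l < n; m < d\<rbrakk> \<Longrightarrow> g l m \<in> carrier G"
  shows "(\<Oplus>L\<in>{..<n * d}. g (L div d) (L mod d)) = (\<Oplus>l\<in>{..<n}. \<Oplus>m\<in>{..<d}. g l m)"
  using assms
proof (induction n)
  case (Suc n)
  have g: "g (L div d) (L mod d) \<in> carrier G" if "L < Suc n * d" for L
    using that Suc.prems by (metis div_less_iff_less_mult gr_zeroI mod_less_divisor mult_0_right not_less_zero)
  have "(+) (n * d) ` {..<d} = {n * d..<n * d + d}"
    using image_add_atLeastLessThan[of "n * d" 0 d] by (simp add: lessThan_atLeast0 add.commute)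
  then have "{..<Suc n * d} = {..<n * d} \<union> (+) (n * d) ` {..<d}"
    by auto
  then have "(\<Oplus>L\<in>{..<Suc n * d}. g (L div d) (L mod d)) =
      (\<Oplus>L\<in>{..<n * d}. g (L div d) (L mod d)) \<oplus> (\<Oplus>L\<in>(+) (n * d) ` {..<d}. g (L div d) (L mod d))"
    using g by (simp only:) (intro finsum_Un_disjoint; auto)
  also have "(\<Oplus>L\<in>(+) (n * d) ` {..<d}. g (L div d) (L mod d)) =
      (\<Oplus>m\<in>{..<d}. g ((n * d + m) div d) ((n * d + m) mod d))"
    using Suc.prems by (intro finsum_reindex) auto
  also have "\<dots> = (\<Oplus>m\<in>{..<d}. g n m)"
    using Suc.prems by (intro finsum_cong' refl) auto
  also have "(\<Oplus>L\<in>{..<n * d}. g (L div d) (L mod d)) = (\<Oplus>l\<in>{..<n}. \<Oplus>m\<in>{..<d}. g l m)"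
    using Suc by simp
  finally show ?case
    using Suc.prems by (simp add: lessThan_Suc a_comm Pi_def)
qed simp

lemma alg_isoI:
  assumes "bij_betw f (carrier A) (carrier B)"
    and "\<And>x y. \<lbrakk>x \<in> carrier A; y \<in> carrier A\<rbrakk> \<Longrightarrow> f (x \<otimes>\<^bsub>A\<^esub> y) = f x \<otimes>\<^bsub>B\<^esub> f y"
    and "\<And>x y. \<lbrakk>x \<in> carrier A; y \<in> carrier A\<rbrakk> \<Longrightarrow> f (x \<oplus>\<^bsub>A\<^esub> y) = f x \<oplus>\<^bsub>B\<^esub> f y"
    and "f \<one>\<^bsub>A\<^esub> = \<one>\<^bsub>B\<^esub>"
    and "\<And>k x. \<lbrakk>k \<in> carrier K; x \<in> carrier A\<rbrakk> \<Longrightarrow> f (k \<odot>\<^bsub>A\<^esub> x) = k \<odot>\<^bsub>B\<^esub> f x"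
  shows "f \<in> alg_iso K A B"
  using assms by (auto simp: alg_iso_def ring_iso_def ring_hom_def bij_betw_def)

abbreviation matrix_product :: "'k ring \<Rightarrow> nat \<Rightarrow> (nat \<Rightarrow> nat) \<Rightarrow> ('k, nat \<Rightarrow> nat \<times> nat \<Rightarrow> 'k) module" where
  "matrix_product K r d \<equiv> product_alg {..<r} (\<lambda>i. matrix_alg K (d i))"

lemma matrix_product_eqI:
  assumes "x \<in> carrier (matrix_product K r d)" "y \<in> carrier (matrix_product K r d)"
    and "\<And>s i j. \<lbrakk>s < r; i < d s; j < d s\<rbrakk> \<Longrightarrow> x s (i, j) = y s (i, j)"
  shows "x = y"
proof (rule PiE_ext)
  show "x \<in> (\<Pi>\<^sub>E i\<in>{..<r}. carrier (matrix_alg K (d i)))" "y \<in> (\<Pi>\<^sub>E i\<in>{..<r}. carrier (matrix_alg K (d i)))"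
    using assms(1,2) by (simp_all add: product_alg_def)
  fix s assume s: "s \<in> {..<r}"
  then have "x s \<in> {..<d s} \<times> {..<d s} \<rightarrow>\<^sub>E carrier K" "y s \<in> {..<d s} \<times> {..<d s} \<rightarrow>\<^sub>E carrier K"
    using assms(1,2) by (auto simp: product_alg_def matrix_alg_def)
  then show "x s = y s"
    using assms(3) s by (intro PiE_ext) auto
qed

text \<open>A matrix whose entries are themselves families of matrices of sizes \<open>d s\<close>
  is a family of block matrices of sizes \<open>n * d s\<close>. Applying \<open>f\<close> entrywise
  and erasing the block boundaries is the isomorphism.\<close>

lemma split_semisimple_mat_over:
  fixes K :: "'k ring" and A :: "('k, 'a) module" (structure)
  assumes A: "assoc_algebra K A" and n: "0 < n" and ss: "split_semisimple K A"
  shows "split_semisimple K (mat_over A n)"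
proof -
  interpret matrices K A n
    using A by (simp add: matrices_def)
  obtain r :: nat and d f where d: "\<And>i. i < r \<Longrightarrow> 1 \<le> d i"
    and f: "f \<in> alg_iso K A (matrix_product K r d)"
    using ss unfolding split_semisimple_def by blast
  have f_closed: "f a \<in> carrier (matrix_product K r d)" if "a \<in> carrier A" for a
    using f that by (auto simp: alg_iso_def ring_iso_def ring_hom_def)
  have f_bij: "bij_betw f (carrier A) (carrier (matrix_product K r d))"
    using f by (auto simp: alg_iso_def ring_iso_def)
  define F where "F s x y a = f a s (x, y)" for s x y a
  have F_closed: "F s x y a \<in> carrier K" if "s < r" "x < d s" "y < d s" "a \<in> carrier A" for s x y a
    using f_closed[OF that(4)] that by (auto simp: F_def product_alg_def matrix_alg_def PiE_def Pi_def)
  have F_add: "F s x y (a \<oplus> b) = F s x y a \<oplus>\<^bsub>K\<^esub> F s x y b"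
    if "s < r" "x < d s" "y < d s" "a \<in> carrier A" "b \<in> carrier A" for s x y a b
    using f that by (simp add: F_def alg_iso_def ring_iso_def ring_hom_def product_alg_def matrix_alg_def)
  have F_mult: "F s x y (a \<otimes> b) = (\<Oplus>\<^bsub>K\<^esub>l\<in>{..<d s}. F s x l a \<otimes>\<^bsub>K\<^esub> F s l y b)"
    if "s < r" "x < d s" "y < d s" "a \<in> carrier A" "b \<in> carrier A" for s x y a b
    using f that by (simp add: F_def alg_iso_def ring_iso_def ring_hom_def product_alg_def matrix_alg_def)
  have F_one: "F s x y \<one> = (if x = y then \<one>\<^bsub>K\<^esub> else \<zero>\<^bsub>K\<^esub>)" if "s < r" "x < d s" "y < d s" for s x y
    using f that by (simp add: F_def alg_iso_def ring_iso_def ring_hom_def product_alg_def matrix_alg_def)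
  have F_smult: "F s x y (k \<odot> a) = k \<otimes>\<^bsub>K\<^esub> F s x y a"
    if "s < r" "x < d s" "y < d s" "k \<in> carrier K" "a \<in> carrier A" for s x y k a
    using f that by (simp add: F_def alg_iso_def product_alg_def matrix_alg_def)
  have F_sum: "F s x y (\<Oplus>i\<in>I. g i) = (\<Oplus>\<^bsub>K\<^esub>i\<in>I. F s x y (g i))"
    if "s < r" "x < d s" "y < d s" "finite I" "\<And>i. i \<in> I \<Longrightarrow> g i \<in> carrier A" for s x y and I :: "nat set" and g
    using that F_closed F_add
    by (intro finsum_additive[OF is_abelian_group R.is_abelian_group]) auto
  have F_zero: "F s x y \<zero> = \<zero>\<^bsub>K\<^esub>" if "s < r" "x < d s" "y < d s" for s x y
    using F_sum[OF that, of "{}"] by simp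
  \<comment> \<open>The quotients by \<open>d s\<close> select the entry of \<open>b\<close>, that
    is the block, and the remainders the position inside it.\<close>
  define \<Phi> where "\<Phi> b = (\<lambda>s\<in>{..<r}. \<lambda>q\<in>{..<n * d s} \<times> {..<n * d s}.
    F s (fst q mod d s) (snd q mod d s) (b (fst q div d s) (snd q div d s)))" for b
  \<comment> \<open>The inverse cuts out the block at \<open>(i, j)\<close> in every factor and
    pulls the resulting family back along \<open>f\<close>.\<close>
  define \<Psi> where "\<Psi> q i j = (if i < n \<and> j < n then
      inv_into (carrier A) f (\<lambda>s\<in>{..<r}. \<lambda>u\<in>{..<d s} \<times> {..<d s}. q s (i * d s + fst u, j * d s + snd u))
    else \<zero>)" for q :: "nat \<Rightarrow> nat \<times> nat \<Rightarrow> 'k" and i j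
  let ?P = "matrix_product K r (\<lambda>i. n * d i)"
  have mod: "x mod d s < d s" if "s < r" for x s
    using d[OF that] by simp
  have div: "x div d s < n" if "x < n * d s" for x s
    using that by (metis less_mult_imp_div_less)
  have block: "i * d s + x < n * d s" if "i < n" "x < d s" for i x s
  proof -
    have "i * d s + x < Suc i * d s" using that by simp
    also have "\<dots> \<le> n * d s" using that by (intro mult_le_mono1) simp
    finally show ?thesis .
  qed
  have \<Phi>_entry: "\<Phi> b s (x, y) = F s (x mod d s) (y mod d s) (b (x div d s) (y div d s))"
    if "s < r" "x < n * d s" "y < n * d s" for b s x y
    using that by (simp add: \<Phi>_def)
  have \<Phi>_closed: "\<Phi> b \<in> carrier ?P" if "b \<in> carrier Mat" for b
    using that mod F_closed by (auto simp: \<Phi>_def product_alg_def matrix_alg_def)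
  have arg_closed: "(\<lambda>s\<in>{..<r}. \<lambda>u\<in>{..<d s} \<times> {..<d s}. q s (i * d s + fst u, j * d s + snd u))
      \<in> carrier (matrix_product K r d)"
    if q: "q \<in> carrier ?P" and "i < n" "j < n" for q i j
  proof -
    have "q s (i * d s + x, j * d s + y) \<in> carrier K" if "s < r" "x < d s" "y < d s" for s x y
    proof -
      have "q s \<in> {..<n * d s} \<times> {..<n * d s} \<rightarrow> carrier K"
        using q that by (auto simp: product_alg_def matrix_alg_def PiE_def Pi_def)
      then show ?thesis
        using block that \<open>i < n\<close> \<open>j < n\<close> by (auto simp: Pi_def)
    qed
    then show ?thesis
      by (auto simp: product_alg_def matrix_alg_def split: if_splits)
  qed
  have \<Psi>_closed: "\<Psi> q \<in> carrier Mat" if "q \<in> carrier ?P" for q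
    using arg_closed[OF that] f_bij by (auto simp: \<Psi>_def bij_betw_def inv_into_into)
  have f_\<Psi>: "f (\<Psi> q i j) = (\<lambda>s\<in>{..<r}. \<lambda>u\<in>{..<d s} \<times> {..<d s}. q s (i * d s + fst u, j * d s + snd u))"
    if "q \<in> carrier ?P" "i < n" "j < n" for q i j
    using arg_closed[OF that] f_bij that by (simp add: \<Psi>_def bij_betw_def f_inv_into_f)
  have \<Phi>\<Psi>: "\<Phi> (\<Psi> q) = q" if "q \<in> carrier ?P" for q
  proof (rule matrix_product_eqI[OF \<Phi>_closed[OF \<Psi>_closed[OF that]] that])
    fix s x y assume "s < r" "x < n * d s" "y < n * d s"
    then show "\<Phi> (\<Psi> q) s (x, y) = q s (x, y)"
      using f_\<Psi>[OF that div div] mod by (simp add: \<Phi>_entry F_def)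
  qed
  have \<Psi>\<Phi>: "\<Psi> (\<Phi> b) = b" if b: "b \<in> carrier Mat" for b
  proof (intro ext)
    fix i j
    show "\<Psi> (\<Phi> b) i j = b i j"
    proof (cases "i < n \<and> j < n")
      case True
      then have "f (\<Psi> (\<Phi> b) i j) = f (b i j)"
        unfolding f_\<Psi>[OF \<Phi>_closed[OF b] conjunct1[OF True] conjunct2[OF True]]
        using arg_closed[OF \<Phi>_closed[OF b], of i j] b f_closed block
        by (intro matrix_product_eqI) (auto simp: \<Phi>_entry F_def)
      moreover have "\<Psi> (\<Phi> b) i j \<in> carrier A" "b i j \<in> carrier A"
        using b \<Psi>_closed[OF \<Phi>_closed[OF b]] by auto
      ultimately show ?thesis
        using f_bij by (auto simp: bij_betw_def dest: inj_onD)
    next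
      case False
      then show ?thesis
        using b by (auto simp: \<Psi>_def not_less)
    qed
  qed
  have "\<Phi> \<in> alg_iso K Mat ?P"
  proof (rule alg_isoI)
    show "bij_betw \<Phi> (carrier Mat) (carrier ?P)"
      using \<Phi>_closed \<Psi>_closed \<Phi>\<Psi> \<Psi>\<Phi> by (intro bij_betw_byWitness[where f' = \<Psi>]) (auto simp del: mat_over_simps)
  next
    fix b c assume b: "b \<in> carrier Mat" and c: "c \<in> carrier Mat"
    show "\<Phi> (b \<otimes>\<^bsub>Mat\<^esub> c) = \<Phi> b \<otimes>\<^bsub>?P\<^esub> \<Phi> c"
    proof -
      have "F s (x mod d s) (y mod d s) (\<Oplus>l\<in>{..<n}. b (x div d s) l \<otimes> c l (y div d s)) =
          (\<Oplus>\<^bsub>K\<^esub>L\<in>{..<n * d s}. \<Phi> b s (x, L) \<otimes>\<^bsub>K\<^esub> \<Phi> c s (L, y))"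
        if "s < r" "x < n * d s" "y < n * d s" for s x y
      proof -
        \<comment> \<open>One sum comes from the product in \<open>Mat\<close>, the other from the
          product inside a block; \<open>finsum_div_mod\<close> fuses them into a single sum over
          \<open>L\<close>.\<close>
        have "F s (x mod d s) (y mod d s) (\<Oplus>l\<in>{..<n}. b (x div d s) l \<otimes> c l (y div d s)) =
            (\<Oplus>\<^bsub>K\<^esub>l\<in>{..<n}. \<Oplus>\<^bsub>K\<^esub>m\<in>{..<d s}. F s (x mod d s) m (b (x div d s) l) \<otimes>\<^bsub>K\<^esub> F s m (y mod d s) (c l (y div d s)))"
          using that b c mod by (simp add: F_sum F_mult)
        also have "\<dots> = (\<Oplus>\<^bsub>K\<^esub>L\<in>{..<n * d s}. F s (x mod d s) (L mod d s) (b (x div d s) (L div d s))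
            \<otimes>\<^bsub>K\<^esub> F s (L mod d s) (y mod d s) (c (L div d s) (y div d s)))"
          using that b c mod F_closed by (intro R.finsum_div_mod[symmetric]) auto
        also have "\<dots> = (\<Oplus>\<^bsub>K\<^esub>L\<in>{..<n * d s}. \<Phi> b s (x, L) \<otimes>\<^bsub>K\<^esub> \<Phi> c s (L, y))"
          using that b c mod F_closed by (intro R.finsum_cong' refl) (auto simp: \<Phi>_entry)
        finally show ?thesis .
      qed
      then show ?thesis
        by (simp, subst \<Phi>_def) (auto simp: product_alg_def matrix_alg_def intro!: restrict_ext)
    qed
    show "\<Phi> (b \<oplus>\<^bsub>Mat\<^esub> c) = \<Phi> b \<oplus>\<^bsub>?P\<^esub> \<Phi> c"
      using b c mod by (auto simp: \<Phi>_def product_alg_def matrix_alg_def F_add intro!: restrict_ext)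
  next
    have "F s (x mod d s) (y mod d s) (\<one>\<^bsub>Mat\<^esub> (x div d s) (y div d s)) = (if x = y then \<one>\<^bsub>K\<^esub> else \<zero>\<^bsub>K\<^esub>)"
      if "s < r" "x < n * d s" "y < n * d s" for s x y
    proof (cases "x = y")
      case False
      then have "x div d s \<noteq> y div d s \<or> x mod d s \<noteq> y mod d s"
        by (metis div_mult_mod_eq)
      then show ?thesis
        using False that mod by (auto simp: F_one F_zero)
    qed (use that mod div in \<open>simp add: F_one\<close>)
    then show "\<Phi> \<one>\<^bsub>Mat\<^esub> = \<one>\<^bsub>?P\<^esub>"
      by (auto simp: \<Phi>_def product_alg_def matrix_alg_def simp del: mat_over_simps(3) intro!: restrict_ext)
  next
    fix k b assume "k \<in> carrier K" "b \<in> carrier Mat"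
    then show "\<Phi> (k \<odot>\<^bsub>Mat\<^esub> b) = k \<odot>\<^bsub>?P\<^esub> \<Phi> b"
      using mod by (auto simp: \<Phi>_def product_alg_def matrix_alg_def F_smult intro!: restrict_ext)
  qed
  moreover have "1 \<le> n * d i" if "i < r" for i
    using d[OF that] n by simp
  ultimately show ?thesis
    unfolding split_semisimple_def
    by (intro exI[of _ r] exI[of _ "\<lambda>i. n * d i"]) auto
qed

section \<open>Strict algebras over a finite crossed module\<close>

context graded_crossed_module
begin

sublocale G1: group "grp1 X" by (fact group1)
sublocale G2: group "grp2 X" by (fact group2)

lemma actn_closed: "\<lbrakk>g \<in> carrier (grp1 X); x \<in> carrier (grp2 X)\<rbrakk> \<Longrightarrow> actn X g x \<in> carrier (grp2 X)"
  by (rule hom_in_carrier[OF actn_hom])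

lemma bdry_closed: "x \<in> carrier (grp2 X) \<Longrightarrow> bdry X x \<in> carrier (grp1 X)"
  by (rule hom_in_carrier[OF bdry_hom])

lemma bdry_one: "bdry X \<one>\<^bsub>grp2 X\<^esub> = \<one>\<^bsub>grp1 X\<^esub>"
  by (rule hom_one[OF bdry_hom group2 group1])

lemma actn_on_one: "g \<in> carrier (grp1 X) \<Longrightarrow> actn X g \<one>\<^bsub>grp2 X\<^esub> = \<one>\<^bsub>grp2 X\<^esub>"
  by (rule hom_one[OF actn_hom group2 group2])

lemma grading_one: "grading X \<one>\<^bsub>grp1 X\<^esub> = 1"
  using grading_bdry[OF G2.one_closed] by (simp add: bdry_one)

end

theorem strict_algebra_exists:
  fixes K :: "'k ring" and X :: "('g, 'x) xmod" and N :: "('k, 'a, 'g, 'x) nwalg"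
  assumes X: "graded_crossed_module X" and fin: "finite (carrier (grp1 X))" and N: "nweak_algebra K X N"
  obtains B :: "('k, nat \<Rightarrow> nat \<Rightarrow> 'a, 'g, 'x) nwalg"
  where "strict_algebra K X B" and "morita_equivalent K X N B"
    and "split_semisimple K (alg N) \<Longrightarrow> split_semisimple K (alg B)"
proof -
  interpret X: graded_crossed_module X by fact
  interpret N: nweak_algebra K X N by fact
  interpret A: assoc_algebra K "alg N" by (rule N.assoc_algebra)
  define n where "n = card (carrier (grp1 X))"
  obtain e where e: "bij_betw e {..<n} (carrier (grp1 X))"
    using ex_bij_betw_nat_finite[OF fin] by (auto simp: n_def lessThan_atLeast0)
  have n: "0 < n"
    using fin X.G1.one_closed by (auto simp: n_def card_gt_0_iff)
  \<comment> \<open>Beyond \<open>n\<close> the map \<open>p g\<close> is the identity and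
    \<open>d g\<close> is \<open>\<one>\<close>, so the conditions of \<open>twisting\<close> hold
    for all indices except \<open>d_mult\<close>, which there would force \<open>om3 N g h\<close>
    to be trivial.\<close>
  define p where "p g j = (if j < n then inv_into {..<n} e (inv\<^bsub>grp1 X\<^esub> g \<otimes>\<^bsub>grp1 X\<^esub> e j) else j)" for g j
  define d where "d g j = (if j < n then om3 N g (inv\<^bsub>grp1 X\<^esub> g \<otimes>\<^bsub>grp1 X\<^esub> e j) else \<one>\<^bsub>alg N\<^esub>)" for g j
  have e_closed: "e j \<in> carrier (grp1 X)" if "j < n" for j
    using bij_betwE[OF e] that by simp
  have p_less: "p g j < n \<longleftrightarrow> j < n" if "g \<in> carrier (grp1 X)" for g j
    using bij_betw_apply[OF bij_betw_inv_into[OF e], of "inv\<^bsub>grp1 X\<^esub> g \<otimes>\<^bsub>grp1 X\<^esub> e j"] that e_closed[of j]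
    by (auto simp: p_def)
  have e_p: "e (p g j) = inv\<^bsub>grp1 X\<^esub> g \<otimes>\<^bsub>grp1 X\<^esub> e j" if "g \<in> carrier (grp1 X)" "j < n" for g j
    using bij_betw_inv_into_right[OF e] that e_closed[of j] by (simp add: p_def)
  have p_mult: "p (g \<otimes>\<^bsub>grp1 X\<^esub> h) j = p h (p g j)"
    if "g \<in> carrier (grp1 X)" "h \<in> carrier (grp1 X)" for g h j
  proof (cases "j < n")
    case True
    then show ?thesis
      using that p_less[OF that(1), of j] e_closed[of j]
      by (simp add: p_def[of "g \<otimes>\<^bsub>grp1 X\<^esub> h"] p_def[of h] e_p X.G1.inv_mult_group X.G1.m_assoc)
  qed (simp add: p_def)
  have d_mult: "d (g \<otimes>\<^bsub>grp1 X\<^esub> h) j \<otimes>\<^bsub>alg N\<^esub> om3 N g h = d g j \<otimes>\<^bsub>alg N\<^esub> unit_act X N g (d h (p g j))"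
    if "g \<in> carrier (grp1 X)" "h \<in> carrier (grp1 X)" "j < n" for g h j
  proof -
    \<comment> \<open>The cocycle identity is applied to \<open>g\<close>, \<open>h\<close> and this
      element: \<open>h \<otimes> ?k\<close> and \<open>?k\<close> are the group elements with
      indices \<open>p g j\<close> and \<open>p h (p g j)\<close>.\<close>
    let ?k = "inv\<^bsub>grp1 X\<^esub> (g \<otimes>\<^bsub>grp1 X\<^esub> h) \<otimes>\<^bsub>grp1 X\<^esub> e j"
    have k: "?k \<in> carrier (grp1 X)" "h \<otimes>\<^bsub>grp1 X\<^esub> ?k = inv\<^bsub>grp1 X\<^esub> g \<otimes>\<^bsub>grp1 X\<^esub> e j"
      "inv\<^bsub>grp1 X\<^esub> h \<otimes>\<^bsub>grp1 X\<^esub> e (p g j) = ?k"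
      using that e_closed[of j] e_p[of g j]
      by (simp_all add: X.G1.inv_mult_group X.G1.m_assoc flip: X.G1.m_assoc[of h])
    show ?thesis
      using N.om3_cocycle[OF that(1,2) k(1)] that k(2,3) p_less[of g j] by (simp add: d_def)
  qed
  interpret twisting K X N "alg N" n p d
  proof
    fix j
    show "p \<one>\<^bsub>grp1 X\<^esub> j = j"
      using bij_betw_inv_into_left[OF e] e_closed[of j] by (simp add: p_def)
    show "d \<one>\<^bsub>grp1 X\<^esub> j = \<one>\<^bsub>alg N\<^esub>"
      using N.om3_one_left e_closed[of j] by (simp add: d_def)
    fix g assume "g \<in> carrier (grp1 X)"
    then show "d g j \<in> Units (alg N)"
      using N.om3_unit e_closed[of j] by (simp add: d_def)
  qed (use X N p_less p_mult d_mult in auto)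
  show ?thesis
    using strict_strictification morita_equivalent_strictification[OF n]
      split_semisimple_mat_over[OF N.assoc_algebra n]
    by (intro that[of strictification]) simp_all
qed


section \<open>Pullbacks and strict isomorphisms of crossed modules\<close>

lemma nweak_algebra_pullback:
  assumes Y: "graded_crossed_module Y" and X: "graded_crossed_module X"
    and \<phi>: "xmod_hom Y X \<phi>1 \<phi>2" and N: "nweak_algebra K X N"
  shows "nweak_algebra K Y (pullback_nwalg \<phi>1 \<phi>2 N)"
proof -
  interpret X: graded_crossed_module X by fact
  interpret Y: graded_crossed_module Y by fact
  interpret N: nweak_algebra K X N by fact
  interpret \<phi>1: group_hom "grp1 Y" "grp1 X" \<phi>1
    using \<phi> by unfold_locales (simp add: xmod_hom_def)
  interpret \<phi>2: group_hom "grp2 Y" "grp2 X" \<phi>2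
    using \<phi> by unfold_locales (simp add: xmod_hom_def)
  have [simp]: "\<And>y. y \<in> carrier (grp2 Y) \<Longrightarrow> \<phi>1 (bdry Y y) = bdry X (\<phi>2 y)"
    "\<And>h y. \<lbrakk>h \<in> carrier (grp1 Y); y \<in> carrier (grp2 Y)\<rbrakk> \<Longrightarrow> \<phi>2 (actn Y h y) = actn X (\<phi>1 h) (\<phi>2 y)"
    and gr: "\<And>h. h \<in> carrier (grp1 Y) \<Longrightarrow> grading Y h = grading X (\<phi>1 h)"
    using \<phi> by (simp_all add: xmod_hom_def)
  have act: "unit_act Y (pullback_nwalg \<phi>1 \<phi>2 N) h u = unit_act X N (\<phi>1 h) u" if "h \<in> carrier (grp1 Y)" for h u
    using that by (simp add: unit_act_def pullback_nwalg_def gr)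
  show ?thesis
    by (rule nweak_algebra.intro)
      (simp_all add: act, simp_all add: pullback_nwalg_def gr N.assoc_algebra N.om3_unit N.om3_one_left
        N.om3_one_right N.om1_iso N.om1_one N.om2_unit N.om2_one N.om1_mult N.om2_mult N.om1_bdry
        N.om3_cocycle N.om2_actn Y.bdry_closed)
qed

section \<open>Strict homomorphisms of crossed modules as maps of 2-groups\<close>

lemma two_group_of_simps [simp]:
  "carrier (two_group_of X) = carrier (grp1 X)"
  "g \<otimes>\<^bsub>two_group_of X\<^esub> h = g \<otimes>\<^bsub>grp1 X\<^esub> h"
  "\<one>\<^bsub>two_group_of X\<^esub> = \<one>\<^bsub>grp1 X\<^esub>"
  "cells (two_group_of X) = carrier (grp1 X) \<times> carrier (grp2 X)"
  "src (two_group_of X) c = fst c"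
  "tgt (two_group_of X) (g, x) = bdry X x \<otimes>\<^bsub>grp1 X\<^esub> g"
  "idc (two_group_of X) g = (g, \<one>\<^bsub>grp2 X\<^esub>)"
  "vcomp (two_group_of X) (h, y) (g, x) = (g, y \<otimes>\<^bsub>grp2 X\<^esub> x)"
  "hcomp (two_group_of X) (g, x) (h, y) = (g \<otimes>\<^bsub>grp1 X\<^esub> h, x \<otimes>\<^bsub>grp2 X\<^esub> actn X g y)"
  "degr (two_group_of X) = grading X"
  by (simp_all add: two_group_of_def)

lemma two_group_hom_induced:
  assumes Y: "graded_crossed_module Y" and X: "graded_crossed_module X" and \<phi>: "xmod_hom Y X \<phi>1 \<phi>2"
  shows "two_group_hom (two_group_of Y) (two_group_of X) (induced_two_group_map Y X \<phi>1 \<phi>2)"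
proof -
  interpret X: graded_crossed_module X by fact
  interpret Y: graded_crossed_module Y by fact
  interpret \<phi>1: group_hom "grp1 Y" "grp1 X" \<phi>1
    using \<phi> by unfold_locales (simp add: xmod_hom_def)
  interpret \<phi>2: group_hom "grp2 Y" "grp2 X" \<phi>2
    using \<phi> by unfold_locales (simp add: xmod_hom_def)
  have "\<And>y. y \<in> carrier (grp2 Y) \<Longrightarrow> \<phi>1 (bdry Y y) = bdry X (\<phi>2 y)"
    "\<And>h y. \<lbrakk>h \<in> carrier (grp1 Y); y \<in> carrier (grp2 Y)\<rbrakk> \<Longrightarrow> \<phi>2 (actn Y h y) = actn X (\<phi>1 h) (\<phi>2 y)"
    "\<And>h. h \<in> carrier (grp1 Y) \<Longrightarrow> grading X (\<phi>1 h) = grading Y h"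
    using \<phi> by (simp_all add: xmod_hom_def)
  then show ?thesis
    by (auto simp: two_group_hom_def induced_two_group_map_def X.bdry_closed Y.bdry_closed
        X.bdry_one X.actn_on_one X.actn_closed Y.actn_closed X.actn_one X.G1.m_assoc)
qed

text \<open>The composite is the identity on 1- and 2-morphisms and its compositors are identities,
  so identity 2-morphisms serve as components.\<close>

lemma two_group_trans_of_inverse:
  assumes Y: "graded_crossed_module Y" and X: "graded_crossed_module X"
    and \<phi>: "xmod_hom Y X \<phi>1 \<phi>2" and \<psi>: "xmod_hom X Y \<psi>1 \<psi>2"
    and inv1: "\<And>h. h \<in> carrier (grp1 Y) \<Longrightarrow> \<psi>1 (\<phi>1 h) = h"
    and inv2: "\<And>y. y \<in> carrier (grp2 Y) \<Longrightarrow> \<psi>2 (\<phi>2 y) = y"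
  shows "two_group_trans (two_group_of Y) (two_group_of Y)
    (two_group_comp (two_group_of Y) (induced_two_group_map X Y \<psi>1 \<psi>2) (induced_two_group_map Y X \<phi>1 \<phi>2))
    (two_group_id (two_group_of Y)) \<one>\<^bsub>grp1 Y\<^esub> (\<lambda>h. (h, \<one>\<^bsub>grp2 Y\<^esub>))"
proof -
  interpret X: graded_crossed_module X by fact
  interpret Y: graded_crossed_module Y by fact
  interpret \<phi>1: group_hom "grp1 Y" "grp1 X" \<phi>1
    using \<phi> by unfold_locales (simp add: xmod_hom_def)
  interpret \<psi>1: group_hom "grp1 X" "grp1 Y" \<psi>1
    using \<psi> by unfold_locales (simp add: xmod_hom_def)
  interpret \<psi>2: group_hom "grp2 X" "grp2 Y" \<psi>2
    using \<psi> by unfold_locales (simp add: xmod_hom_def)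
  show ?thesis
    by (auto simp: two_group_trans_def two_group_comp_def two_group_id_def induced_two_group_map_def
        inv1 inv2 Y.grading_one Y.bdry_closed Y.bdry_one Y.actn_on_one Y.actn_closed Y.actn_one)
qed

lemma two_group_equivalence_of_iso:
  assumes "graded_crossed_module Y" "graded_crossed_module X"
    and "xmod_hom Y X \<phi>1 \<phi>2" "xmod_hom X Y \<psi>1 \<psi>2"
    and "\<And>h. h \<in> carrier (grp1 Y) \<Longrightarrow> \<psi>1 (\<phi>1 h) = h" "\<And>y. y \<in> carrier (grp2 Y) \<Longrightarrow> \<psi>2 (\<phi>2 y) = y"
    and "\<And>g. g \<in> carrier (grp1 X) \<Longrightarrow> \<phi>1 (\<psi>1 g) = g" "\<And>x. x \<in> carrier (grp2 X) \<Longrightarrow> \<phi>2 (\<psi>2 x) = x"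
  shows "two_group_equivalence (two_group_of Y) (two_group_of X) (induced_two_group_map Y X \<phi>1 \<phi>2)"
  unfolding two_group_equivalence_def
  using two_group_hom_induced[of Y X \<phi>1 \<phi>2] two_group_hom_induced[of X Y \<psi>1 \<psi>2]
    two_group_trans_of_inverse[of Y X \<phi>1 \<phi>2 \<psi>1 \<psi>2] two_group_trans_of_inverse[of X Y \<psi>1 \<psi>2 \<phi>1 \<phi>2] assms
  by blast

text \<open>An isomorphic copy of \<open>X\<close> in the types that the theorem prescribes for \<open>H\<close>.\<close>

definition times_point :: "('g, 'x) xmod \<Rightarrow> 'a \<Rightarrow> ('g \<times> 'a, 'x \<times> 'a) xmod" where
  "times_point X u =
    \<lparr>grp1 = grp1 X \<times>\<times> singleton_group u, grp2 = grp2 X \<times>\<times> singleton_group u,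
     bdry = (\<lambda>(x, _). (bdry X x, u)), actn = (\<lambda>(g, _) (x, _). (actn X g x, u)),
     grading = (\<lambda>(g, _). grading X g)\<rparr>"

lemma (in graded_crossed_module) times_point:
  shows "graded_crossed_module (times_point X u)"
    and "xmod_hom (times_point X u) X fst fst"
    and "xmod_hom X (times_point X u) (\<lambda>g. (g, u)) (\<lambda>x. (x, u))"
proof -
  have inv1: "inv\<^bsub>grp1 X \<times>\<times> singleton_group u\<^esub> (g, u) = (inv\<^bsub>grp1 X\<^esub> g, u)" if "g \<in> carrier (grp1 X)" for g
    using that inv_DirProd[OF group1 singleton_group[of u]] group.inv_closed[OF singleton_group[of u]]
    by simp
  have inv2: "inv\<^bsub>grp2 X \<times>\<times> singleton_group u\<^esub> (x, u) = (inv\<^bsub>grp2 X\<^esub> x, u)" if "x \<in> carrier (grp2 X)" for x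
    using that inv_DirProd[OF group2 singleton_group[of u]] group.inv_closed[OF singleton_group[of u]]
    by simp
  have [simp]: "a \<otimes>\<^bsub>singleton_group u\<^esub> b = u" "\<one>\<^bsub>singleton_group u\<^esub> = u" for a b
    by (simp_all add: singleton_group_def)
  show "graded_crossed_module (times_point X u)"
  proof (rule graded_crossed_module.intro)
    show "group (grp1 (times_point X u))" "group (grp2 (times_point X u))"
      by (simp_all add: times_point_def DirProd_group group1 group2)
  qed (auto simp: times_point_def hom_def inv1 inv2 actn_closed bdry_closed
      hom_mult[OF actn_hom] hom_mult[OF bdry_hom] hom_mult[OF grading_hom] hom_in_carrier[OF grading_hom]
      actn_one actn_mult bdry_actn peiffer grading_bdry)
  show "xmod_hom (times_point X u) X fst fst" "xmod_hom X (times_point X u) (\<lambda>g. (g, u)) (\<lambda>x. (x, u))"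
    by (auto simp: xmod_hom_def times_point_def hom_def)
qed

theorem theorem1:
  fixes K :: "'k ring" and G :: "('g, 'x) xmod" and A :: "('k, 'a, 'g, 'x) nwalg"
  assumes "field K"
    and "graded_crossed_module G"
    and "finite (carrier (grp1 G))"
    and "nweak_algebra K G A"
  shows
    "(split_semisimple K (alg A) \<longrightarrow>
       (\<exists>B :: ('k, nat \<Rightarrow> nat \<Rightarrow> 'a, 'g, 'x) nwalg.
          strict_algebra K G B \<and> split_semisimple K (alg B) \<and> morita_equivalent K G A B)) \<and>
     (\<exists>(H :: ('g \<times> 'a, 'x \<times> 'a) xmod) \<phi>1 \<phi>2
        (B :: ('k, nat \<Rightarrow> nat \<Rightarrow> 'a, 'g \<times> 'a, 'x \<times> 'a) nwalg).
        graded_crossed_module H \<and> xmod_hom H G \<phi>1 \<phi>2 \<and>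
        two_group_equivalence (two_group_of H) (two_group_of G)
          (induced_two_group_map H G \<phi>1 \<phi>2) \<and>
        strict_algebra K H B \<and>
        morita_equivalent K H (pullback_nwalg \<phi>1 \<phi>2 A) B)"
proof -
  interpret graded_crossed_module G by fact
  \<comment> \<open>The second component only supplies the prescribed type; any element serves as
    the point.\<close>
  define u :: 'a where "u = undefined"
  let ?H = "times_point G u"
  have carrier_H: "carrier (grp1 ?H) = carrier (grp1 G) \<times> {u}" "carrier (grp2 ?H) = carrier (grp2 G) \<times> {u}"
    by (simp_all add: times_point_def)
  have N: "nweak_algebra K ?H (pullback_nwalg fst fst A)"
    by (rule nweak_algebra_pullback[OF times_point(1) assms(2) times_point(2) assms(4)])
  have equiv: "two_group_equivalence (two_group_of ?H) (two_group_of G) (induced_two_group_map ?H G fst fst)"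
    using times_point[of u] assms(2)
    by (intro two_group_equivalence_of_iso[of ?H G fst fst "\<lambda>g. (g, u)" "\<lambda>x. (x, u)"])
      (auto simp: carrier_H)
  obtain B :: "('k, nat \<Rightarrow> nat \<Rightarrow> 'a, 'g \<times> 'a, 'x \<times> 'a) nwalg"
    where B: "strict_algebra K ?H B" "morita_equivalent K ?H (pullback_nwalg fst fst A) B"
    using strict_algebra_exists[OF times_point(1) _ N] assms(3) by (auto simp: carrier_H)
  obtain B' :: "('k, nat \<Rightarrow> nat \<Rightarrow> 'a, 'g, 'x) nwalg"
    where B': "strict_algebra K G B'" "morita_equivalent K G A B'"
      "split_semisimple K (alg A) \<Longrightarrow> split_semisimple K (alg B')"
    using strict_algebra_exists[OF assms(2-4)] by metis
  show ?thesis
  proof (intro conjI impI)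
    assume "split_semisimple K (alg A)"
    then show "\<exists>B :: ('k, nat \<Rightarrow> nat \<Rightarrow> 'a, 'g, 'x) nwalg.
        strict_algebra K G B \<and> split_semisimple K (alg B) \<and> morita_equivalent K G A B"
      using B' by blast
  next
    show "\<exists>(H :: ('g \<times> 'a, 'x \<times> 'a) xmod) \<phi>1 \<phi>2
        (B :: ('k, nat \<Rightarrow> nat \<Rightarrow> 'a, 'g \<times> 'a, 'x \<times> 'a) nwalg).
        graded_crossed_module H \<and> xmod_hom H G \<phi>1 \<phi>2 \<and>
        two_group_equivalence (two_group_of H) (two_group_of G)
          (induced_two_group_map H G \<phi>1 \<phi>2) \<and>
        strict_algebra K H B \<and>
        morita_equivalent K H (pullback_nwalg \<phi>1 \<phi>2 A) B"
      using times_point(1,2)[of u] equiv B by blast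
  qed
qed

end
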